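(* There exists a sequence $(f_n, g_n)_{n}$ in $\mathcal{D}$ converging to $(\mathrm{id}, \mathrm{id})$ in the $C^1$-topology such that, for every $n$, the semigroup action $\langle f_n, g_n\rangle_+$ on $I=[0,1]$ has a minimal set that is not equal to $I$.
   Context: Let $I=[0,1]$. $\mathcal{C}$ is the set of pairs $(f,g)$ of continuous maps $f,g:I\to I$ such that: $f(0)=0$, $g(1)=1$; $0<f(x)<x$ for all $x\in I$, $x\neq 0$; $x<g(x)<1$ for all $x\in I$, $x\ne 1$; and $f,g$ are orientation preserving homeomorphisms onto their images. $\mathcal{D}\subset\mathcal{C}$ is the set of $(f,g)\in\mathcal{C}$ such that $f,g$ are $C^1$-diffeomorphisms onto their images and $f'(0),g'(1)\in(0,1)$. $\langle f,g\rangle_+$ denotes the semigroup of all finite compositions of $f$ and $g$, and $\mathcal{O}_+(x)=\{\phi(x)\mid \phi\in\langle f,g\rangle_+\}$ is the orbit of $x$. A non-empty set $M\subset I$ is a (forward) minimal set if $\overline{\mathcal{O}_+(x)}=M$ for every $x\in M$. For a $C^1$ map $f:I\to I$ put $d_{C^1}(f)=\sup_{x\in I}|f(x)-x|+\sup_{x\in I}|f'(x)-1|$. Convergence of $(f_n,g_n)$ to $(\mathrm{id},\mathrm{id})$ in the $C^1$-topology means $d_{C^1}(f_n)\to0$ and $d_{C^1}(g_n)\to 0$. *)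

theory Defs
  imports "HOL-Analysis.Analysis"
begin

text \<open>Maps of the unit interval are represented by functions \<open>real \<Rightarrow> real\<close>; only their
  values on \<open>unit_I\<close> matter below.\<close>

abbreviation unit_I :: "real set" where
  "unit_I \<equiv> {0..1}"

definition orientation_preserving_embedding :: "(real \<Rightarrow> real) \<Rightarrow> bool" where
  "orientation_preserving_embedding f \<longleftrightarrow>
     strict_mono_on unit_I f \<and> (\<exists>h. homeomorphism unit_I (f ` unit_I) f h)"

definition class_C :: "((real \<Rightarrow> real) \<times> (real \<Rightarrow> real)) set" where
  "class_C = {(f, g).
     continuous_on unit_I f \<and> f ` unit_I \<subseteq> unit_I \<and>
     continuous_on unit_I g \<and> g ` unit_I \<subseteq> unit_I \<and>
     f 0 = 0 \<and> g 1 = 1 \<and>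
     (\<forall>x\<in>unit_I. x \<noteq> 0 \<longrightarrow> 0 < f x \<and> f x < x) \<and>
     (\<forall>x\<in>unit_I. x \<noteq> 1 \<longrightarrow> x < g x \<and> g x < 1) \<and>
     orientation_preserving_embedding f \<and> orientation_preserving_embedding g}"

text \<open>Derivatives are taken within the domain, hence one-sided at the endpoints of an interval
  (unlike the library's \<open>C1_differentiable_on\<close>, which uses two-sided derivatives).\<close>

definition C1_within :: "real set \<Rightarrow> (real \<Rightarrow> real) \<Rightarrow> bool" where
  "C1_within S f \<longleftrightarrow>
     (\<exists>f'. (\<forall>x\<in>S. (f has_real_derivative f' x) (at x within S)) \<and> continuous_on S f')"

definition C1_diffeo_onto_image :: "(real \<Rightarrow> real) \<Rightarrow> bool" where
  "C1_diffeo_onto_image f \<longleftrightarrow>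
     inj_on f unit_I \<and> C1_within unit_I f \<and> C1_within (f ` unit_I) (inv_into unit_I f)"

definition deriv_I :: "(real \<Rightarrow> real) \<Rightarrow> real \<Rightarrow> real" where
  "deriv_I f x = vector_derivative f (at x within unit_I)"

definition class_D :: "((real \<Rightarrow> real) \<times> (real \<Rightarrow> real)) set" where
  "class_D = {(f, g) \<in> class_C.
     C1_diffeo_onto_image f \<and> C1_diffeo_onto_image g \<and>
     deriv_I f 0 \<in> {0<..<1} \<and> deriv_I g 1 \<in> {0<..<1}}"

text \<open>Compositions have at least one factor. Including the identity would not change which sets
  are minimal.\<close>

inductive_set semigroup_gen :: "(real \<Rightarrow> real) \<Rightarrow> (real \<Rightarrow> real) \<Rightarrow> (real \<Rightarrow> real) set"
  for f g :: "real \<Rightarrow> real" where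
  gen_left: "f \<in> semigroup_gen f g"
| gen_right: "g \<in> semigroup_gen f g"
| gen_comp: "\<phi> \<in> semigroup_gen f g \<Longrightarrow> \<psi> \<in> semigroup_gen f g \<Longrightarrow> \<phi> \<circ> \<psi> \<in> semigroup_gen f g"

definition forward_orbit :: "(real \<Rightarrow> real) \<Rightarrow> (real \<Rightarrow> real) \<Rightarrow> real \<Rightarrow> real set" where
  "forward_orbit f g x = {\<phi> x | \<phi>. \<phi> \<in> semigroup_gen f g}"

definition minimal_set :: "(real \<Rightarrow> real) \<Rightarrow> (real \<Rightarrow> real) \<Rightarrow> real set \<Rightarrow> bool" where
  "minimal_set f g M \<longleftrightarrow>
     M \<noteq> {} \<and> M \<subseteq> unit_I \<and> (\<forall>x\<in>M. closure (forward_orbit f g x) = M)"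

text \<open>For \<open>f\<close> of class C1 on the compact interval, both suprema are over bounded sets.\<close>

definition d_C1 :: "(real \<Rightarrow> real) \<Rightarrow> real" where
  "d_C1 f = (SUP x\<in>unit_I. \<bar>f x - x\<bar>) + (SUP x\<in>unit_I. \<bar>deriv_I f x - 1\<bar>)"

end

theory Submission
  imports Defs "HOL-Computational_Algebra.Polynomial" "HOL-Library.Sublist"
begin

text \<open>Cut \<open>[0,1]\<close> into \<open>T\<close> gaps separated by short spaces. The inverse of \<open>f\<close> pushes the gaps to the
  right along a staircase \<open>n \<mapsto> shift n\<close> which at certain slips sends one gap onto two adjacent gaps and
  the space between them; \<open>g\<close> is the mirror image, with slips of its own. The complement of the spaces
  is then forward invariant and contains \<open>0\<close>, so it contains a minimal set. For \<open>f\<close> and \<open>g\<close> to be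
  close to the identity, the lengths of the gaps must be almost equal along the steps, and almost
  additive at the slips. Such lengths exist if different slips are far apart in the graph of steps
  and if no slip has both of its range gaps close to its domain gap.

  The first property is achieved by a greedy choice of the slips. For the second, the staircases follow
  a pair of projective maps \<open>h\<close>, \<open>k\<close> near the identity which play ping-pong for a valuation of the
  reals at an integer \<open>q\<close>. The ping-pong orients the Schreier graph of \<open>h\<close>, \<open>k\<close> on \<open>[0,1]\<close> so that
  each point has at most one outgoing edge; hence that graph has no finite subgraph with all
  degrees at least two and a branch point. Two short walks from a slip to its two range gaps would, as
  \<open>T\<close> tends to infinity, converge to such a subgraph.\<close>

section \<open>A valuation ring of the reals\<close>

text \<open>Slips cannot be avoided: as \<open>f 1 < 1\<close>, the \<open>T\<close> gaps are mapped
  into fewer than \<open>T\<close> gaps, so some gaps share an image. The lengths of such a pair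
  must add up to nearly the length of the image, which is impossible if all three are comparable;
  and gaps joined by a short walk are comparable, since each step changes lengths by a factor near
  1. This is why one of the range gaps has to be far away.

  Freeness of the group generated by \<open>h\<close> and \<open>k\<close> would not suffice. Points
  of \<open>[0,1]\<close> can have nontrivial stabilizers (\<open>h\<close> fixes \<open>0\<close>),
  so a cycle in the Schreier graph must be tolerated and only branching cycles excluded. Moreover
  the limits of positions \<open>n / T\<close> are arbitrary reals, so the valuation must be defined
  on all reals; it comes from Zorn's lemma.

  The constants are chosen in the order \<open>\<rho>\<close>, \<open>\<Lambda>\<close>,
  \<open>N\<close>, \<open>L\<close>, \<open>R\<close>, \<open>E\<close>, \<open>T\<close>. The
  number \<open>T\<close> of gaps comes last because it is found by a compactness argument, so all
  bounds on walks and on the freedom in placing slips have to be independent of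
  \<open>T\<close>.\<close>

definition subring_of_reals :: "real set \<Rightarrow> bool" where
  "subring_of_reals A \<longleftrightarrow> 1 \<in> A \<and> (\<forall>x\<in>A. \<forall>y\<in>A. x - y \<in> A \<and> x * y \<in> A)"

lemma subring_of_realsD:
  assumes "subring_of_reals A"
  shows "0 \<in> A" "1 \<in> A" "x \<in> A \<Longrightarrow> - x \<in> A" "x \<in> A \<Longrightarrow> y \<in> A \<Longrightarrow> x + y \<in> A"
    "x \<in> A \<Longrightarrow> y \<in> A \<Longrightarrow> x - y \<in> A" "x \<in> A \<Longrightarrow> y \<in> A \<Longrightarrow> x * y \<in> A"
proof -
  have one: "1 \<in> A" and d: "\<And>x y. x \<in> A \<Longrightarrow> y \<in> A \<Longrightarrow> x - y \<in> A"
    and m: "\<And>x y. x \<in> A \<Longrightarrow> y \<in> A \<Longrightarrow> x * y \<in> A"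
    using assms unfolding subring_of_reals_def by auto
  have z: "0 \<in> A" using d[OF one one] by simp
  have n: "- x \<in> A" if "x \<in> A" for x using d[OF z that] by simp
  have "x + y \<in> A" if "x \<in> A" "y \<in> A" for x y using d[OF that(1) n[OF that(2)]] by simp
  then show "0 \<in> A" "1 \<in> A" "x \<in> A \<Longrightarrow> - x \<in> A" "x \<in> A \<Longrightarrow> y \<in> A \<Longrightarrow> x + y \<in> A"
    "x \<in> A \<Longrightarrow> y \<in> A \<Longrightarrow> x - y \<in> A" "x \<in> A \<Longrightarrow> y \<in> A \<Longrightarrow> x * y \<in> A"
    using one d m z n by auto
qed

lemma subring_of_reals_power: "subring_of_reals A \<Longrightarrow> x \<in> A \<Longrightarrow> x ^ n \<in> A"
  by (induction n) (auto simp: subring_of_realsD)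

lemma subring_of_reals_sum:
  "subring_of_reals A \<Longrightarrow> (\<And>i. i \<in> I \<Longrightarrow> g i \<in> A) \<Longrightarrow> sum g I \<in> A"
  by (induction I rule: infinite_finite_induct) (auto simp: subring_of_realsD)

lemma subring_of_reals_of_nat: "subring_of_reals A \<Longrightarrow> real n \<in> A"
  by (induction n) (auto simp: subring_of_realsD)

lemma subring_of_reals_adjoin:
  assumes A: "subring_of_reals A"
  shows "subring_of_reals {poly p x |p. \<forall>i. coeff p i \<in> A}"
proof -
  have "1 \<in> {poly p x |p. \<forall>i. coeff p i \<in> A}"
    by (intro CollectI exI[of _ 1]) (auto simp: coeff_1 subring_of_realsD[OF A])
  moreover have "poly p x - poly r x \<in> {poly p x |p. \<forall>i. coeff p i \<in> A}"
    "poly p x * poly r x \<in> {poly p x |p. \<forall>i. coeff p i \<in> A}"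
    if "\<forall>i. coeff p i \<in> A" "\<forall>i. coeff r i \<in> A" for p r
    subgoal using that by (intro CollectI exI[of _ "p - r"]) (auto simp: subring_of_realsD[OF A])
    subgoal using that by (intro CollectI exI[of _ "p * r"])
      (auto simp: coeff_mult intro!: subring_of_reals_sum[OF A] subring_of_realsD[OF A])
    done
  ultimately show ?thesis unfolding subring_of_reals_def by blast
qed

text \<open>Multiplying \<open>poly r (1/x) = e\<close> by \<open>c\<close> and collecting the
  constant terms puts the unit \<open>1 - c * coeff r 0\<close> on one side; dividing by it and
  multiplying by \<open>x ^ n\<close> expresses \<open>x ^ n\<close> through lower powers of
  \<open>x\<close>. Substitution into the leading term of \<open>p\<close> lowers its degree. In the
  application \<open>e = 1 / q\<close> and \<open>c = q\<close>.\<close>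

lemma reduce_degree:
  fixes x c :: real
  assumes A: "subring_of_reals A" and c: "c \<in> A"
    and p: "\<forall>i. coeff p i \<in> A" "poly p x = e" "degree p = n" "n \<ge> 1"
    and r: "\<forall>i. coeff r i \<in> A" "poly r (1/x) = e" "degree r \<le> n"
    and x: "x \<noteq> 0" and ce: "c * e = 1" and u: "1 / (1 - c * coeff r 0) \<in> A" "1 - c * coeff r 0 \<noteq> 0"
  shows "\<exists>p'. (\<forall>i. coeff p' i \<in> A) \<and> poly p' x = e \<and> degree p' < n"
proof -
  define v where "v = 1 / (1 - c * coeff r 0)"
  have eq: "e = (\<Sum>j\<le>n. coeff r j * (1/x) ^ j)"
  proof -
    have "poly r (1/x) = (\<Sum>j\<le>n. coeff r j * (1/x) ^ j)"
      unfolding poly_altdef using r(3)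
      by (intro sum.mono_neutral_left) (auto simp: coeff_eq_0)
    then show ?thesis using r(2) by simp
  qed
  have "{..n} = insert 0 {1..n}" by auto
  then have "e = coeff r 0 + (\<Sum>j\<in>{1..n}. coeff r j * (1/x) ^ j)" using eq by simp
  then have "1 = c * coeff r 0 + c * (\<Sum>j\<in>{1..n}. coeff r j * (1/x) ^ j)"
    using ce by (metis distrib_left)
  then have "1 = v * (c * (\<Sum>j\<in>{1..n}. coeff r j * (1/x) ^ j))"
    using u(2) unfolding v_def by (simp add: field_simps)
  then have "x ^ n = v * (c * (\<Sum>j\<in>{1..n}. coeff r j * (1/x) ^ j)) * x ^ n" by simp
  also have "\<dots> = (\<Sum>j\<in>{1..n}. v * c * coeff r j * ((1/x) ^ j * x ^ n))"
    by (simp add: sum_distrib_left sum_distrib_right mult_ac)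
  also have "\<dots> = (\<Sum>j\<in>{1..n}. v * c * coeff r j * x ^ (n - j))"
    using x by (intro sum.cong) (auto simp: power_diff power_one_over field_simps)
  finally have xn: "x ^ n = (\<Sum>j\<in>{1..n}. v * c * coeff r j * x ^ (n - j))" .
  define s where "s = (\<Sum>j\<in>{1..n}. monom (v * c * coeff r j) (n - j))"
  have s1: "coeff s i \<in> A" for i
    unfolding s_def coeff_sum coeff_monom
    using r(1) c u(1) unfolding v_def[symmetric]
    by (intro subring_of_reals_sum[OF A]) (auto intro!: subring_of_realsD[OF A])
  have s2: "poly s x = x ^ n" unfolding s_def xn by (simp add: poly_sum poly_monom)
  have s3: "coeff s i = 0" if "i \<ge> n" for i
    unfolding s_def coeff_sum coeff_monom using that by (intro sum.neutral) auto
  define p' where "p' = p - monom (coeff p n) n + smult (coeff p n) s"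
  have "\<forall>i. coeff p' i \<in> A"
    unfolding p'_def using p(1) s1 by (auto simp: subring_of_realsD[OF A])
  moreover have "poly p' x = e" unfolding p'_def using p(2) s2 by (simp add: poly_monom)
  moreover have "degree p' \<le> n - 1"
  proof (rule degree_le, intro allI impI)
    fix i assume "n - 1 < i"
    then have "i \<ge> n" by simp
    then show "coeff p' i = 0" unfolding p'_def using s3[of i] p(3)
      by (cases "i = n") (auto simp: coeff_eq_0)
  qed
  ultimately show ?thesis using p(4) by (intro exI[of _ p']) auto
qed

text \<open>Chevalley's extension theorem for the reals: a subring that is maximal among those
  without \<open>1 / q\<close> is a valuation ring. The convention \<open>1 / 0 = 0\<close> is
  harmless, as \<open>0\<close> lies in \<open>V\<close>.\<close>

lemma exists_valuation_ring:
  fixes q :: nat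
  assumes q: "q > 1"
  shows "\<exists>V. subring_of_reals V \<and> 1 / real q \<notin> V \<and> (\<forall>x. x \<in> V \<or> 1 / x \<in> V)"
proof -
  define \<A> where "\<A> = {A. subring_of_reals A \<and> 1 / real q \<notin> A}"
  have Z: "range real_of_int \<in> \<A>"
  proof -
    have "1 / real q \<noteq> real_of_int k" for k
    proof
      assume "1 / real q = real_of_int k"
      then have "1 = real_of_int (k * int q)" using q by (simp add: field_simps)
      then have "k * int q = 1" by linarith
      then show False using q zmult_eq_1_iff by auto
    qed
    moreover have "subring_of_reals (range real_of_int)"
      unfolding subring_of_reals_def
      by (auto simp flip: of_int_diff of_int_mult intro: image_eqI[of _ _ 1])
    ultimately show ?thesis unfolding \<A>_def by auto
  qed
  have "\<exists>M\<in>\<A>. \<forall>X\<in>\<A>. M \<subseteq> X \<longrightarrow> X = M"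
  proof (rule subset_Zorn_nonempty)
    show "\<A> \<noteq> {}" using Z by auto
    fix C assume C: "C \<noteq> {}" "subset.chain \<A> C"
    have "subring_of_reals (\<Union>C)"
      unfolding subring_of_reals_def
    proof (intro conjI ballI)
      obtain X0 where "X0 \<in> C" using C(1) by auto
      moreover have "1 \<in> X0" using \<open>X0 \<in> C\<close> C(2) subring_of_realsD(2)
        unfolding subset.chain_def \<A>_def by blast
      ultimately show "1 \<in> \<Union>C" by auto
      fix x y assume "x \<in> \<Union>C" "y \<in> \<Union>C"
      then obtain X Y where XY: "X \<in> C" "x \<in> X" "Y \<in> C" "y \<in> Y" by auto
      then obtain B where B: "B \<in> C" "x \<in> B" "y \<in> B"
        using C(2) unfolding subset.chain_def by blast
      then have "subring_of_reals B" using C(2) unfolding subset.chain_def \<A>_def by auto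
      then have "x - y \<in> B" "x * y \<in> B" using B(2,3) subring_of_realsD by auto
      then show "x - y \<in> \<Union>C" "x * y \<in> \<Union>C" using B(1) by auto
    qed
    then show "\<Union>C \<in> \<A>" using C unfolding subset.chain_def \<A>_def by auto
  qed
  then obtain A where A: "subring_of_reals A" "1 / real q \<notin> A"
    and max: "\<And>B. subring_of_reals B \<Longrightarrow> 1 / real q \<notin> B \<Longrightarrow> A \<subseteq> B \<Longrightarrow> B = A"
    unfolding \<A>_def by auto
  have qA: "real q \<in> A" by (rule subring_of_reals_of_nat[OF A(1)])
  \<comment> \<open>This places \<open>q\<close> in the Jacobson radical of \<open>A\<close>. Powers
    of \<open>u = 1 - q b\<close> are again \<open>1\<close> modulo \<open>q\<close>, so inverting
    \<open>u\<close> does not create \<open>1 / q\<close>, and maximality gives \<open>1 / u\<close>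
    in \<open>A\<close>.\<close>
  have unit: "1 - real q * b \<noteq> 0 \<and> 1 / (1 - real q * b) \<in> A" if b: "b \<in> A" for b
  proof -
    define u where "u = 1 - real q * b"
    have uA: "u \<in> A" unfolding u_def using b qA by (auto simp: subring_of_realsD[OF A(1)])
    have u0: "u \<noteq> 0"
    proof
      assume "u = 0"
      then have "1 / real q = b" using q unfolding u_def by (simp add: field_simps)
      then show False using A(2) b by simp
    qed
    define B where "B = {a / u ^ k |a k. a \<in> A}"
    have "\<exists>b'\<in>A. u ^ k = 1 - real q * b'" for k
    proof (induction k)
      case 0 show ?case by (rule bexI[of _ 0]) (auto simp: subring_of_realsD[OF A(1)])
    next
      case (Suc k)
      then obtain b' where b': "b' \<in> A" "u ^ k = 1 - real q * b'" by auto
      have "u ^ Suc k = 1 - real q * (b + b' - real q * (b * b'))"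
        by (simp add: b'(2)) (simp add: u_def algebra_simps)
      moreover have "b + b' - real q * (b * b') \<in> A"
        using b'(1) b qA by (auto intro!: subring_of_realsD[OF A(1)])
      ultimately show ?case by blast
    qed
    then have "1 / real q \<notin> B"
    proof (intro notI)
      assume "1 / real q \<in> B"
      then obtain a k where a: "a \<in> A" "1 / real q = a / u ^ k" unfolding B_def by auto
      obtain b' where b': "b' \<in> A" "u ^ k = 1 - real q * b'"
        using \<open>\<And>k. \<exists>b'\<in>A. u ^ k = 1 - real q * b'\<close> by auto
      have "u ^ k = real q * a" using a(2) u0 q by (simp add: field_simps)
      then have "1 / real q = a + b'" using b'(2) q by (simp add: field_simps)
      then show False using A(2) a(1) b'(1) by (auto simp: subring_of_realsD[OF A(1)])
    qed
    moreover have "subring_of_reals B"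
      unfolding subring_of_reals_def
    proof (intro conjI ballI)
      show "1 \<in> B" unfolding B_def
        by (intro CollectI exI[of _ 1] exI[of _ 0]) (auto simp: subring_of_realsD[OF A(1)])
      fix x y assume "x \<in> B" "y \<in> B"
      then obtain a k a' k' where *: "x = a / u ^ k" "y = a' / u ^ k'" "a \<in> A" "a' \<in> A"
        unfolding B_def by auto
      have "x - y = (a * u ^ k' - a' * u ^ k) / u ^ (k + k')"
        using u0 by (simp add: * power_add field_simps)
      then show "x - y \<in> B" unfolding B_def using *(3,4) uA
        by (intro CollectI exI[of _ "a * u ^ k' - a' * u ^ k"] exI[of _ "k + k'"])
          (auto intro!: subring_of_realsD[OF A(1)] subring_of_reals_power[OF A(1)])
      show "x * y \<in> B" unfolding B_def using *(3,4)
        by (intro CollectI exI[of _ "a * a'"] exI[of _ "k + k'"])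
          (auto simp: * power_add intro!: subring_of_realsD[OF A(1)])
    qed
    moreover have "A \<subseteq> B"
    proof
      fix a assume "a \<in> A"
      then show "a \<in> B" unfolding B_def by (intro CollectI exI[of _ a] exI[of _ 0]) auto
    qed
    ultimately have "B = A" by (intro max)
    moreover have "1 / u \<in> B" unfolding B_def
      by (intro CollectI exI[of _ 1]) (auto simp: subring_of_realsD[OF A(1)] intro: exI[of _ 1])
    ultimately show ?thesis using u0 unfolding u_def by auto
  qed
  define Q where "Q x p \<longleftrightarrow> (\<forall>i. coeff p i \<in> A) \<and> poly p x = 1 / real q" for x p
  have ex: "\<exists>p. Q x p" if "x \<notin> A" for x
  proof (rule ccontr)
    let ?B = "{poly p x |p. \<forall>i. coeff p i \<in> A}"
    assume "\<not> ?thesis"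
    then have "1 / real q \<notin> ?B" unfolding Q_def by auto
    moreover have "A \<subseteq> ?B"
    proof
      fix a assume "a \<in> A"
      then show "a \<in> ?B" by (intro CollectI exI[of _ "[:a:]"])
          (auto simp: coeff_pCons subring_of_realsD[OF A(1)] split: nat.split)
    qed
    ultimately have "?B = A" by (intro max subring_of_reals_adjoin A(1))
    moreover have "x \<in> ?B"
      by (intro CollectI exI[of _ "[:0, 1:]"])
        (auto simp: coeff_pCons subring_of_realsD[OF A(1)] split: nat.split)
    ultimately show False using that by auto
  qed
  \<comment> \<open>Of two relations of least degree, one for \<open>x\<close> and one for
    \<open>1 / x\<close>, the longer can be shortened by means of the other; below, \<open>x\<close>
    and \<open>1 / x\<close> are interchanged if \<open>r\<close> is the longer one.\<close>
  have main: False if p: "Q x p" "\<And>p'. Q x p' \<Longrightarrow> degree p \<le> degree p'"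
    and r: "Q (1/x) r" and le: "degree r \<le> degree p" for x p r
  proof -
    have "degree p \<ge> 1"
    proof (rule ccontr)
      assume "\<not> ?thesis"
      then have "degree p = 0" by simp
      then obtain a where "p = [:a:]" using degree_eq_zeroE by blast
      then have "coeff p 0 = 1 / real q" using p(1) unfolding Q_def by simp
      then show False using p(1) A(2) unfolding Q_def by metis
    qed
    have "x \<noteq> 0"
    proof
      assume "x = 0"
      then have "coeff p 0 = 1 / real q" using p(1) unfolding Q_def by (simp add: poly_0_coeff_0)
      then show False using p(1) A(2) unfolding Q_def by metis
    qed
    obtain p' where "Q x p'" "degree p' < degree p"
      using reduce_degree[OF A(1) qA, of p x "1 / real q" "degree p" r]
        p(1) r le \<open>degree p \<ge> 1\<close> \<open>x \<noteq> 0\<close> q unit[of "coeff r 0"]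
      unfolding Q_def by auto
    then show False using p(2) by fastforce
  qed
  have "x \<in> A \<or> 1 / x \<in> A" for x
  proof (rule ccontr)
    assume "\<not> ?thesis"
    then have nx: "x \<notin> A" "1 / x \<notin> A" by auto
    have least: "\<exists>p. Q y p \<and> (\<forall>p'. Q y p' \<longrightarrow> degree p \<le> degree p')" if "y \<notin> A" for y
      using ex[OF that] exists_least_iff[of "\<lambda>n. \<exists>p. Q y p \<and> degree p = n"]
      by (metis linorder_not_less)
    obtain p r where p: "Q x p" "\<And>p'. Q x p' \<Longrightarrow> degree p \<le> degree p'"
      and r: "Q (1/x) r" "\<And>p'. Q (1/x) p' \<Longrightarrow> degree r \<le> degree p'"
      using least[OF nx(1)] least[OF nx(2)] by auto
    show False
    proof (cases "degree r \<le> degree p")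
      case True then show False using main[OF p r(1)] by auto
    next
      case False
      then show False using main[of "1/x" r p] p r by auto
    qed
  qed
  then show ?thesis using A by blast
qed

section \<open>Schreier graphs with an orientation\<close>

text \<open>A letter \<open>(b, d)\<close> names one of the four maps \<open>h, h\<inverse>, k, k\<inverse>\<close>: \<open>b\<close> selects \<open>k\<close>,
  the mirror image of \<open>h\<close> under \<open>x \<mapsto> 1 - x\<close>, and \<open>d\<close> selects the inverse.\<close>

type_synonym letter = "bool \<times> bool"

definition inv_letter :: "letter \<Rightarrow> letter" where "inv_letter l = (fst l, \<not> snd l)"

definition mirror :: "bool \<Rightarrow> real \<Rightarrow> real" where "mirror b x = (if b then 1 - x else x)"

lemma inv_letter_simps [simp]: "inv_letter (b, d) = (b, \<not> d)" "inv_letter (inv_letter l) = l"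
  "inv_letter l \<noteq> l" "l \<noteq> inv_letter l"
  by (auto simp: inv_letter_def prod_eq_iff)

lemma mirror_mirror [simp]: "mirror b (mirror b x) = x"
  by (simp add: mirror_def)

lemma mirror_unit: "x \<in> {0..1} \<longleftrightarrow> mirror b x \<in> {0..1}"
  by (auto simp: mirror_def)

lemma mirror_diff: "\<bar>mirror b x - mirror b y\<bar> = \<bar>x - y\<bar>"
  by (simp add: mirror_def abs_minus_commute)

text \<open>\<open>bad\<close> orients every edge of the Schreier graph on \<open>[0,1]\<close>: each point has at most one
  outgoing edge, and each edge leaves one of its ends.\<close>

locale reference =
  fixes a :: "real \<Rightarrow> real" and E :: nat and bad :: "letter \<Rightarrow> real \<Rightarrow> bool"
  assumes E: "E > 0"
    and a_nonpos: "\<And>x. x \<le> 0 \<Longrightarrow> a x = 0"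
    and a_mono: "\<And>x y. x \<le> y \<Longrightarrow> a x \<le> a y"
    and a_slope: "\<And>x y. x \<le> y \<Longrightarrow> a y - a x \<le> (y - x) / real E"
    and a_le: "\<And>x. a x \<le> 1 / real E"
    and a_top: "\<And>x. a x \<le> a 1"
    and bad_unique: "\<And>x l l'. x \<in> {0..1} \<Longrightarrow> bad l x \<Longrightarrow> bad l' x \<Longrightarrow> l = l'"
    and bad_edge: "\<And>x b. x \<in> {0..1} \<Longrightarrow> mirror b x + a (mirror b x) \<in> {0..1} \<Longrightarrow>
      bad (b, False) x \<or> bad (b, True) (mirror b (mirror b x + a (mirror b x)))"
begin

text \<open>As \<open>a\<close> lives on the whole line, \<open>up\<close> is a bijection of the
  reals and words can be applied without domain conditions. Staying in \<open>[0,1]\<close> is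
  demanded only where the orientation is used.\<close>

definition up :: "real \<Rightarrow> real" where "up x = x + a x"

definition app :: "letter \<Rightarrow> real \<Rightarrow> real" where
  "app l x = mirror (fst l) ((if snd l then inv up else up) (mirror (fst l) x))"

definition app_word :: "letter list \<Rightarrow> real \<Rightarrow> real" where
  "app_word ws x = fold app ws x"

lemma app_word_simps [simp]: "app_word [] x = x" "app_word (l # ws) x = app_word ws (app l x)"
  "app_word (us @ vs) x = app_word vs (app_word us x)"
  by (simp_all add: app_word_def)

lemma a_nonneg: "a x \<ge> 0"
  using a_mono[of 0 x] a_nonpos[of 0] a_nonpos[of x] by (cases "x \<le> 0") auto

lemma up_expand: "\<bar>x - y\<bar> \<le> \<bar>up x - up y\<bar>"
  using a_mono[of x y] a_mono[of y x] by (cases "x \<le> y") (auto simp: up_def)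

lemma up_lipschitz: "\<bar>up x - up y\<bar> \<le> 2 * \<bar>x - y\<bar>"
proof -
  have *: "\<bar>up x - up y\<bar> \<le> 2 * \<bar>x - y\<bar>" if "x \<le> y" for x y
  proof -
    have "(y - x) * 1 \<le> (y - x) * real E" using E that by (intro mult_left_mono) auto
    then have "(y - x) / real E \<le> y - x" using E by (simp add: divide_le_eq)
    then show ?thesis using a_slope[OF that] a_mono[OF that] that by (auto simp: up_def)
  qed
  show ?thesis using *[of x y] *[of y x] by (cases "x \<le> y") auto
qed

lemma continuous_up: "continuous_on UNIV up"
proof -
  have "2-lipschitz_on UNIV up"
    by (rule lipschitz_onI) (auto simp: dist_real_def up_lipschitz)
  then show ?thesis by (rule lipschitz_on_continuous_on)
qed

lemma inj_up: "inj up"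
  using up_expand by (intro injI) (metis abs_le_zero_iff diff_self right_minus_eq abs_zero)

lemma bij_up: "bij up"
proof -
  have "y \<in> range up" for y
  proof -
    have "up (y - 1 / real E) \<le> y" "y \<le> up y"
      using a_le[of "y - 1 / real E"] a_nonneg[of y] by (auto simp: up_def)
    then obtain x where "up x = y"
      using IVT'[of up "y - 1 / real E" y y] continuous_on_subset[OF continuous_up] E by auto
    then show ?thesis by auto
  qed
  then show ?thesis using inj_up by (auto simp: bij_def)
qed

lemma up_inv [simp]: "up (inv up x) = x"
  using bij_up by (simp add: bij_is_surj surj_f_inv_f)

lemma inv_up [simp]: "inv up (up x) = x"
  using inj_up by simp

lemma inv_up_lipschitz: "\<bar>inv up x - inv up y\<bar> \<le> \<bar>x - y\<bar>"
  using up_expand[of "inv up x" "inv up y"] by simp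

lemma inv_up_expand: "\<bar>x - y\<bar> \<le> 2 * \<bar>inv up x - inv up y\<bar>"
  using up_lipschitz[of "inv up x" "inv up y"] by simp

lemma app_diff: "\<bar>app l x - app l y\<bar> =
    \<bar>(if snd l then inv up else up) (mirror (fst l) x) - (if snd l then inv up else up) (mirror (fst l) y)\<bar>"
  unfolding app_def mirror_diff by simp

lemma app_lipschitz: "\<bar>app l x - app l y\<bar> \<le> 2 * \<bar>x - y\<bar>"
proof -
  have "\<bar>inv up u - inv up v\<bar> \<le> 2 * \<bar>u - v\<bar>" for u v
    by (rule order_trans[OF inv_up_lipschitz]) simp
  then have "\<bar>app l x - app l y\<bar> \<le> 2 * \<bar>mirror (fst l) x - mirror (fst l) y\<bar>"
    unfolding app_diff using up_lipschitz by simp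
  then show ?thesis by (simp add: mirror_diff)
qed

lemma app_expand: "\<bar>x - y\<bar> \<le> 2 * \<bar>app l x - app l y\<bar>"
proof -
  have "\<bar>u - v\<bar> \<le> 2 * \<bar>up u - up v\<bar>" for u v
    by (rule order_trans[OF up_expand]) simp
  then have "\<bar>mirror (fst l) x - mirror (fst l) y\<bar> \<le> 2 * \<bar>app l x - app l y\<bar>"
    unfolding app_diff using inv_up_expand by simp
  then show ?thesis by (simp add: mirror_diff)
qed

text \<open>Forward letters do not contract at all, so going backwards along a letter does not
  increase rounding errors; \<open>near_step_backward\<close> relies on this to keep its
  constant.\<close>

lemma app_forward_expand: "\<bar>x - y\<bar> \<le> \<bar>app (b, False) x - app (b, False) y\<bar>"
  using up_expand[of "mirror b x" "mirror b y"] by (simp add: app_diff mirror_diff)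

lemma app_inv [simp]: "app (inv_letter l) (app l x) = x"
  by (cases l) (auto simp: app_def)

lemma app_inv' [simp]: "app l (app (inv_letter l) x) = x"
  using app_inv[of "inv_letter l" x] by simp

lemma app_displacement: "\<bar>app l x - x\<bar> \<le> 1 / real E"
proof -
  have u: "\<bar>up y - y\<bar> \<le> 1 / real E" for y using a_le[of y] a_nonneg[of y] by (simp add: up_def)
  have "\<bar>inv up y - y\<bar> \<le> 1 / real E" for y using u[of "inv up y"] by simp
  then have "\<bar>(if snd l then inv up else up) (mirror (fst l) x) - mirror (fst l) x\<bar> \<le> 1 / real E"
    using u by simp
  then show ?thesis unfolding app_def
    using mirror_diff[of "fst l" "(if snd l then inv up else up) (mirror (fst l) x)" "mirror (fst l) x"]
    by simp
qed

lemma app_word_expand: "\<bar>x - y\<bar> \<le> 2 ^ length ws * \<bar>app_word ws x - app_word ws y\<bar>"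
proof (induction ws arbitrary: x y)
  case (Cons l ws)
  have "\<bar>x - y\<bar> \<le> 2 * \<bar>app l x - app l y\<bar>" by (rule app_expand)
  also have "\<dots> \<le> 2 * (2 ^ length ws * \<bar>app_word ws (app l x) - app_word ws (app l y)\<bar>)"
    using Cons by (intro mult_left_mono) auto
  finally show ?case by simp
qed simp

lemma continuous_app: "continuous_on UNIV (app l)"
proof -
  have "2-lipschitz_on UNIV (app l)"
    by (rule lipschitz_onI) (auto simp: dist_real_def app_lipschitz)
  then show ?thesis by (rule lipschitz_on_continuous_on)
qed

lemma continuous_app_word: "continuous_on UNIV (app_word ws)"
proof (induction ws)
  case (Cons l ws)
  have "app_word (l # ws) = app_word ws \<circ> app l" by auto
  then show ?case using continuous_on_compose[OF continuous_app[of l]]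
      continuous_on_subset[OF Cons] by (metis subset_UNIV)
qed (auto simp: fun_eq_iff cong: continuous_on_cong)

lemma bad_app:
  assumes "x \<in> {0..1}" "app l x \<in> {0..1}"
  shows "bad l x \<or> bad (inv_letter l) (app l x)"
proof (cases l)
  case (Pair b d)
  show ?thesis
  proof (cases d)
    case False
    then have "app l x = mirror b (mirror b x + a (mirror b x))"
      by (simp add: Pair app_def up_def)
    then have "mirror b x + a (mirror b x) \<in> {0..1}"
      using assms(2) by (simp only: mirror_unit[symmetric])
    then have "bad (b, False) x \<or> bad (b, True) (app l x)"
      using bad_edge[of x b] assms(1) \<open>app l x = _\<close> by simp
    then show ?thesis using Pair False by auto
  next
    case True
    define y where "y = app l x"
    have x: "x = mirror b (mirror b y + a (mirror b y))"
      using app_inv[of l x] by (simp add: Pair True app_def up_def y_def)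
    have "mirror b y + a (mirror b y) \<in> {0..1}"
      using assms(1) unfolding x by (simp only: mirror_unit[symmetric])
    then have "bad (b, False) y \<or> bad (b, True) x"
      using bad_edge[of y b] assms(2) unfolding x[symmetric] by (simp add: y_def)
    then show ?thesis unfolding y_def[symmetric] using Pair True by auto
  qed
qed

text \<open>Handshake count: each half-edge is bad or has a bad reverse, and each vertex has at most
  one bad half-edge, so there are at most \<open>2 * card S\<close> half-edges. The degree
  assumptions force more.\<close>

lemma degree_contradiction:
  assumes S: "finite S" "S \<subseteq> {0..1}"
    and two: "\<And>x. x \<in> S \<Longrightarrow> \<exists>l l'. l \<noteq> l' \<and> app l x \<in> S \<and> app l' x \<in> S"
    and three: "x0 \<in> S" "distinct [l1, l2, l3]" "app l1 x0 \<in> S" "app l2 x0 \<in> S" "app l3 x0 \<in> S"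
  shows False
proof -
  define out where "out x = {l. app l x \<in> S}" for x
  \<comment> \<open>A half-edge is a vertex with a letter, so a letter fixing a vertex yields two of
    them, as a loop should.\<close>
  define HE where "HE = (SIGMA x:S. out x)"
  define flip where "flip p = (app (snd p) (fst p), inv_letter (snd p))" for p :: "real \<times> letter"
  define B where "B = {p \<in> HE. bad (snd p) (fst p)}"
  have fin: "finite (out x)" for x by simp
  have flip: "flip (flip p) = p" for p
    unfolding flip_def by (simp add: prod_eq_iff)
  have flip_HE: "flip p \<in> HE" if "p \<in> HE" for p
    using that unfolding HE_def flip_def out_def by (cases p) (simp del: inv_letter_simps(1))
  have HE: "finite HE" unfolding HE_def using S(1) fin by auto
  have "HE \<subseteq> B \<union> flip ` B"
  proof
    fix p assume p: "p \<in> HE"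
    then have "fst p \<in> S" "app (snd p) (fst p) \<in> S" unfolding HE_def out_def by auto
    then have "bad (snd p) (fst p) \<or> bad (snd (flip p)) (fst (flip p))"
      using bad_app[of "fst p" "snd p"] S(2) unfolding flip_def by (metis fst_conv snd_conv subsetD)
    then show "p \<in> B \<union> flip ` B"
    proof
      assume "bad (snd (flip p)) (fst (flip p))"
      then have "flip p \<in> B" using flip_HE[OF p] unfolding B_def by simp
      then have "flip (flip p) \<in> flip ` B" by (rule imageI)
      then show ?thesis by (simp only: flip UnI2)
    qed (use p in \<open>simp add: B_def\<close>)
  qed
  then have "card HE \<le> card (B \<union> flip ` B)"
    using HE by (intro card_mono) (auto simp: B_def)
  also have "\<dots> \<le> card B + card B"
    using card_Un_le[of B "flip ` B"] card_image_le[of B flip] HE by (auto simp: B_def)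
  also have "card B \<le> card S"
  proof (rule card_inj_on_le[of fst])
    show "inj_on fst B"
    proof (rule inj_onI)
      fix p p' assume "p \<in> B" "p' \<in> B" "fst p = fst p'"
      moreover from this have "snd p = snd p'"
        using bad_unique[of "fst p" "snd p" "snd p'"] S(2) unfolding B_def HE_def by auto
      ultimately show "p = p'" by (simp add: prod_eq_iff)
    qed
  qed (use S(1) in \<open>auto simp: B_def HE_def\<close>)
  finally have le: "card HE \<le> 2 * card S" by simp
  have "2 \<le> card (out x)" if x: "x \<in> S" for x
  proof -
    obtain l l' where "l \<noteq> l'" "{l, l'} \<subseteq> out x"
      using two[OF x] unfolding out_def by (metis (mono_tags, lifting) empty_subsetI insert_subset mem_Collect_eq)
    then show ?thesis using card_mono[OF fin, of "{l, l'}" x] by auto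
  qed
  moreover have "2 < card (out x0)"
  proof -
    have "{l1, l2, l3} \<subseteq> out x0" using three unfolding out_def by auto
    then have "card {l1, l2, l3} \<le> card (out x0)" by (intro card_mono fin)
    then show ?thesis using three(2) by simp
  qed
  ultimately have "(\<Sum>x\<in>S. 2) < (\<Sum>x\<in>S. card (out x))"
    using S(1) three(1) by (intro sum_strict_mono_ex1) auto
  also have "\<dots> = card HE" unfolding HE_def using S(1) fin by simp
  finally show False using le by simp
qed

end

section \<open>The reference maps\<close>

definition h0 :: "nat \<Rightarrow> real \<Rightarrow> real" where
  "h0 E x = (6 * real E + 2) * x / (6 * real E + 1 - x)"

text \<open>Clamping freezes the displacement outside \<open>[0,1]\<close>: the extended map is the
  identity on the left and a translation on the right.\<close>

definition ref_a :: "nat \<Rightarrow> real \<Rightarrow> real" where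
  "ref_a E x = (let t = min 1 (max 0 x) in h0 E t - t)"

lemma h0_diff:
  assumes "E > 0" "x \<le> 1" "y \<le> 1"
  shows "h0 E y - h0 E x = (y - x) * ((6 * real E + 2) * (6 * real E + 1) / ((6 * real E + 1 - x) * (6 * real E + 1 - y)))"
proof -
  have "6 * real E + 1 - x > 0" "6 * real E + 1 - y > 0" using assms by auto
  then show ?thesis unfolding h0_def by (simp add: divide_simps) (simp add: algebra_simps)
qed

lemma h0_slope:
  assumes E: "E > 0" and x: "0 \<le> x" "x \<le> y" "y \<le> 1"
  shows "y - x \<le> h0 E y - h0 E x" "h0 E y - h0 E x \<le> (y - x) * (1 + 1 / real E)"
proof -
  define m where "m = (6 * real E + 2) * (6 * real E + 1) / ((6 * real E + 1 - x) * (6 * real E + 1 - y))"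
  have d: "h0 E y - h0 E x = (y - x) * m" unfolding m_def using h0_diff[OF E] x by simp
  have pos: "6 * real E + 1 - x > 0" "6 * real E + 1 - y > 0" using E x by auto
  have "(6 * real E + 1 - x) * (6 * real E + 1 - y) \<le> (6 * real E + 2) * (6 * real E + 1)"
    using x E by (intro mult_mono) auto
  then have "1 \<le> m" unfolding m_def using pos by (simp add: le_divide_eq)
  have "m \<le> (6 * real E + 2) * (6 * real E + 1) / ((6 * real E) * (6 * real E))"
    unfolding m_def using x E by (intro divide_left_mono mult_mono) auto
  also have "\<dots> \<le> 1 + 1 / real E"
  proof -
    have "(6 * real E + 2) * (6 * real E + 1) \<le> (1 + 1 / real E) * ((6 * real E) * (6 * real E))"
      using E by (simp add: algebra_simps)
    then show ?thesis using E by (simp add: pos_divide_le_eq)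
  qed
  finally have "m \<le> 1 + 1 / real E" .
  then show "y - x \<le> h0 E y - h0 E x" "h0 E y - h0 E x \<le> (y - x) * (1 + 1 / real E)"
    unfolding d using \<open>1 \<le> m\<close> x mult_left_mono[of 1 m "y - x"] by (auto intro: mult_left_mono)
qed

text \<open>Of \<open>x / y\<close> and \<open>y / x\<close> one lies in \<open>V\<close>, so a sum
  of non-units is a multiple of one of them. The last claim also covers \<open>x\<close> outside
  \<open>V\<close>.\<close>

lemma non_units_ideal:
  assumes V: "subring_of_reals V" and val: "\<And>x. x \<in> V \<or> 1 / x \<in> V"
  defines "m \<equiv> {x \<in> V. x = 0 \<or> 1 / x \<notin> V}"
  shows "x \<in> m \<Longrightarrow> y \<in> m \<Longrightarrow> x + y \<in> m" "x \<in> m \<Longrightarrow> y \<in> V \<Longrightarrow> y * x \<in> m" "1 \<notin> m"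
    "x \<notin> m \<Longrightarrow> 1 / x \<in> V"
proof -
  have add: "x + y \<in> m" if xy: "x \<in> m" "y \<in> m" "y \<noteq> 0" "x / y \<in> V" for x y
  proof -
    have "x + y \<in> V" using xy unfolding m_def by (auto intro: subring_of_realsD[OF V])
    moreover have "1 / (x + y) \<notin> V" if "x + y \<noteq> 0"
    proof
      assume "1 / (x + y) \<in> V"
      then have "(1 + x / y) * (1 / (x + y)) \<in> V"
        using xy by (intro subring_of_realsD[OF V])
      moreover have "(1 + x / y) * (1 / (x + y)) = 1 / y"
        using that xy(3) by (simp add: add_divide_eq_iff add.commute)
      ultimately show False using xy(2,3) unfolding m_def by auto
    qed
    ultimately show ?thesis unfolding m_def by auto
  qed
  show "x + y \<in> m" if "x \<in> m" "y \<in> m"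
  proof (cases "x = 0 \<or> y = 0")
    case False
    then show ?thesis using add[of x y] add[of y x] val[of "x / y"] that by (auto simp: add.commute)
  qed (use that in auto)
  show "y * x \<in> m" if "x \<in> m" "y \<in> V"
  proof -
    have "y * x \<in> V" using that unfolding m_def by (auto intro: subring_of_realsD[OF V])
    moreover have "1 / (y * x) \<notin> V" if "y * x \<noteq> 0"
    proof
      assume "1 / (y * x) \<in> V"
      then have "y * (1 / (y * x)) \<in> V" using \<open>y \<in> V\<close> by (intro subring_of_realsD[OF V])
      then show False using that \<open>x \<in> m\<close> unfolding m_def by (auto simp: field_simps)
    qed
    ultimately show ?thesis unfolding m_def by auto
  qed
  show "1 \<notin> m" using subring_of_realsD(2)[OF V] unfolding m_def by auto
  show "1 / x \<in> V" if "x \<notin> m" using that val[of x] unfolding m_def by auto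
qed

text \<open>In the coordinate \<open>x / (x + 1)\<close> the map \<open>h0\<close> is multiplication by \<open>(q + 1) / q\<close> with
  \<open>q = 6 E + 1\<close>. For a valuation in which \<open>q\<close> is not a unit this is hyperbolic with repelling disc
  around \<open>0\<close> and attracting disc around \<open>-1\<close>; the discs around \<open>0, -1, 1, 2\<close> are disjoint since
  \<open>q\<close> is prime to \<open>6\<close>. A letter is bad at the points of its repelling disc (ping-pong).\<close>

lemma exists_reference:
  assumes E: "E > 0"
  shows "\<exists>bad. reference (ref_a E) E bad"
proof -
  define q where "q = 6 * E + 1"
  obtain V where V: "subring_of_reals V" and qV: "1 / real q \<notin> V" and val: "\<And>x. x \<in> V \<or> 1 / x \<in> V"
    using exists_valuation_ring[of q] E unfolding q_def by auto
  define m where "m = {x \<in> V. x = 0 \<or> 1 / x \<notin> V}"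
  note ideal = non_units_ideal[OF V val, folded m_def]
  have nat: "real n \<in> V" for n by (rule subring_of_reals_of_nat[OF V])
  have qm: "real q \<in> m" using qV nat[of q] unfolding m_def by auto
  have neg: "- x \<in> m" if "x \<in> m" for x using ideal(2)[OF that, of "-1"] subring_of_realsD[OF V] by auto
  have diff: "x - y \<in> m" if "x \<in> m" "y \<in> m" for x y using ideal(1)[OF that(1) neg[OF that(2)]] by simp
  \<comment> \<open>Modulo \<open>m\<close> the integer \<open>q\<close> vanishes, so
    \<open>6 E = -1\<close> and \<open>6\<close> is a unit.\<close>
  have six: "6 \<notin> m"
  proof
    assume "6 \<in> m"
    then have "real q - real E * 6 \<in> m" using diff[OF qm ideal(2)[OF _ nat]] by auto
    then show False using ideal(3) unfolding q_def by (simp add: algebra_simps)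
  qed
  have two: "2 \<notin> m" and three: "3 \<notin> m"
    using six ideal(2)[of 2 3] ideal(2)[of 3 2] nat[of 3] nat[of 2] by auto
  have q1: "real q + 1 \<notin> m" using diff[of "real q + 1" "real q"] qm ideal(3) by auto
  define bad where "bad l x \<longleftrightarrow> (if snd l then mirror (fst l) x + 1 \<in> m else mirror (fst l) x \<in> m)"
    for l :: letter and x
  have clamp: "ref_a E x = h0 E x - x" if "x \<in> {0..1}" for x
    using that unfolding ref_a_def by (simp add: min_absorb2 max_absorb2)
  have "reference (ref_a E) E bad"
  proof
    show "E > 0" by fact
    show "ref_a E x = 0" if "x \<le> 0" for x using that unfolding ref_a_def h0_def by (simp add: max_def)
    have mono_slope: "0 \<le> ref_a E y - ref_a E x \<and> ref_a E y - ref_a E x \<le> (y - x) / real E"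
      if "x \<le> y" for x y
    proof -
      define s t where "s = min 1 (max 0 x)" and "t = min 1 (max 0 y)"
      have st: "0 \<le> s" "s \<le> t" "t \<le> 1" "t - s \<le> y - x" using that unfolding s_def t_def by auto
      have "(t - s) / real E \<le> (y - x) / real E" using st E by (intro divide_right_mono) auto
      then show ?thesis using h0_slope[OF E st(1-3)] unfolding ref_a_def s_def[symmetric] t_def[symmetric] Let_def
        by (auto simp: algebra_simps)
    qed
    show "ref_a E x \<le> ref_a E y" "ref_a E y - ref_a E x \<le> (y - x) / real E" if "x \<le> y" for x y
      using mono_slope[OF that] by auto
    show "ref_a E x \<le> 1 / real E" for x
    proof -
      define t where "t = min 1 (max 0 x)"
      have t: "0 \<le> t" "t \<le> 1" unfolding t_def by auto
      have "ref_a E x = ref_a E t - ref_a E 0" unfolding ref_a_def h0_def t_def by (simp add: Let_def)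
      also have "\<dots> \<le> t / real E" using mono_slope[OF t(1)] by simp
      also have "\<dots> \<le> 1 / real E" using t by (intro divide_right_mono) auto
      finally show ?thesis .
    qed
    show "ref_a E x \<le> ref_a E 1" for x
    proof -
      have "ref_a E x \<le> ref_a E (max 1 x)" using mono_slope[of x "max 1 x"] by simp
      then show ?thesis unfolding ref_a_def by (simp add: Let_def)
    qed
    show "l = l'" if "x \<in> {0..1}" "bad l x" "bad l' x" for x l l'
    proof (rule ccontr)
      assume "l \<noteq> l'"
      moreover have False if "x \<in> m" "x + 1 \<in> m" using diff[OF that(2,1)] ideal(3) by simp
      moreover have False if "x \<in> m" "1 - x \<in> m" using ideal(1)[OF that] ideal(3) by simp
      moreover have False if "x \<in> m" "2 - x \<in> m" using ideal(1)[OF that] two by simp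
      moreover have False if "x + 1 \<in> m" "1 - x \<in> m" using ideal(1)[OF that] two by simp
      moreover have False if "x + 1 \<in> m" "2 - x \<in> m" using ideal(1)[OF that] three by simp
      moreover have False if "1 - x \<in> m" "2 - x \<in> m" using diff[OF that(2,1)] ideal(3) by simp
      ultimately show False using that(2,3)
        by (cases l; cases l') (auto simp: bad_def mirror_def split: if_splits)
    qed
    show "bad (b, False) x \<or> bad (b, True) (mirror b (mirror b x + ref_a E (mirror b x)))"
      if x: "x \<in> {0..1}" and y: "mirror b x + ref_a E (mirror b x) \<in> {0..1}" for x b
    proof -
      define u where "u = mirror b x"
      have u: "u \<in> {0..1}" using x mirror_unit[of x b] unfolding u_def by simp
      have eq: "mirror b x + ref_a E (mirror b x) = h0 E u" using clamp[OF u] unfolding u_def by simp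
      \<comment> \<open>Outside the repelling disc \<open>1 / u\<close>, and hence the coordinate
        \<open>1 + 1 / u\<close>, is in \<open>V\<close>. In this coordinate \<open>h0\<close> is
        multiplication by \<open>q / (q + 1)\<close>, which lies in \<open>m\<close>, so the image
        has \<open>1 / h0\<close> congruent to \<open>-1\<close> modulo \<open>m\<close>.\<close>
      have "h0 E u + 1 \<in> m" if um: "u \<notin> m"
      proof -
        have u0: "u \<noteq> 0" using um subring_of_realsD(1)[OF V] unfolding m_def by auto
        have pos: "real q - u > 0" using u E unfolding q_def by auto
        have "1 / u \<in> V" by (rule ideal(4)[OF um])
        then have "1 + 1 / u \<in> V" using subring_of_realsD[OF V] by auto
        define s where "s = (1 / (real q + 1)) * ((1 + 1 / u) * real q)"
        have sm: "s \<in> m" unfolding s_def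
          using ideal(4)[OF q1] \<open>1 + 1 / u \<in> V\<close> qm by (intro ideal(2))
        have h: "h0 E u = (real q + 1) * u / (real q - u)" unfolding h0_def q_def by (simp add: algebra_simps)
        have h1: "h0 E u \<noteq> 0" unfolding h using u0 pos by simp
        have s: "1 + 1 / h0 E u = s"
          unfolding h s_def using u0 pos by (simp add: divide_simps) (simp add: algebra_simps)
        have "1 / h0 E u = s - 1" using s by simp
        then have "1 / h0 E u \<notin> m" using diff[of s "s - 1"] sm ideal(3) by auto
        then have "h0 E u \<in> V" using ideal(4)[of "1 / h0 E u"] by simp
        then have "h0 E u * s \<in> m" using sm by (intro ideal(2))
        moreover have "h0 E u * s = h0 E u + 1" unfolding s[symmetric] using h1 by (simp add: field_simps)
        ultimately show ?thesis by simp
      qed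
      then show ?thesis unfolding eq by (auto simp: bad_def u_def)
    qed
  qed
  then show ?thesis by blast
qed

section \<open>Staircases with slips\<close>

definition slip_count :: "nat set \<Rightarrow> nat \<Rightarrow> nat" where "slip_count Z n = card {z \<in> Z. z < n}"

text \<open>The first gap that \<open>f\<close> will send into gap \<open>n\<close>: each of the
  \<open>n\<close> earlier gaps receives one gap, or two if it is a slip.\<close>

definition shift :: "nat set \<Rightarrow> nat \<Rightarrow> nat" where "shift Z n = n + slip_count Z n"

lemma slip_count_0 [simp]: "slip_count Z 0 = 0"
  by (simp add: slip_count_def)

lemma slip_count_Suc: "slip_count Z (Suc n) = slip_count Z n + (if n \<in> Z then 1 else 0)"
proof -
  have "{z \<in> Z. z < Suc n} = (if n \<in> Z then insert n {z \<in> Z. z < n} else {z \<in> Z. z < n})"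
    by (auto simp: less_Suc_eq)
  then show ?thesis by (simp add: slip_count_def)
qed

lemma shift_0 [simp]: "shift Z 0 = 0"
  by (simp add: shift_def)

lemma shift_Suc: "shift Z (Suc n) = shift Z n + (if n \<in> Z then 2 else 1)"
  by (simp add: shift_def slip_count_Suc)

lemma strict_mono_shift: "strict_mono (shift Z)"
  by (intro strict_monoI_Suc) (simp add: shift_Suc)

lemma shift_less_iff [simp]: "shift Z i < shift Z j \<longleftrightarrow> i < j"
  by (simp add: strict_mono_less strict_mono_shift)

lemma shift_eq_iff [simp]: "shift Z i = shift Z j \<longleftrightarrow> i = j"
  by (simp add: strict_mono_eq strict_mono_shift)

lemma shift_ge: "n \<le> shift Z n"
  by (simp add: shift_def)

text \<open>The slip at \<open>0\<close> displaces all later gaps strictly; this is the source of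
  \<open>f x < x\<close>.\<close>

lemma shift_gt: assumes "0 \<in> Z" "n > 0" shows "n < shift Z n"
proof -
  have "card {0::nat} \<le> card {z \<in> Z. z < n}" using assms by (intro card_mono) auto
  then show ?thesis by (simp add: shift_def slip_count_def)
qed

lemma shift_skip: assumes "z \<in> Z" shows "shift Z i \<noteq> Suc (shift Z z)"
proof
  assume "shift Z i = Suc (shift Z z)"
  then have "shift Z z < shift Z i" "shift Z i < shift Z (Suc z)" using assms by (auto simp: shift_Suc)
  then show False by simp
qed

text \<open>To be used with \<open>m = T\<close>, where the second alternative means a slip whose
  range straddles the right end of the interval.\<close>

lemma shift_cover: "\<exists>n. m = shift Z n \<or> (n \<in> Z \<and> m = Suc (shift Z n))"
proof (induction m)
  case 0 then show ?case by (metis shift_0)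
next
  case (Suc m)
  then obtain n where "m = shift Z n \<or> (n \<in> Z \<and> m = Suc (shift Z n))" by auto
  then show ?case
  proof
    assume "m = shift Z n"
    then have "Suc m = shift Z (if n \<in> Z then n else Suc n) + (if n \<in> Z then 1 else 0)"
      by (simp add: shift_Suc)
    then show ?thesis by (cases "n \<in> Z") auto
  next
    assume "n \<in> Z \<and> m = Suc (shift Z n)"
    then have "Suc m = shift Z (Suc n)" by (simp add: shift_Suc)
    then show ?thesis by blast
  qed
qed

section \<open>Mirroring of gaps, and the partial maps on gaps given by two staircases\<close>

definition flip_gap :: "nat \<Rightarrow> bool \<Rightarrow> nat \<Rightarrow> nat" where
  "flip_gap T b n = (if b then T - 1 - n else n)"

lemma flip_gap_flip [simp]: "n < T \<Longrightarrow> flip_gap T b (flip_gap T b n) = n"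
  by (auto simp: flip_gap_def)

lemma flip_gap_less: "n < T \<Longrightarrow> flip_gap T b n < T"
  by (auto simp: flip_gap_def)

lemma flip_gap_inj: "n < T \<Longrightarrow> m < T \<Longrightarrow> flip_gap T b n = flip_gap T b m \<Longrightarrow> n = m"
  by (metis flip_gap_flip)

text \<open>Leaving out the slips makes this a partial injection on single gaps, so words act on
  gaps and backtracking can be cancelled.\<close>

definition forward_step :: "nat \<Rightarrow> nat set \<Rightarrow> bool \<Rightarrow> nat \<Rightarrow> nat \<Rightarrow> bool" where
  "forward_step T Z b n m \<longleftrightarrow>
     (\<exists>i. i \<notin> Z \<and> shift Z i < T \<and> n = flip_gap T b i \<and> m = flip_gap T b (shift Z i))"

definition step :: "nat \<Rightarrow> (bool \<Rightarrow> nat set) \<Rightarrow> letter \<Rightarrow> nat \<Rightarrow> nat \<Rightarrow> bool" where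
  "step T Z l n m \<longleftrightarrow> (if snd l then forward_step T (Z (fst l)) (fst l) m n
                       else forward_step T (Z (fst l)) (fst l) n m)"

lemma step_inv: "step T Z (inv_letter l) m n \<longleftrightarrow> step T Z l n m"
  by (cases l) (auto simp: step_def)

lemma forward_step_det: "forward_step T Z b n m \<Longrightarrow> forward_step T Z b n m' \<Longrightarrow> m = m'"
  and forward_step_inj: "forward_step T Z b n m \<Longrightarrow> forward_step T Z b n' m \<Longrightarrow> n = n'"
proof -
  have less: "i < T" if "shift Z i < T" for i using shift_ge[of i Z] that by simp
  show "m = m'" if "forward_step T Z b n m" "forward_step T Z b n m'"
  proof -
    obtain i j where "shift Z i < T" "n = flip_gap T b i" "m = flip_gap T b (shift Z i)"
      "shift Z j < T" "n = flip_gap T b j" "m' = flip_gap T b (shift Z j)"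
      using \<open>forward_step T Z b n m\<close> \<open>forward_step T Z b n m'\<close> unfolding forward_step_def by blast
    then show ?thesis using flip_gap_inj[of i T j b] less by auto
  qed
  show "n = n'" if "forward_step T Z b n m" "forward_step T Z b n' m"
  proof -
    obtain i j where "shift Z i < T" "n = flip_gap T b i" "m = flip_gap T b (shift Z i)"
      "shift Z j < T" "n' = flip_gap T b j" "m = flip_gap T b (shift Z j)"
      using \<open>forward_step T Z b n m\<close> \<open>forward_step T Z b n' m\<close> unfolding forward_step_def by blast
    then show ?thesis using flip_gap_inj[of "shift Z i" T "shift Z j" b] by auto
  qed
qed

lemma step_det: "step T Z l n m \<Longrightarrow> step T Z l n m' \<Longrightarrow> m = m'"
  unfolding step_def using forward_step_det forward_step_inj by (metis (full_types))

lemma forward_step_less: "forward_step T Z b n m \<Longrightarrow> n < T \<and> m < T"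
  using order_le_less_trans[OF shift_ge] unfolding forward_step_def by (auto simp: flip_gap_less)

lemma step_less: "step T Z l n m \<Longrightarrow> n < T \<and> m < T"
  unfolding step_def using forward_step_less by (metis (full_types))

section \<open>Slips placed along the displacement profile of the reference map\<close>

context reference
begin

text \<open>The displacement of \<open>n / T\<close> under \<open>up\<close>, measured in gaps of
  length \<open>1 / T\<close>. The number of slips before \<open>n\<close> has to follow it.\<close>

definition level :: "nat \<Rightarrow> nat \<Rightarrow> real" where "level T n = real T * a (real n / real T)"

definition first_reach :: "nat \<Rightarrow> nat \<Rightarrow> nat" where
  "first_reach T j = (LEAST n. real j \<le> level T n)"

definition num_levels :: "nat \<Rightarrow> nat" where "num_levels T = nat \<lfloor>real T * a 1\<rfloor>"

text \<open>One slip per unit of \<open>level\<close>, at the place where \<open>level\<close>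
  reaches \<open>j\<close>, delayed by a free offset \<open>c j\<close> that the greedy choice will
  adjust. The slip at \<open>0\<close> keeps \<open>f x < x\<close> true from the first gap
  on.\<close>

definition slips :: "nat \<Rightarrow> (nat \<Rightarrow> nat) \<Rightarrow> nat set" where
  "slips T c = insert 0 ((\<lambda>j. first_reach T j + c j) ` {1..num_levels T})"

lemma level_mono: "T > 0 \<Longrightarrow> m \<le> n \<Longrightarrow> level T m \<le> level T n"
  unfolding level_def by (intro mult_left_mono a_mono divide_right_mono) auto

lemma level_slope: assumes "T > 0" "m \<le> n" shows "level T n - level T m \<le> (real n - real m) / real E"
proof -
  have "a (real n / real T) - a (real m / real T) \<le> (real n / real T - real m / real T) / real E"
    using assms by (intro a_slope divide_right_mono) auto
  then have "real T * (a (real n / real T) - a (real m / real T)) \<le> real T * ((real n / real T - real m / real T) / real E)"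
    by (intro mult_left_mono) auto
  also have "\<dots> = (real n - real m) / real E"
    using assms(1) by (simp add: diff_divide_distrib[symmetric])
  finally show ?thesis by (simp add: level_def algebra_simps)
qed

lemma level_0 [simp]: "level T 0 = 0"
  by (simp add: level_def a_nonpos)

lemma level_le: "level T n \<le> real T * a 1"
  unfolding level_def by (intro mult_left_mono a_top) auto

end

lemma of_nat_mult_abs_diff: "real T * \<bar>x - y\<bar> = \<bar>real T * x - real T * y\<bar>"
  by (simp add: abs_mult flip: right_diff_distrib)

fun walk :: "('l \<Rightarrow> 'v \<Rightarrow> 'v \<Rightarrow> bool) \<Rightarrow> 'l list \<Rightarrow> 'v \<Rightarrow> 'v \<Rightarrow> bool" where
  "walk Q [] n m \<longleftrightarrow> n = m"
| "walk Q (l # ws) n m \<longleftrightarrow> (\<exists>n'. Q l n n' \<and> walk Q ws n' m)"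

lemma walk_append: "walk Q (us @ vs) n m \<longleftrightarrow> (\<exists>n'. walk Q us n n' \<and> walk Q vs n' m)"
  by (induction us arbitrary: n) auto

lemma walk_mono: "walk Q ws n m \<Longrightarrow> (\<And>l n m. Q l n m \<Longrightarrow> Q' l n m) \<Longrightarrow> walk Q' ws n m"
  by (induction ws arbitrary: n) (simp, fastforce)

context reference
begin

lemma first_reach_le_iff:
  assumes T: "T > 0" and j: "j \<in> {1..num_levels T}"
  shows "first_reach T j \<le> n \<longleftrightarrow> real j \<le> level T n"
proof -
  have "real j \<le> level T T"
  proof -
    have "j \<le> nat \<lfloor>real T * a 1\<rfloor>" using j by (simp add: num_levels_def)
    then have "int j \<le> \<lfloor>real T * a 1\<rfloor>" using j by auto
    then have "real j \<le> real T * a 1" by linarith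
    then show ?thesis using T by (simp add: level_def)
  qed
  then have "real j \<le> level T (first_reach T j)" unfolding first_reach_def by (rule LeastI)
  then show ?thesis
    using level_mono[OF T, of "first_reach T j" n] Least_le[of "\<lambda>n. real j \<le> level T n" n]
    unfolding first_reach_def by auto
qed

lemma first_reach_pos:
  assumes T: "T > 0" and j: "j \<in> {1..num_levels T}"
  shows "first_reach T j > 0" "level T (first_reach T j - 1) < real j"
proof -
  show pos: "first_reach T j > 0"
  proof (rule ccontr)
    assume "\<not> ?thesis"
    then have "real j \<le> level T 0" using first_reach_le_iff[OF T j, of 0] by simp
    then show False using j by simp
  qed
  have "\<not> first_reach T j \<le> first_reach T j - 1" using pos by simp
  then show "level T (first_reach T j - 1) < real j"
    unfolding first_reach_le_iff[OF T j] by simp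
qed

text \<open>One gap before \<open>first_reach T i\<close> the level is still below \<open>i\<close>,
  so it rises by more than \<open>1\<close> up to \<open>first_reach T j\<close>; at slope at most
  \<open>1 / E\<close> this takes more than \<open>E\<close> gaps.\<close>

lemma first_reach_spacing:
  assumes T: "T > 0" and ij: "i \<in> {1..num_levels T}" "j \<in> {1..num_levels T}"
    and le: "i < j"
  shows "first_reach T i + E \<le> first_reach T j"
proof -
  let ?m = "first_reach T i - 1" and ?n = "first_reach T j"
  have 1: "level T ?m < real i" "first_reach T i > 0" using first_reach_pos[OF T ij(1)] by auto
  have 2: "real j \<le> level T ?n" using first_reach_le_iff[OF T ij(2), of ?n] by simp
  have gt: "level T ?n - level T ?m > 1" using 1 2 le by linarith
  then have mn: "?m \<le> ?n" using level_mono[OF T, of ?n ?m] by (cases "?m \<le> ?n") auto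
  have "1 < (real ?n - real ?m) / real E" using gt level_slope[OF T mn] by linarith
  then have "real E < real ?n - real ?m" using E by (simp add: less_divide_eq)
  then have "E < ?n - ?m" using mn by linarith
  then show ?thesis using 1(2) by linarith
qed

text \<open>Offsets below \<open>R \<le> E\<close> are smaller than the spacing of the levels. With
  \<open>k\<close> the integer part of the level at \<open>n > 0\<close>, every slip
  \<open>j < k\<close> lies before \<open>n\<close> and no slip \<open>j > k\<close> does; the slip
  at \<open>0\<close> adds one, so the count is \<open>k\<close> or \<open>k + 1\<close>.\<close>

lemma slip_count_approx:
  assumes T: "T > 0" and R: "R \<le> E" and c: "\<And>j. j \<in> {1..num_levels T} \<Longrightarrow> c j < R"
  shows "\<bar>real (slip_count (slips T c) n) - level T n\<bar> \<le> 1"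
proof (cases "n = 0")
  case False
  define z where "z j = first_reach T j + c j" for j
  define J where "J = {1..num_levels T}"
  have sep: "z i < z j" if "i \<in> J" "j \<in> J" "i < j" for i j
    using first_reach_spacing[OF T, of i j] that c[of i] R unfolding J_def z_def by fastforce
  have inj: "inj_on z J"
    by (rule linorder_inj_onI) (use sep in \<open>auto simp: less_le\<close>)
  have zpos: "z j > 0" if "j \<in> J" for j using first_reach_pos[OF T] that unfolding J_def z_def by auto
  have "{x \<in> slips T c. x < n} = insert 0 (z ` {j \<in> J. z j < n})"
    unfolding slips_def J_def z_def using False by auto
  moreover have "0 \<notin> z ` {j \<in> J. z j < n}" 
  proof
    assume "0 \<in> z ` {j \<in> J. z j < n}"
    then obtain j where "j \<in> J" "z j = 0" by force
    then show False using zpos[of j] by simp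
  qed
  ultimately have "slip_count (slips T c) n = Suc (card (z ` {j \<in> J. z j < n}))"
    unfolding slip_count_def by (simp add: J_def)
  also have "card (z ` {j \<in> J. z j < n}) = card {j \<in> J. z j < n}"
    by (rule card_image) (rule inj_on_subset[OF inj], auto)
  finally have eq: "slip_count (slips T c) n = Suc (card {j \<in> J. z j < n})" .
  define k where "k = nat \<lfloor>level T n\<rfloor>"
  have lev0: "0 \<le> level T n" using level_mono[OF T, of 0 n] by simp
  then have "real k = of_int \<lfloor>level T n\<rfloor>" unfolding k_def by simp
  then have k: "real k \<le> level T n" "level T n < real k + 1"
    using of_int_floor_le[of "level T n"] real_of_int_floor_add_one_gt[of "level T n"] by auto
  have kJ: "k \<le> num_levels T"
    unfolding k_def num_levels_def using level_le[of T n] by (intro nat_mono floor_mono)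
  have "{j \<in> J. z j < n} \<subseteq> {1..k}"
  proof
    fix j assume j: "j \<in> {j \<in> J. z j < n}"
    then have "real j \<le> level T n"
      using first_reach_le_iff[OF T, of j n] unfolding z_def J_def by auto
    then show "j \<in> {1..k}" using j k unfolding J_def by auto
  qed
  then have up: "card {j \<in> J. z j < n} \<le> k" using card_mono[of "{1..k}"] by fastforce
  have "{1..<k} \<subseteq> {j \<in> J. z j < n}"
  proof
    fix j assume j: "j \<in> {1..<k}"
    then have jJ: "j \<in> {1..num_levels T}" using kJ by auto
    let ?m = "first_reach T j - 1"
    have m: "level T ?m < real j" "first_reach T j > 0" using first_reach_pos[OF T jJ] by auto
    have "real j + 1 \<le> real k" using j by auto
    then have gt: "level T n - level T ?m > 1" using m(1) k(1) by linarith
    then have mn: "?m \<le> n" using level_mono[OF T, of n ?m] by (cases "?m \<le> n") auto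
    have "1 < (real n - real ?m) / real E" using gt level_slope[OF T mn] by linarith
    then have "real E < real n - real ?m" using E by (simp add: less_divide_eq)
    then have "first_reach T j + E \<le> n" using mn m(2) by linarith
    then show "j \<in> {j \<in> J. z j < n}" using c[OF jJ] R jJ unfolding z_def J_def by auto
  qed
  then have "card {1..<k} \<le> card {j \<in> J. z j < n}" by (intro card_mono) (auto simp: J_def)
  then have "k \<le> Suc (card {j \<in> J. z j < n})" by simp
  then show ?thesis using up k unfolding eq by auto
qed simp

section \<open>Comparison of walks on gaps with words in the reference maps\<close>

definition near_step :: "nat \<Rightarrow> letter \<Rightarrow> nat \<Rightarrow> nat \<Rightarrow> bool" where
  "near_step T l n m \<longleftrightarrow> \<bar>real m - real T * app l (real n / real T)\<bar> \<le> 4"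

abbreviation near_walk :: "nat \<Rightarrow> letter list \<Rightarrow> nat \<Rightarrow> nat \<Rightarrow> bool" where
  "near_walk T \<equiv> walk (\<lambda>l n m. n < T \<and> m < T \<and> near_step T l n m)"

text \<open>Errors of size at most one come from \<open>slip_count\<close>, from \<open>e\<close>,
  and on the mirrored side from the left end of the mirrored gap \<open>i\<close> being
  \<open>1 - (i + 1) / T\<close>, so that the level is read at \<open>Suc i\<close>. The bound
  \<open>4\<close> covers them all. Admitting \<open>e = 1\<close> makes both range gaps of a slip
  near images of its domain.\<close>

lemma near_step_forward:
  assumes T: "T > 0" and R: "R \<le> E" and c: "\<And>j. j \<in> {1..num_levels T} \<Longrightarrow> c j < R"
    and i: "shift (slips T c) i + e < T" "e \<le> 1"
  shows "near_step T (b, False) (flip_gap T b i) (flip_gap T b (shift (slips T c) i + e))"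
proof -
  let ?s = "slip_count (slips T c) i"
  have iT: "i < T" using i shift_ge[of i "slips T c"] by simp
  have ap: "\<bar>real ?s - level T i\<bar> \<le> 1" by (rule slip_count_approx[OF T R c])
  have up: "real T * up (real n / real T) = real n + level T n" for n
    using T by (simp add: up_def level_def field_simps)
  show ?thesis
  proof (cases b)
    case False
    then show ?thesis using ap i(2) up[of i]
      by (simp add: near_step_def flip_gap_def app_def mirror_def shift_def)
  next
    case True
    have "real (T - Suc i) = real T - real (Suc i)" using iT by (intro of_nat_diff) simp
    then have n: "1 - real (T - Suc i) / real T = real (Suc i) / real T"
      using T by (simp add: diff_divide_distrib del: of_nat_Suc)
    have "level T (Suc i) - level T i \<le> 1 / real E" using level_slope[OF T, of i "Suc i"] by simp
    moreover have "1 / real E \<le> 1" using E by simp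
    moreover have "level T i \<le> level T (Suc i)" by (rule level_mono[OF T]) simp
    moreover have "real T * (1 - up (real (Suc i) / real T)) = real T - (real (Suc i) + level T (Suc i))"
      using up[of "Suc i"] by (simp add: algebra_simps)
    moreover have "real (T - 1 - (shift (slips T c) i + e)) = real T - 1 - real i - real ?s - real e"
      using i(1) by (simp add: shift_def of_nat_diff)
    moreover have "app (b, False) (real (flip_gap T b i) / real T) = 1 - up (real (Suc i) / real T)"
      using True by (simp add: app_def mirror_def flip_gap_def n del: of_nat_Suc)
    moreover have "flip_gap T b (shift (slips T c) i + e) = T - 1 - (shift (slips T c) i + e)"
      using True by (simp add: flip_gap_def)
    ultimately show ?thesis using ap i(2) unfolding near_step_def by simp
  qed
qed

lemma near_step_backward:
  assumes "T > 0" "near_step T (b, False) n m"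
  shows "near_step T (b, True) m n"
proof -
  let ?y = "app (b, True) (real m / real T)"
  have "\<bar>real n / real T - ?y\<bar> \<le> \<bar>app (b, False) (real n / real T) - app (b, False) ?y\<bar>"
    by (rule app_forward_expand)
  also have "app (b, False) ?y = real m / real T" using app_inv'[of "(b, False)"] by simp
  finally have "real T * \<bar>real n / real T - ?y\<bar> \<le> real T * \<bar>app (b, False) (real n / real T) - real m / real T\<bar>"
    using assms(1) by (intro mult_left_mono) auto
  moreover have "real T * (real n / real T) = real n" "real T * (real m / real T) = real m"
    using assms(1) by auto
  ultimately show ?thesis using assms(2) unfolding near_step_def of_nat_mult_abs_diff
    by (simp add: abs_minus_commute)
qed

lemma step_near_step:
  assumes T: "T > 0" and R: "R \<le> E" and c: "\<And>b j. j \<in> {1..num_levels T} \<Longrightarrow> c b j < R"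
    and s: "step T (\<lambda>b. slips T (c b)) l n m"
  shows "near_step T l n m"
proof -
  have *: "near_step T (b, False) n m" if f: "forward_step T (slips T (c b)) b n m" for b n m
  proof -
    obtain i where i: "shift (slips T (c b)) i < T" "n = flip_gap T b i"
      "m = flip_gap T b (shift (slips T (c b)) i)"
      using f unfolding forward_step_def by auto
    show ?thesis using near_step_forward[of T R "c b" i 0 b, OF T R c] i by simp
  qed
  show ?thesis using s * near_step_backward[OF T] by (cases l) (auto simp: step_def split: if_splits)
qed

lemma app_word_lipschitz: "\<bar>app_word ws x - app_word ws y\<bar> \<le> 2 ^ length ws * \<bar>x - y\<bar>"
proof (induction ws arbitrary: x y)
  case (Cons l ws)
  have "\<bar>app_word ws (app l x) - app_word ws (app l y)\<bar> \<le> 2 ^ length ws * \<bar>app l x - app l y\<bar>"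
    by (rule Cons)
  also have "\<dots> \<le> 2 ^ length ws * (2 * \<bar>x - y\<bar>)" by (intro mult_left_mono app_lipschitz) auto
  finally show ?case by simp
qed simp

lemma near_walk_app_word:
  assumes T: "T > 0" and "near_walk T ws n m"
  shows "\<bar>real m - real T * app_word ws (real n / real T)\<bar> \<le> 4 * 2 ^ length ws"
proof -
  \<comment> \<open>The errors add up to \<open>4 (1 + 2 + 4 + ...)\<close>; the induction closes
    for this exact sum.\<close>
  have "\<bar>real m - real T * app_word ws (real n / real T)\<bar> \<le> 4 * (2 ^ length ws - 1)"
    using assms(2)
  proof (induction ws arbitrary: n)
    case (Cons l ws)
    then obtain n' where n': "near_step T l n n'" "near_walk T ws n' m" by auto
    have *: "real T * (real n' / real T) = real n'" using T by simp
    have "real T * \<bar>app_word ws (real n' / real T) - app_word ws (app l (real n / real T))\<bar>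
        \<le> real T * (2 ^ length ws * \<bar>real n' / real T - app l (real n / real T)\<bar>)"
      using T by (intro mult_left_mono app_word_lipschitz) auto
    also have "\<dots> = 2 ^ length ws * (real T * \<bar>real n' / real T - app l (real n / real T)\<bar>)"
      by (simp only: mult_ac)
    also have "\<dots> \<le> 2 ^ length ws * 4"
      using n'(1) unfolding near_step_def of_nat_mult_abs_diff * by (intro mult_left_mono) auto
    finally have "\<bar>real T * app_word ws (real n' / real T) - real T * app_word ws (app l (real n / real T))\<bar>
        \<le> 2 ^ length ws * 4"
      unfolding of_nat_mult_abs_diff .
    then show ?case using Cons.IH[OF n'(2)] by simp
  qed (use T in simp)
  then show ?thesis by simp
qed

end

section \<open>A greedy choice of slips\<close>

lemma card_nats_near: "card {v. \<bar>real v - y\<bar> \<le> real C} \<le> 2 * C + 1"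
proof (cases "{v. \<bar>real v - y\<bar> \<le> real C} = {}")
  case True
  then show ?thesis by (simp only: card.empty)
next
  case False
  define m where "m = (LEAST v. \<bar>real v - y\<bar> \<le> real C)"
  have m: "\<bar>real m - y\<bar> \<le> real C" unfolding m_def using False by (auto intro: LeastI)
  have "{v. \<bar>real v - y\<bar> \<le> real C} \<subseteq> {m..m + 2 * C}"
  proof
    fix v assume v: "v \<in> {v. \<bar>real v - y\<bar> \<le> real C}"
    then have "m \<le> v" unfolding m_def by (auto intro: Least_le)
    moreover have "real v \<le> real (m + 2 * C)" using v m by (simp add: abs_le_iff)
    ultimately show "v \<in> {m..m + 2 * C}" by simp
  qed
  from card_mono[OF _ this] show ?thesis by simp
qed

text \<open>A real-valued \<open>flip_gap\<close>: with its offset a slip may lie beyond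
  \<open>T\<close>, where subtraction of naturals would truncate.\<close>

definition gap_pos :: "nat \<Rightarrow> bool \<Rightarrow> nat \<Rightarrow> real" where
  "gap_pos T b z = (if b then real T - 1 - real z else real z)"

lemma gap_pos_eq: "z < T \<Longrightarrow> gap_pos T b z = real (flip_gap T b z)"
  by (simp add: gap_pos_def flip_gap_def of_nat_diff)

lemma card_gaps_near: "card {v. \<bar>gap_pos T b (n + v) - y\<bar> \<le> real C} \<le> 2 * C + 1"
proof -
  have "{v. \<bar>gap_pos T b (n + v) - y\<bar> \<le> real C}
      = {v. \<bar>real v - (if b then real T - 1 - real n - y else y - real n)\<bar> \<le> real C}"
    by (auto simp: gap_pos_def abs_le_iff)
  then show ?thesis using card_nats_near by simp
qed

abbreviation short_words :: "nat \<Rightarrow> letter list set" where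
  "short_words L \<equiv> {ws. length ws \<le> L}"

lemma finite_short_words: "finite (short_words L)"
  using finite_lists_length_le[of "UNIV :: letter set" L] by simp

definition slip_gaps :: "nat \<Rightarrow> (bool \<Rightarrow> nat set) \<Rightarrow> (bool \<times> nat) set" where
  "slip_gaps T Z = {(b, z). z \<in> Z b \<and> z < T}"

context reference
begin

lemma app_word_displacement: "\<bar>app_word ws x - x\<bar> \<le> length ws / real E"
proof (induction ws arbitrary: x)
  case (Cons l ws)
  have "\<bar>app_word ws (app l x) - x\<bar> \<le> length ws / real E + 1 / real E"
    using Cons[of "app l x"] app_displacement[of l x] by linarith
  then show ?case by (simp add: add_divide_distrib)
qed simp

lemma app_word_inv: "app_word ws (app_word (rev (map inv_letter ws)) x) = x"
  by (induction ws arbitrary: x) auto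

lemma near_word_reverse:
  assumes T: "T > 0" and "\<bar>q - real T * app_word ws (p / real T)\<bar> \<le> A"
  shows "\<bar>p - real T * app_word (rev (map inv_letter ws)) (q / real T)\<bar> \<le> 2 ^ length ws * A"
proof -
  let ?y = "app_word (rev (map inv_letter ws)) (q / real T)"
  have *: "real T * \<bar>u - v\<bar> = \<bar>real T * u - real T * v\<bar>" for u v by (simp add: of_nat_mult_abs_diff)
  have "\<bar>p / real T - ?y\<bar> \<le> 2 ^ length ws * \<bar>app_word ws (p / real T) - app_word ws ?y\<bar>"
    by (rule app_word_expand)
  then have "real T * \<bar>p / real T - ?y\<bar> \<le> 2 ^ length ws * (real T * \<bar>app_word ws (p / real T) - q / real T\<bar>)"
    unfolding app_word_inv using T by (subst mult.left_commute) (intro mult_left_mono, auto)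
  also have "\<dots> \<le> 2 ^ length ws * A"
    unfolding * using assms by (intro mult_left_mono) (auto simp: abs_minus_commute)
  finally show ?thesis unfolding * using T by simp
qed

text \<open>Words expand by at least \<open>2 ^ - L\<close>, so points whose images meet one window
  of \<open>R\<close> offsets are close together. Slips of the same side are farther apart than this
  bound, so each side contributes at most one.\<close>

lemma one_relevant_slip:
  fixes q q' :: real
  assumes T: "T > 0" and ws: "length ws \<le> L"
    and v: "\<bar>gap_pos T b (n + v) - real T * app_word ws (q / real T)\<bar> \<le> real C" "v < R"
    and v': "\<bar>gap_pos T b (n + v') - real T * app_word ws (q' / real T)\<bar> \<le> real C" "v' < R"
  shows "\<bar>q - q'\<bar> \<le> 2 ^ L * (2 * real C + real R)"
proof -
  have *: "real T * \<bar>u - v\<bar> = \<bar>real T * u - real T * v\<bar>" for u v by (simp add: of_nat_mult_abs_diff)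
  have "\<bar>gap_pos T b (n + v) - gap_pos T b (n + v')\<bar> \<le> real R"
    using v(2) v'(2) by (auto simp: gap_pos_def abs_le_iff)
  then have d: "real T * \<bar>app_word ws (q / real T) - app_word ws (q' / real T)\<bar> \<le> 2 * real C + real R"
    unfolding * using v(1) v'(1) by linarith
  have "\<bar>q / real T - q' / real T\<bar> \<le> 2 ^ length ws * \<bar>app_word ws (q / real T) - app_word ws (q' / real T)\<bar>"
    by (rule app_word_expand)
  then have "real T * \<bar>q / real T - q' / real T\<bar>
      \<le> 2 ^ length ws * (real T * \<bar>app_word ws (q / real T) - app_word ws (q' / real T)\<bar>)"
    using T by (subst mult.left_commute) (intro mult_left_mono, auto)
  also have "\<dots> \<le> 2 ^ L * (2 * real C + real R)"
    using d ws by (intro mult_mono) (auto intro: power_increasing)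
  finally show ?thesis unfolding * using T by simp
qed

text \<open>The parity of \<open>k\<close> selects the side of the slip. For each word only four
  sources can block offsets, namely the two end gaps and one earlier slip of each side, and each
  blocks at most \<open>2 * C + 1\<close> of them. Hence a window \<open>R\<close> independent of
  \<open>T\<close> leaves a free offset.\<close>

lemma greedy_choice:
  fixes T L C R :: nat
  assumes T: "T > 0"
    and RE: "real R + 2 ^ L * (2 * real C + real R) < real E"
    and CR: "4 * card (short_words L) * (2 * C + 1) < R"
  defines "pos \<equiv> \<lambda>k r. gap_pos T (odd k) (first_reach T (Suc (k div 2)) + r)"
  shows "\<exists>v :: nat \<Rightarrow> nat. \<forall>k < 2 * num_levels T. v k < R \<and>
    (\<forall>ws \<in> short_words L. \<forall>q \<in> {0, real T - 1} \<union> (\<lambda>k'. pos k' (v k')) ` {..<k}.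
       \<bar>pos k (v k) - real T * app_word ws (q / real T)\<bar> > real C)"
proof -
  define P where "P v k r \<longleftrightarrow> (k < 2 * num_levels T \<longrightarrow> r < R \<and>
    (\<forall>ws \<in> short_words L. \<forall>q \<in> {0, real T - 1} \<union> (\<lambda>k'. pos k' (v k')) ` {..<k}.
       \<bar>pos k r - real T * app_word ws (q / real T)\<bar> > real C))" for v :: "nat \<Rightarrow> nat" and k r
  have "\<exists>v. \<forall>k. P v k (v k)"
  proof (rule dependent_wellorder_choice)
    fix r :: nat and f g :: "nat \<Rightarrow> nat" and k :: nat assume "\<And>y. y < k \<Longrightarrow> f y = g y"
    then have "(\<lambda>k'. pos k' (f k')) ` {..<k} = (\<lambda>k'. pos k' (g k')) ` {..<k}"
      by (intro image_cong) auto
    then show "P f k r = P g k r" by (simp only: P_def)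
  next
    fix k v assume IH: "\<And>y. y < k \<Longrightarrow> P v y (v y)"
    show "\<exists>r. P v k r"
    proof (cases "k < 2 * num_levels T")
      case True
      define near where "near ws q = {r. r < R \<and> \<bar>pos k r - real T * app_word ws (q / real T)\<bar> \<le> real C}" for ws q
      \<comment> \<open>The four kinds of sources: the end gaps, and the earlier slips of even and
        of odd number.\<close>
      define Q where "Q s = (if s = (0::nat) then {0} else if s = 1 then {real T - 1}
        else (\<lambda>k'. pos k' (v k')) ` {k'. k' < k \<and> odd k' = (s = 3)})" for s
      have card: "card (\<Union>q\<in>Q s. near ws q) \<le> 2 * C + 1" if ws: "ws \<in> short_words L" for ws s
      proof (cases "\<exists>q\<in>Q s. near ws q \<noteq> {}")
        case False
        then have "(\<Union>q\<in>Q s. near ws q) = {}" by auto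
        then show ?thesis by (simp only: card.empty)
      next
        case ex: True
        then obtain q where q: "q \<in> Q s" "near ws q \<noteq> {}" by auto
        \<comment> \<open>Different earlier slips of one side are at least \<open>E - R\<close>
          apart, more than \<open>one_relevant_slip\<close> allows.\<close>
        have "q' = q" if q': "q' \<in> Q s" "near ws q' \<noteq> {}" for q'
        proof (cases "s = 0 \<or> s = 1")
          case False
          obtain i i' where i: "q = pos i (v i)" "i < k" "odd i = (s = 3)"
            and i': "q' = pos i' (v i')" "i' < k" "odd i' = (s = 3)"
            using q(1) q'(1) False unfolding Q_def by auto
          obtain r r' where "\<bar>pos k r - real T * app_word ws (q / real T)\<bar> \<le> real C" "r < R"
            "\<bar>pos k r' - real T * app_word ws (q' / real T)\<bar> \<le> real C" "r' < R"
            using q(2) q'(2) unfolding near_def by auto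
          then have le: "\<bar>q - q'\<bar> \<le> 2 ^ L * (2 * real C + real R)"
            using one_relevant_slip[OF T, of ws L] ws unfolding pos_def by auto
          have far: "\<bar>pos x (v x) - pos y (v y)\<bar> \<ge> real E - real R"
            if "x < y" "odd x = odd y" "x < k" "y < k" for x y
          proof -
            have "Suc (x div 2) < Suc (y div 2)" using that(1,2) by presburger
            then have "first_reach T (Suc (x div 2)) + E \<le> first_reach T (Suc (y div 2))"
              using that True by (intro first_reach_spacing[OF T]) auto
            then have *: "real (first_reach T (Suc (x div 2))) + real E \<le> real (first_reach T (Suc (y div 2)))"
              by linarith
            have "v x < R" "v y < R" using IH[of x] IH[of y] that True unfolding P_def by auto
            then have "real (v x) < real R" by simp
            then show ?thesis using * that(2) unfolding pos_def gap_pos_def by (cases "odd y") auto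
          qed
          have "\<not> i < i'" "\<not> i' < i"
            using far[of i i'] far[of i' i] le RE i i' by (auto simp: abs_minus_commute)
          then show ?thesis using i i' by (metis linorder_neqE_nat)
        qed (use q q' in \<open>auto simp: Q_def split: if_splits\<close>)
        then have "(\<Union>q\<in>Q s. near ws q) \<subseteq> near ws q" by blast
        also have "\<dots> \<subseteq> {r. \<bar>pos k r - real T * app_word ws (q / real T)\<bar> \<le> real C}"
          unfolding near_def by auto
        finally have sub: "(\<Union>q\<in>Q s. near ws q) \<subseteq> {r. \<bar>pos k r - real T * app_word ws (q / real T)\<bar> \<le> real C}" .
        have "finite {r. \<bar>pos k r - real T * app_word ws (q / real T)\<bar> \<le> real C}"
        proof (rule finite_subset)
          let ?y = "real T * app_word ws (q / real T)" and ?n = "real (first_reach T (Suc (k div 2)))"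
          show "{r. \<bar>pos k r - ?y\<bar> \<le> real C} \<subseteq> {r. real r \<le> real T + \<bar>?y\<bar> + ?n + real C}"
            unfolding pos_def gap_pos_def by (auto simp: abs_le_iff split: if_splits)
          show "finite {r. real r \<le> real T + \<bar>?y\<bar> + ?n + real C}"
            by (rule finite_subset[of _ "{..nat \<lfloor>real T + \<bar>?y\<bar> + ?n + real C\<rfloor>}"])
              (use le_nat_floor in blast, simp)
        qed
        from card_mono[OF this sub] show ?thesis
          using card_gaps_near[of T "odd k" "first_reach T (Suc (k div 2))"] unfolding pos_def
          by (meson order_trans)
      qed
      define B where "B = (\<Union>(ws, s)\<in>short_words L \<times> {0, 1, 2, 3}. \<Union>q\<in>Q s. near ws q)"
      have "card B \<le> (\<Sum>(ws, s)\<in>short_words L \<times> {0, 1, 2, 3}. card (\<Union>q\<in>Q s. near ws q))"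
        unfolding B_def split_def
        by (rule card_UN_le) (use finite_short_words in auto)
      also have "\<dots> \<le> (\<Sum>p\<in>short_words L \<times> {0, 1, 2, 3::nat}. 2 * C + 1)"
        using card by (intro sum_mono) auto
      also have "\<dots> = 4 * card (short_words L) * (2 * C + 1)"
        by (simp add: card_cartesian_product)
      also have "\<dots> < card {..<R}" using CR by simp
      finally have "card B < card {..<R}" .
      moreover have "B \<subseteq> {..<R}" unfolding B_def near_def by auto
      ultimately have "B \<noteq> {..<R}" by auto
      then obtain r where r: "r < R" "r \<notin> B" using \<open>B \<subseteq> {..<R}\<close> by auto
      have "\<bar>pos k r - real T * app_word ws (q / real T)\<bar> > real C"
        if ws: "ws \<in> short_words L" and q: "q \<in> {0, real T - 1} \<union> (\<lambda>k'. pos k' (v k')) ` {..<k}" for ws q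
      proof -
        have "\<exists>s\<in>{0,1,2,3}. q \<in> Q s"
          using q
        proof
          assume "q \<in> (\<lambda>k'. pos k' (v k')) ` {..<k}"
          then obtain i where i: "i < k" "q = pos i (v i)" by auto
          then have "q \<in> Q (if odd i then 3 else 2)" unfolding Q_def by auto
          then show ?thesis by (cases "odd i") auto
        qed (auto simp: Q_def)
        then have "r \<notin> near ws q" using r(2) ws unfolding B_def by auto
        then show ?thesis using r(1) unfolding near_def by auto
      qed
      then show ?thesis using r(1) unfolding P_def by blast
    qed (simp add: P_def)
  qed
  then show ?thesis unfolding P_def by blast
qed

lemma separated_slips:
  fixes T L R :: nat
  assumes T: "T > 8 * 2 ^ L + 2" and L: "2 * L \<le> E"
    and RE: "real R + 2 ^ L * (8 * 4 ^ L + real R) < real E"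
    and CR: "4 * card (short_words L) * (8 * 4 ^ L + 1) < R"
  shows "\<exists>c. (\<forall>b. \<forall>j \<in> {1..num_levels T}. c b j < R) \<and>
    (\<forall>i \<in> slip_gaps T (\<lambda>b. slips T (c b)). \<forall>j \<in> slip_gaps T (\<lambda>b. slips T (c b)). \<forall>ws \<in> short_words L.
       i \<noteq> j \<longrightarrow> \<not> near_walk T ws (flip_gap T (fst i) (snd i)) (flip_gap T (fst j) (snd j)))"
proof -
  have T0: "T > 0" using T by simp
  \<comment> \<open>A walk ending at the slip chosen earlier has to be reversed, which turns the
    error \<open>4 * 2 ^ L\<close> into \<open>2 ^ L * (4 * 2 ^ L)\<close>.\<close>
  define C :: nat where "C = 4 * 4 ^ L"
  define pos where "pos k r = gap_pos T (odd k) (first_reach T (Suc (k div 2)) + r)" for k r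
  have "\<exists>v. \<forall>k < 2 * num_levels T. v k < R \<and>
    (\<forall>ws \<in> short_words L. \<forall>q \<in> {0, real T - 1} \<union> (\<lambda>k'. pos k' (v k')) ` {..<k}.
       \<bar>pos k (v k) - real T * app_word ws (q / real T)\<bar> > real C)"
    unfolding pos_def by (rule greedy_choice) (use T0 RE CR in \<open>simp_all add: C_def\<close>)
  then obtain v where vv: "\<forall>k < 2 * num_levels T. v k < R \<and>
    (\<forall>ws \<in> short_words L. \<forall>q \<in> {0, real T - 1} \<union> (\<lambda>k'. pos k' (v k')) ` {..<k}.
       \<bar>pos k (v k) - real T * app_word ws (q / real T)\<bar> > real C)" ..
  have v: "v k < R" if "k < 2 * num_levels T" for k using vv that by blast
  have far: "\<bar>pos k (v k) - real T * app_word ws (q / real T)\<bar> > real C"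
    if "k < 2 * num_levels T" "length ws \<le> L" "q \<in> {0, real T - 1} \<union> (\<lambda>k'. pos k' (v k')) ` {..<k}" for k ws q
    using vv that by blast
  define ix where "ix b j = 2 * (j - 1) + (if b then 1 else 0)" for b and j :: nat
  define c where "c b j = v (ix b j)" for b j
  have ix: "ix b j < 2 * num_levels T" "odd (ix b j) = b" "Suc (ix b j div 2) = j"
    if "j \<in> {1..num_levels T}" for b j
    using that by (auto simp: ix_def)
  have cR: "c b j < R" if "j \<in> {1..num_levels T}" for b j using v ix(1)[OF that] by (simp add: c_def)
  let ?I = "slip_gaps T (\<lambda>b. slips T (c b))"
  have cases: "(snd i = 0 \<and> gap_pos T (fst i) (snd i) \<in> {0, real T - 1}) \<or>
      (\<exists>k < 2 * num_levels T. i = (odd k, first_reach T (Suc (k div 2)) + v k))" if iI: "i \<in> ?I" for i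
  proof -
    obtain b z where i: "i = (b, z)" "z \<in> slips T (c b)" using iI by (auto simp: slip_gaps_def)
    show ?thesis
    proof (cases "z = 0")
      case False
      then obtain j where j: "j \<in> {1..num_levels T}" "z = first_reach T j + c b j"
        using i(2) unfolding slips_def by auto
      then show ?thesis using i(1) ix[OF j(1), of b] unfolding c_def by (intro disjI2 exI[of _ "ix b j"]) auto
    qed (use i in \<open>auto simp: gap_pos_def\<close>)
  qed
  have walk: "\<bar>gap_pos T (fst j) (snd j) - real T * app_word ws (gap_pos T (fst i) (snd i) / real T)\<bar> \<le> 4 * 2 ^ L"
      (is ?A)
    and walk': "\<bar>gap_pos T (fst i) (snd i) - real T * app_word (rev (map inv_letter ws))
        (gap_pos T (fst j) (snd j) / real T)\<bar> \<le> real C" (is ?B)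
    if ij: "i \<in> ?I" "j \<in> ?I" and ws: "length ws \<le> L"
      and w: "near_walk T ws (flip_gap T (fst i) (snd i)) (flip_gap T (fst j) (snd j))" for i j ws
  proof -
    have lt: "snd i < T" "snd j < T" using ij by (auto simp: slip_gaps_def)
    have "4 * 2 ^ length ws \<le> (4 * 2 ^ L :: real)" using ws by (intro mult_left_mono power_increasing) auto
    then show ?A using near_walk_app_word[OF T0 w] unfolding gap_pos_eq[OF lt(1)] gap_pos_eq[OF lt(2)]
      by linarith
    from near_word_reverse[OF T0 this] have "\<bar>gap_pos T (fst i) (snd i) - real T * app_word (rev (map inv_letter ws))
        (gap_pos T (fst j) (snd j) / real T)\<bar> \<le> 2 ^ length ws * (4 * 2 ^ L)" .
    also have "\<dots> \<le> 2 ^ L * (4 * 2 ^ L)" using ws by (intro mult_right_mono power_increasing) auto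
    also have "\<dots> = real C" by (simp add: C_def power_mult_distrib[symmetric])
    finally show ?B .
  qed
  have C: "4 * 2 ^ L \<le> real C" unfolding C_def by (simp add: power_mono)
  have no: False if ij: "i \<in> ?I" "j \<in> ?I" "i \<noteq> j" and ws: "length ws \<le> L"
      and w: "near_walk T ws (flip_gap T (fst i) (snd i)) (flip_gap T (fst j) (snd j))" for i j ws
  proof -
    note A = walk[OF ij(1,2) ws w] and B = walk'[OF ij(1,2) ws w]
    have rl: "length (rev (map inv_letter ws)) \<le> L" using ws by simp
    consider (00) "snd i = 0" "snd j = 0"
      | (0) k where "gap_pos T (fst i) (snd i) \<in> {0, real T - 1}" "k < 2 * num_levels T"
          "j = (odd k, first_reach T (Suc (k div 2)) + v k)"
      | (1) k where "gap_pos T (fst j) (snd j) \<in> {0, real T - 1}" "k < 2 * num_levels T"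
          "i = (odd k, first_reach T (Suc (k div 2)) + v k)"
      | (2) k k' where "k < 2 * num_levels T" "i = (odd k, first_reach T (Suc (k div 2)) + v k)"
         "k' < 2 * num_levels T" "j = (odd k', first_reach T (Suc (k' div 2)) + v k')"
      using cases[OF ij(1)] cases[OF ij(2)] by (elim disjE exE conjE; meson)
    then show False
    proof cases
      \<comment> \<open>These are the slips at the two opposite ends. Because of
        \<open>2 * L \<le> E\<close> a short word moves a point by at most half of the interval, and
        the lower bound on \<open>T\<close> absorbs the rounding error.\<close>
      case 00
      then have ne: "fst i \<noteq> fst j" using ij(3) by (auto simp: prod_eq_iff)
      have d: "\<bar>gap_pos T (fst j) 0 - gap_pos T (fst i) 0\<bar> = real T - 1"
        using ne T by (auto simp: gap_pos_def)
      let ?p = "gap_pos T (fst i) 0"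
      have "\<bar>app_word ws (?p / real T) - ?p / real T\<bar> \<le> length ws / real E"
        by (rule app_word_displacement)
      also have "\<dots> \<le> 1 / 2" using L ws E by (simp add: divide_le_eq)
      finally have "real T * \<bar>app_word ws (?p / real T) - ?p / real T\<bar> \<le> real T * (1 / 2)"
        by (intro mult_left_mono) auto
      then have "\<bar>real T * app_word ws (?p / real T) - ?p\<bar> \<le> real T / 2"
        unfolding of_nat_mult_abs_diff using T0 by simp
      moreover have "real (8 * 2 ^ L + 2) < real T" using T by (simp only: of_nat_less_iff)
      then have "real T > 8 * 2 ^ L + 2" by simp
      ultimately show False using A d unfolding 00 by linarith
    next
      case 0
      then show False using far[OF 0(2) ws, of "gap_pos T (fst i) (snd i)"] A C unfolding pos_def by auto
    next
      case 1
      then show False using far[OF 1(2) rl, of "gap_pos T (fst j) (snd j)"] B unfolding pos_def by auto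
    next
      case 2
      then consider "k < k'" | "k' < k" using ij(3) by (metis linorder_neqE_nat)
      then show False
      proof cases
        case 1
        then have "gap_pos T (fst i) (snd i) \<in> (\<lambda>k'. pos k' (v k')) ` {..<k'}"
          unfolding 2 pos_def by auto
        then show False using far[OF 2(3) ws, of "gap_pos T (fst i) (snd i)"] A C
          unfolding 2 pos_def by auto
      next
        case r: 2
        then have "gap_pos T (fst j) (snd j) \<in> (\<lambda>k'. pos k' (v k')) ` {..<k}"
          unfolding 2 pos_def by auto
        then show False using far[OF 2(1) rl, of "gap_pos T (fst j) (snd j)"] B
          unfolding 2 pos_def by auto
      qed
    qed
  qed
  show ?thesis using cR no by (intro exI[of _ c]) blast
qed

end

section \<open>Branching loops at a slip\<close>

abbreviation reduced :: "letter list \<Rightarrow> bool" where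
  "reduced \<equiv> successively (\<lambda>c d. d \<noteq> inv_letter c)"

lemma not_successivelyE:
  assumes "\<not> successively P ws"
  obtains p c d q where "ws = p @ c # d # q" "\<not> P c d"
proof -
  have "\<exists>p c d q. ws = p @ c # d # q \<and> \<not> P c d"
    using assms
  proof (induction ws)
    case (Cons l ws)
    show ?case
    proof (cases "successively P ws")
      case True
      then obtain d q where "ws = d # q" "\<not> P l d" using Cons.prems by (cases ws) (auto simp: successively_Cons)
      then show ?thesis by (intro exI[of _ "[]"]) auto
    next
      case False
      then obtain p c d q where "ws = p @ c # d # q" "\<not> P c d" using Cons.IH by blast
      then show ?thesis by (intro exI[of _ "l # p"]) auto
    qed
  qed simp
  then show ?thesis using that by blast
qed

context reference
begin

definition confined :: "letter list \<Rightarrow> real \<Rightarrow> bool" where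
  "confined e x \<longleftrightarrow> (\<forall>k \<le> length e. app_word (take k e) x \<in> {0..1})"

text \<open>Two loops at \<open>x\<close> which leave and return along the same edge but branch in between produce
  a finite subgraph of the Schreier graph that has all degrees at least two and a branch point.\<close>

lemma no_double_loop:
  assumes loops: "app_word e1 x = x" "app_word e2 x = x" "confined e1 x" "confined e2 x"
    and red: "reduced (m # e1)" "reduced (m # e2)" and last: "last e1 = m" "last e2 = m"
    and par: "e1 \<parallel> e2"
  shows False
proof -
  define S where "S = {y. \<exists>e\<in>{e1, e2}. \<exists>k<length e. y = app_word (take k e) x}"
  obtain p c1 t1 c2 t2 where c: "c1 \<noteq> c2" "e1 = p @ c1 # t1" "e2 = p @ c2 # t2"
    using parallel_decomp[OF par] by blast
  have e: "app_word e x = x" "reduced (m # e)" "last e = m" "e \<noteq> []" "confined e x" if "e \<in> {e1, e2}" for e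
    using that loops red last c by auto
  have "finite S"
  proof -
    have "S = (\<Union>e\<in>{e1, e2}. (\<lambda>k. app_word (take k e) x) ` {..<length e})" unfolding S_def by auto
    then show ?thesis by simp
  qed
  have mem: "app_word (take k e) x \<in> S" if "e \<in> {e1, e2}" "k \<le> length e" for e k
  proof (cases "k = length e")
    case True
    then have "app_word (take k e) x = app_word (take 0 e) x" using e[OF that(1)] by simp
    then show ?thesis unfolding S_def using that(1) e(4)[OF that(1)] by blast
  next
    case False
    then have "k < length e" using that by simp
    then show ?thesis unfolding S_def using that(1) by blast
  qed
  \<comment> \<open>At each visited point the outgoing letter and the reversed incoming letter give
    two different edges. With \<open>last e = m\<close>, reducedness of \<open>m # e\<close> gives
    this at the base point as well.\<close>
  have edges: "app (e ! k) (app_word (take k e) x) \<in> S"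
      "app (inv_letter ((m # e) ! k)) (app_word (take k e) x) \<in> S"
      "e ! k \<noteq> inv_letter ((m # e) ! k)" if ek: "e \<in> {e1, e2}" "k < length e" for e k
  proof -
    have "app (e ! k) (app_word (take k e) x) = app_word (take (Suc k) e) x"
      using ek by (simp add: take_Suc_conv_app_nth)
    then show "app (e ! k) (app_word (take k e) x) \<in> S" using mem[of e "Suc k"] ek by simp
    show "app (inv_letter ((m # e) ! k)) (app_word (take k e) x) \<in> S"
    proof (cases k)
      case 0
      have "e = butlast e @ [m]" using e(3,4)[OF ek(1)] by (metis append_butlast_last_id)
      then have "app m (app_word (butlast e) x) = x" using e(1)[OF ek(1)]
        by (metis app_word_simps)
      then have "app (inv_letter m) x = app_word (butlast e) x" by (metis app_inv)
      then show ?thesis using mem[OF ek(1), of "length e - 1"] 0 by (simp add: butlast_conv_take)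
    next
      case (Suc j)
      then have "app_word (take k e) x = app (e ! j) (app_word (take j e) x)"
        using ek by (simp add: take_Suc_conv_app_nth)
      then show ?thesis using mem[OF ek(1), of j] ek Suc by simp
    qed
    have "m # e = take k (m # e) @ (m # e) ! k # e ! k # drop (Suc k) e"
      using ek(2) by (metis Cons_nth_drop_Suc id_take_nth_drop length_Cons less_Suc_eq drop_Suc_Cons)
    then have "reduced (take k (m # e) @ (m # e) ! k # e ! k # drop (Suc k) e)"
      using e(2)[OF ek(1)] by metis
    then show "e ! k \<noteq> inv_letter ((m # e) ! k)"
      by (simp add: successively_append_iff)
  qed
  show False
  proof (rule degree_contradiction)
    show "finite S" by fact
    show "S \<subseteq> {0..1}" using e(5) unfolding S_def confined_def by force
    show "\<exists>l l'. l \<noteq> l' \<and> app l y \<in> S \<and> app l' y \<in> S" if yS: "y \<in> S" for y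
    proof -
      obtain e k where "e \<in> {e1, e2}" "k < length e" "y = app_word (take k e) x"
        using yS unfolding S_def by blast
      then show ?thesis using edges[of e k] by blast
    qed
    \<comment> \<open>The end of the common prefix is the branch point: two ways out and one way
      back.\<close>
    let ?k = "length p"
    show "app_word p x \<in> S" using mem[of e1 ?k] c by simp
    show "app c1 (app_word p x) \<in> S" using edges(1)[of e1 ?k] c by simp
    show "app c2 (app_word p x) \<in> S" using edges(1)[of e2 ?k] c by simp
    have pred: "(m # p @ c # t) ! ?k = (m # p) ! ?k" for c t
      by (metis append_Cons length_Cons lessI nth_append)
    show "app (inv_letter ((m # p) ! ?k)) (app_word p x) \<in> S"
      using edges(2)[of e1 ?k] c by (simp add: pred)
    show "distinct [c1, c2, inv_letter ((m # p) ! ?k)]"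
      using edges(3)[of e1 ?k] edges(3)[of e2 ?k] c by (simp add: pred)
  qed
qed

section \<open>Compactness: words that almost close up inside the unit interval\<close>

lemma clamp_unit: "max 0 (min 1 y) \<in> {0..1::real}"
  by auto

lemma clamp_nearest: "0 \<le> r \<Longrightarrow> r \<le> 1 \<Longrightarrow> \<bar>y - max 0 (min 1 y)\<bar> \<le> \<bar>r - (y::real)\<bar>"
  by (simp add: max_def min_def)

text \<open>Measures how far \<open>e\<close> is from being a loop at \<open>x\<close> inside
  \<open>[0,1]\<close>. Being continuous in \<open>x\<close>, it turns the absence of exact double
  loops into a uniform bound.\<close>

definition overshoot :: "letter list \<Rightarrow> real \<Rightarrow> real" where
  "overshoot e x = \<bar>app_word e x - x\<bar> +
     (\<Sum>k\<le>length e. \<bar>app_word (take k e) x - max 0 (min 1 (app_word (take k e) x))\<bar>)"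

lemma overshoot_nonneg: "overshoot e x \<ge> 0"
  unfolding overshoot_def by (intro add_nonneg_nonneg sum_nonneg) auto

lemma overshoot_eq_0: assumes "overshoot e x = 0" shows "app_word e x = x" "confined e x"
proof -
  have s: "(\<Sum>k\<le>length e. \<bar>app_word (take k e) x - max 0 (min 1 (app_word (take k e) x))\<bar>) \<ge> 0"
    by (intro sum_nonneg) auto
  then show "app_word e x = x" using assms unfolding overshoot_def by linarith
  have "(\<Sum>k\<le>length e. \<bar>app_word (take k e) x - max 0 (min 1 (app_word (take k e) x))\<bar>) = 0"
    using s assms unfolding overshoot_def by linarith
  then have 0: "\<forall>k\<le>length e. \<bar>app_word (take k e) x - max 0 (min 1 (app_word (take k e) x))\<bar> = 0"
    by (subst (asm) sum_nonneg_eq_0_iff) auto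
  show "confined e x" unfolding confined_def
  proof (intro allI impI)
    fix k assume "k \<le> length e"
    then have "app_word (take k e) x = max 0 (min 1 (app_word (take k e) x))" using 0 by simp
    then show "app_word (take k e) x \<in> {0..1}"
      using clamp_unit by metis
  qed
qed

lemma near_walk_less: "near_walk T ws n m \<Longrightarrow> n < T \<Longrightarrow> m < T"
  by (induction ws arbitrary: n) auto

text \<open>Each prefix of the walk ends at some gap \<open>m < T\<close>, and \<open>m / T\<close>
  is a point of \<open>[0,1]\<close> within the rounding error of the image under that
  prefix.\<close>

lemma near_loop_overshoot:
  assumes w: "near_walk T e n n" and n: "n < T"
  shows "overshoot e (real n / real T) \<le> (real (length e) + 2) * (4 * 2 ^ length e) / real T"
proof -
  let ?x = "real n / real T" and ?A = "4 * 2 ^ length e / real T"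
  have T: "T > 0" using n by simp
  have near: "\<exists>m<T. \<bar>real m / real T - app_word (take k e) ?x\<bar> \<le> ?A" for k
  proof -
    have "near_walk T (take k e @ drop k e) n n" using w by simp
    then obtain m where m: "near_walk T (take k e) n m" unfolding walk_append by blast
    have mT: "m < T" using near_walk_less[OF m n] .
    have "\<bar>real m - real T * app_word (take k e) ?x\<bar> \<le> 4 * 2 ^ length (take k e)"
      by (rule near_walk_app_word[OF T m])
    also have "\<dots> \<le> 4 * 2 ^ length e" by (intro mult_left_mono power_increasing) auto
    finally have "\<bar>real m - real T * app_word (take k e) ?x\<bar> / real T \<le> ?A"
      by (intro divide_right_mono) auto
    moreover have "\<bar>real m - real T * y\<bar> / real T = \<bar>real m / real T - y\<bar>" for y
    proof -
      have "\<bar>real m - real T * y\<bar> / real T = \<bar>(real m - real T * y) / real T\<bar>" by simp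
      also have "(real m - real T * y) / real T = real m / real T - y" using T by (simp add: diff_divide_distrib)
      finally show ?thesis .
    qed
    ultimately show ?thesis using mT by auto
  qed
  have cl: "\<bar>app_word (take k e) ?x - max 0 (min 1 (app_word (take k e) ?x))\<bar> \<le> ?A" for k
  proof -
    obtain m where "m < T" "\<bar>real m / real T - app_word (take k e) ?x\<bar> \<le> ?A" using near by blast
    moreover have "0 \<le> real m / real T" "real m / real T \<le> 1" using \<open>m < T\<close> by auto
    ultimately show ?thesis using clamp_nearest[of "real m / real T" "app_word (take k e) ?x"] by linarith
  qed
  have "(\<Sum>k\<le>length e. \<bar>app_word (take k e) ?x - max 0 (min 1 (app_word (take k e) ?x))\<bar>)
      \<le> (\<Sum>k\<le>length e. ?A)" by (rule sum_mono) (rule cl)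
  moreover have "\<bar>app_word e ?x - ?x\<bar> \<le> ?A"
  proof -
    have "\<bar>real n / real T - app_word e ?x\<bar> = \<bar>real n - real T * app_word e ?x\<bar> / real T"
    proof -
      have "real n / real T - app_word e ?x = (real n - real T * app_word e ?x) / real T"
        using T by (simp add: diff_divide_distrib)
      then show ?thesis by simp
    qed
    also have "\<dots> \<le> ?A" by (intro divide_right_mono near_walk_app_word[OF T w]) auto
    finally show ?thesis by (simp add: abs_minus_commute)
  qed
  ultimately have "overshoot e ?x \<le> ?A + (\<Sum>k\<le>length e. ?A)" unfolding overshoot_def by linarith
  also have "\<dots> = (real (length e) + 2) * (4 * 2 ^ length e) / real T"
    by (simp add: distrib_right add_divide_distrib[symmetric])
  finally show ?thesis .
qed

text \<open>The joint overshoot has a minimum on \<open>[0,1]\<close>, which is positive by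
  \<open>no_double_loop\<close>; two near loops at one gap would make it at most
  \<open>K / T\<close>.\<close>

lemma eventually_no_double_loop:
  assumes "reduced (m # e1)" "reduced (m # e2)" "last e1 = m" "last e2 = m" "e1 \<parallel> e2"
  shows "\<forall>\<^sub>F T in sequentially. \<forall>n<T. \<not> (near_walk T e1 n n \<and> near_walk T e2 n n)"
proof -
  have cont: "continuous_on A (\<lambda>x. app_word e x)" for A e
    using continuous_on_subset[OF continuous_app_word] by auto
  have "continuous_on {0..1} (\<lambda>x. overshoot e1 x + overshoot e2 x)"
    unfolding overshoot_def by (intro continuous_intros cont)
  then have "\<exists>x0\<in>{0..1}. \<forall>x\<in>{0..1}. overshoot e1 x0 + overshoot e2 x0 \<le> overshoot e1 x + overshoot e2 x"
    by (intro continuous_attains_inf) auto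
  then obtain x0 where x0: "\<And>x. x \<in> {0..1} \<Longrightarrow> overshoot e1 x0 + overshoot e2 x0 \<le> overshoot e1 x + overshoot e2 x"
    by blast
  define \<eta> where "\<eta> = overshoot e1 x0 + overshoot e2 x0"
  have "\<eta> \<noteq> 0"
  proof
    assume "\<eta> = 0"
    then have "overshoot e1 x0 = 0" "overshoot e2 x0 = 0"
      using overshoot_nonneg[of e1 x0] overshoot_nonneg[of e2 x0] unfolding \<eta>_def
      by (simp_all add: add_nonneg_eq_0_iff)
    then show False using no_double_loop[of e1 x0 e2 m] overshoot_eq_0 assms by blast
  qed
  then have \<eta>: "\<eta> > 0" using overshoot_nonneg[of e1 x0] overshoot_nonneg[of e2 x0] unfolding \<eta>_def by linarith
  define K where "K = (real (length e1) + 2) * (4 * 2 ^ length e1) + (real (length e2) + 2) * (4 * 2 ^ length e2)"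
  have "(\<lambda>T. K / real T) \<longlonglongrightarrow> 0" by real_asymp
  then have "\<forall>\<^sub>F T in sequentially. K / real T < \<eta>" using \<eta> by (rule order_tendstoD)
  then show ?thesis
  proof eventually_elim
    case (elim T)
    show ?case
    proof (intro allI impI notI)
      fix n assume n: "n < T" and w: "near_walk T e1 n n \<and> near_walk T e2 n n"
      have "\<eta> \<le> overshoot e1 (real n / real T) + overshoot e2 (real n / real T)"
        using x0[of "real n / real T"] n unfolding \<eta>_def by auto
      also have "\<dots> \<le> K / real T"
        using near_loop_overshoot[of T e1 n] near_loop_overshoot[of T e2 n] w n
        unfolding K_def by (simp add: add_divide_distrib)
      finally show False using elim by simp
    qed
  qed
qed

definition no_short_double_loops :: "nat \<Rightarrow> nat \<Rightarrow> bool" where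
  "no_short_double_loops L T \<longleftrightarrow> (\<forall>m e1 e2. length e1 \<le> L \<longrightarrow> length e2 \<le> L \<longrightarrow>
     reduced (m # e1) \<longrightarrow> reduced (m # e2) \<longrightarrow> last e1 = m \<longrightarrow> last e2 = m \<longrightarrow> e1 \<parallel> e2 \<longrightarrow>
     (\<forall>n<T. \<not> (near_walk T e1 n n \<and> near_walk T e2 n n)))"

lemma eventually_no_short_double_loops: "\<forall>\<^sub>F T in sequentially. no_short_double_loops L T"
proof -
  define X where "X = {(m, e1, e2). e1 \<in> short_words L \<and> e2 \<in> short_words L \<and>
     reduced (m # e1) \<and> reduced (m # e2) \<and> last e1 = m \<and> last e2 = m \<and> e1 \<parallel> e2}"
  have "X \<subseteq> UNIV \<times> short_words L \<times> short_words L" unfolding X_def by auto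
  then have "finite X" by (rule finite_subset) (use finite_short_words in auto)
  then have "\<forall>\<^sub>F T in sequentially. \<forall>p\<in>X. \<forall>n<T. \<not> (near_walk T (fst (snd p)) n n \<and> near_walk T (snd (snd p)) n n)"
    by (rule eventually_ball_finite) (use eventually_no_double_loop in \<open>auto simp: X_def\<close>)
  then show ?thesis
  proof eventually_elim
    case (elim T)
    show ?case unfolding no_short_double_loops_def
    proof (intro allI impI)
      fix m e1 e2 n
      assume "length e1 \<le> L" "length e2 \<le> L" "reduced (m # e1)" "reduced (m # e2)" "last e1 = m" "last e2 = m"
        "e1 \<parallel> e2" and n: "n < T"
      then have "(m, e1, e2) \<in> X" by (simp add: X_def)
      from bspec[OF elim this] n show "\<not> (near_walk T e1 n n \<and> near_walk T e2 n n)" by simp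
    qed
  qed
qed

end

text \<open>\<open>step_rel\<close> is the graph on the gaps without the slips. A slip sends the single gap \<open>slip_dom\<close>
  onto the union of the two adjacent gaps \<open>slip_rng 0\<close> and \<open>slip_rng 1\<close>.\<close>

definition step_rel :: "nat \<Rightarrow> (bool \<Rightarrow> nat set) \<Rightarrow> (nat \<times> nat) set" where
  "step_rel T Z = {(n, m). \<exists>l. step T Z l n m}"

definition slip_dom :: "nat \<Rightarrow> bool \<times> nat \<Rightarrow> nat" where
  "slip_dom T i = flip_gap T (fst i) (snd i)"

definition slip_rng :: "nat \<Rightarrow> (bool \<Rightarrow> nat set) \<Rightarrow> nat \<Rightarrow> bool \<times> nat \<Rightarrow> nat" where
  "slip_rng T Z e i = flip_gap T (fst i) (shift (Z (fst i)) (snd i) + e)"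

definition inner_slips :: "nat \<Rightarrow> (bool \<Rightarrow> nat set) \<Rightarrow> (bool \<times> nat) set" where
  "inner_slips T Z = {(b, z). z \<in> Z b \<and> Suc (shift (Z b) z) < T}"

definition slip_ends :: "nat \<Rightarrow> (bool \<Rightarrow> nat set) \<Rightarrow> bool \<times> nat \<Rightarrow> nat set" where
  "slip_ends T Z i = {slip_dom T i, slip_rng T Z 0 i, slip_rng T Z 1 i}"

text \<open>Interface between the combinatorics and the analysis. Weights will spread over
  \<open>N\<close> steps from a slip, hence the distances \<open>2 * N\<close>; that each staircase
  hits \<open>T\<close> makes the last source interval end exactly at \<open>1\<close>.\<close>

definition slip_system :: "nat \<Rightarrow> nat \<Rightarrow> (bool \<Rightarrow> nat set) \<Rightarrow> bool" where
  "slip_system N T Z \<longleftrightarrow> T > 2 \<and> (\<forall>b. 0 \<in> Z b) \<and> (\<forall>b. \<exists>n. shift (Z b) n = T) \<and>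
    (\<forall>i\<in>inner_slips T Z. \<forall>j\<in>inner_slips T Z. i \<noteq> j \<longrightarrow>
       (\<forall>x\<in>slip_ends T Z i. \<forall>y\<in>slip_ends T Z j. \<forall>k\<le>2 * N. (x, y) \<notin> step_rel T Z ^^ k)) \<and>
    (\<forall>i\<in>inner_slips T Z. \<forall>k\<le>2 * N. \<forall>k'\<le>2 * N.
       \<not> ((slip_dom T i, slip_rng T Z 0 i) \<in> step_rel T Z ^^ k \<and>
          (slip_dom T i, slip_rng T Z 1 i) \<in> step_rel T Z ^^ k'))"

section \<open>Reduced walks in the graph of steps\<close>

lemma step_rel_relpow: "(n, m) \<in> step_rel T Z ^^ k \<longleftrightarrow> (\<exists>ws. length ws = k \<and> walk (step T Z) ws n m)"
proof (induction k arbitrary: n)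
  case (Suc k)
  have "(n, m) \<in> step_rel T Z ^^ Suc k \<longleftrightarrow> (\<exists>n'. (n, n') \<in> step_rel T Z \<and> (n', m) \<in> step_rel T Z ^^ k)"
    by (meson relpow_Suc_D2 relpow_Suc_I2)
  also have "\<dots> \<longleftrightarrow> (\<exists>l ws. length ws = k \<and> walk (step T Z) (l # ws) n m)"
    unfolding Suc by (auto simp: step_rel_def)
  also have "\<dots> \<longleftrightarrow> (\<exists>ws. length ws = Suc k \<and> walk (step T Z) ws n m)"
    by (metis length_Suc_conv)
  finally show ?case .
qed auto

lemma sym_step_rel: "sym (step_rel T Z)"
proof (rule symI)
  fix n m assume "(n, m) \<in> step_rel T Z"
  then obtain l where "step T Z l n m" by (auto simp: step_rel_def)
  then have "step T Z (inv_letter l) m n" by (simp only: step_inv)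
  then show "(m, n) \<in> step_rel T Z" unfolding step_rel_def by blast
qed

lemma walk_det: "walk (step T Z) ws n m \<Longrightarrow> walk (step T Z) ws n m' \<Longrightarrow> m = m'"
  by (induction ws arbitrary: n) (auto dest: step_det)

lemma shortest_walk_reduced:
  assumes w: "walk (step T Z) ws n m"
  obtains ws' where "length ws' \<le> length ws" "walk (step T Z) ws' n m" "reduced ws'"
proof -
  define ws' where "ws' = arg_min length (\<lambda>ws. walk (step T Z) ws n m)"
  have w': "walk (step T Z) ws' n m" and le: "\<And>u. walk (step T Z) u n m \<Longrightarrow> length ws' \<le> length u"
    unfolding ws'_def using w by (auto intro: arg_min_natI arg_min_nat_le)
  have "reduced ws'"
  proof (rule ccontr)
    assume "\<not> reduced ws'"
    then obtain p c d q where pq: "ws' = p @ c # d # q" "d = inv_letter c"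
      by (rule not_successivelyE) auto
    then obtain u v u' where u: "walk (step T Z) p n u" "step T Z c u v" "step T Z (inv_letter c) v u'"
      "walk (step T Z) q u' m" using w' by (auto simp: walk_append)
    have "u = u'" using step_det[OF step_inv[THEN iffD2, OF u(2)] u(3)] .
    then have "walk (step T Z) (p @ q) n m" using u by (auto simp: walk_append)
    from le[OF this] show False using pq by simp
  qed
  then show ?thesis using that w' le[OF w] by blast
qed

text \<open>Keeps a reduced walk from the domain to a range gap of a slip reduced when the slip edge
  closes it to a loop.\<close>

lemma slip_no_step:
  assumes i: "(b, z) \<in> inner_slips T Z"
  shows "\<not> step T Z (b, False) (slip_dom T (b, z)) m"
    and "e \<le> 1 \<Longrightarrow> \<not> step T Z (b, True) (slip_rng T Z e (b, z)) m"
proof -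
  have z: "z \<in> Z b" "Suc (shift (Z b) z) < T" "z < T"
    using i shift_ge[of z "Z b"] by (auto simp: inner_slips_def)
  show "\<not> step T Z (b, False) (slip_dom T (b, z)) m"
  proof
    assume "step T Z (b, False) (slip_dom T (b, z)) m"
    then obtain j where j: "j \<notin> Z b" "shift (Z b) j < T" "flip_gap T b z = flip_gap T b j"
      by (auto simp: step_def forward_step_def slip_dom_def)
    then have "z = j" using flip_gap_inj[OF z(3), of j b] shift_ge[of j "Z b"] by simp
    then show False using j z by simp
  qed
  show "\<not> step T Z (b, True) (slip_rng T Z e (b, z)) m" if e: "e \<le> 1"
  proof
    assume "step T Z (b, True) (slip_rng T Z e (b, z)) m"
    then obtain j where j: "j \<notin> Z b" "shift (Z b) j < T"
        "flip_gap T b (shift (Z b) z + e) = flip_gap T b (shift (Z b) j)"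
      by (auto simp: step_def forward_step_def slip_rng_def)
    then have "shift (Z b) z + e = shift (Z b) j"
      using flip_gap_inj[of "shift (Z b) z + e" T "shift (Z b) j" b] z e by simp
    then show False using shift_skip[OF z(1), of j] j z e by (cases "e = 0") auto
  qed
qed

section \<open>Existence of slip systems\<close>

context reference
begin

lemma walk_near_walk:
  assumes "T > 0" "R \<le> E" "\<And>b j. j \<in> {1..num_levels T} \<Longrightarrow> c b j < R"
    and "walk (step T (\<lambda>b. slips T (c b))) ws n m"
  shows "near_walk T ws n m"
proof (rule walk_mono[OF assms(4)])
  fix l n m assume s: "step T (\<lambda>b. slips T (c b)) l n m"
  show "n < T \<and> m < T \<and> near_step T l n m"
    using step_near_step[OF assms(1-3) s] step_less[OF s] by simp
qed

lemma slip_near_step: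
  assumes T: "T > 0" and R: "R \<le> E" and c: "\<And>b j. j \<in> {1..num_levels T} \<Longrightarrow> c b j < R"
    and i: "i \<in> inner_slips T (\<lambda>b. slips T (c b))" and e: "e \<le> 1"
  shows "near_walk T [(fst i, False)] (slip_dom T i) (slip_rng T (\<lambda>b. slips T (c b)) e i)"
    and "near_walk T [(fst i, True)] (slip_rng T (\<lambda>b. slips T (c b)) e i) (slip_dom T i)"
proof -
  let ?Z = "\<lambda>b. slips T (c b)"
  obtain b z where bz: "i = (b, z)" by force
  have lt: "shift (?Z b) z + e < T" "z < T"
    using i e shift_ge[of z "?Z b"] unfolding bz inner_slips_def by auto
  have "near_step T (b, False) (flip_gap T b z) (flip_gap T b (shift (?Z b) z + e))"
    by (rule near_step_forward[OF T R c]) (use lt e in auto)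
  moreover from this have "near_step T (b, True) (flip_gap T b (shift (?Z b) z + e)) (flip_gap T b z)"
    by (rule near_step_backward[OF T])
  ultimately show "near_walk T [(fst i, False)] (slip_dom T i) (slip_rng T ?Z e i)"
    "near_walk T [(fst i, True)] (slip_rng T ?Z e i) (slip_dom T i)"
    using flip_gap_less lt unfolding bz slip_dom_def slip_rng_def by auto
qed

text \<open>In \<open>L = 2 * N + 2\<close> the \<open>2\<close> allows one slip edge at each end of
  a walk, so that a walk between any ends of two slips becomes one between their domains.\<close>

lemma exists_slip_system:
  fixes L N R :: nat
  assumes L: "L = 2 * N + 2" "2 * L \<le> E"
    and RE: "real R + 2 ^ L * (8 * 4 ^ L + real R) < real E"
    and CR: "4 * card (short_words L) * (8 * 4 ^ L + 1) < R"
  shows "\<exists>T Z. slip_system N T Z"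
proof -
  have "\<forall>\<^sub>F T in sequentially. T > 8 * 2 ^ L + 2" by (rule eventually_gt_at_top)
  then have "\<forall>\<^sub>F T in sequentially. T > 8 * 2 ^ L + 2 \<and> no_short_double_loops L T"
    using eventually_no_short_double_loops[of L] by (rule eventually_conj)
  from eventually_happens'[OF sequentially_bot this]
  obtain T where T: "T > 8 * 2 ^ L + 2" and "no_short_double_loops L T" by blast
  then have loops: "False" if "length e1 \<le> L" "length e2 \<le> L" "reduced (m # e1)" "reduced (m # e2)"
      "last e1 = m" "last e2 = m" "e1 \<parallel> e2" "n < T" "near_walk T e1 n n" "near_walk T e2 n n" for m e1 e2 n
    using that unfolding no_short_double_loops_def by blast
  obtain c where cc: "(\<forall>b. \<forall>j\<in>{1..num_levels T}. c b j < R) \<and> (\<forall>i \<in> slip_gaps T (\<lambda>b. slips T (c b)). \<forall>j \<in> slip_gaps T (\<lambda>b. slips T (c b)). \<forall>ws \<in> short_words L.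
       i \<noteq> j \<longrightarrow> \<not> near_walk T ws (slip_dom T i) (slip_dom T j))"
    using separated_slips[OF T L(2) RE CR, folded slip_dom_def] ..
  have c: "c b j < R" if "j \<in> {1..num_levels T}" for b j using conjunct1[OF cc] that by blast
  have sep: "\<not> near_walk T ws (slip_dom T i) (slip_dom T j)"
    if "i \<in> slip_gaps T (\<lambda>b. slips T (c b))" "j \<in> slip_gaps T (\<lambda>b. slips T (c b))" "length ws \<le> L" "i \<noteq> j" for i j ws
    using conjunct2[OF cc] that by blast
  define Z where "Z b = slips T (c b)" for b
  note Z = Z_def[abs_def]
  have T0: "T > 0" using T by simp
  have "0 \<le> 2 ^ L * (8 * 4 ^ L + real R)" by simp
  then have R: "R \<le> E" using RE by linarith
  have inner: "i \<in> slip_gaps T (\<lambda>b. slips T (c b))" if "i \<in> inner_slips T Z" for i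
    using that order_le_less_trans[OF shift_ge] unfolding slip_gaps_def inner_slips_def Z
    by (auto dest: Suc_lessD)
  have near: "near_walk T [(fst i, False)] (slip_dom T i) (slip_rng T Z e i)"
    "near_walk T [(fst i, True)] (slip_rng T Z e i) (slip_dom T i)"
    if "i \<in> inner_slips T Z" "e \<le> 1" for i e
    using slip_near_step[of T R c i e] T0 R c that unfolding Z by simp_all
  have real_near: "near_walk T ws x y" if "walk (step T Z) ws x y" for ws x y
    using walk_near_walk[of T R c ws x y] T0 R c that unfolding Z by blast
  have zero: "0 \<in> Z b" for b by (simp add: Z_def slips_def)
  \<comment> \<open>Otherwise some slip has its first range gap at the last gap, which is the domain
    of the slip \<open>0\<close> of the other side, and a single letter joins the two slips.\<close>
  have hit: "\<exists>n. shift (Z b) n = T" for b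
  proof (rule ccontr)
    assume no: "\<nexists>n. shift (Z b) n = T"
    then obtain z where z: "z \<in> Z b" "T = Suc (shift (Z b) z)" using shift_cover[of T "Z b"] by metis
    have lt: "z < T" using z(2) shift_ge[of z "Z b"] by simp
    have z0: "z > 0" using z T by (cases z) auto
    have "near_step T (b, False) (flip_gap T b z) (flip_gap T b (shift (Z b) z + 0))"
      
      using z(2) unfolding Z_def by (intro near_step_forward[OF T0 R] c) auto
    moreover have "flip_gap T b (shift (Z b) z + 0) = flip_gap T (\<not> b) 0"
      using z(2) by (simp add: flip_gap_def)
    ultimately have "near_walk T [(b, False)] (slip_dom T (b, z)) (slip_dom T (\<not> b, 0))"
      using lt flip_gap_less T0 by (simp add: slip_dom_def)
    moreover have "\<not> near_walk T [(b, False)] (slip_dom T (b, z)) (slip_dom T (\<not> b, 0))"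
      by (rule sep) (use z(1) lt L zero T0 in \<open>auto simp: slip_gaps_def Z\<close>)
    ultimately show False by blast
  qed
  have P1: False if ij: "i \<in> inner_slips T Z" "j \<in> inner_slips T Z" "i \<noteq> j"
    and x: "x \<in> slip_ends T Z i" and y: "y \<in> slip_ends T Z j" and k: "k \<le> 2 * N"
    and xy: "(x, y) \<in> step_rel T Z ^^ k" for i j x y k
  proof -
    obtain ws where ws: "length ws = k" "walk (step T Z) ws x y" using xy step_rel_relpow by blast
    have w: "near_walk T ws x y" using real_near[OF ws(2)] .
    obtain us where us: "length us \<le> 1" "near_walk T us (slip_dom T i) x"
    proof -
      consider "x = slip_dom T i" | e where "e \<le> 1" "x = slip_rng T Z e i"
        using x unfolding slip_ends_def by auto
      then show ?thesis
      proof cases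
        case 1 then show ?thesis using that[of "[]"] by simp
      next
        case 2 then show ?thesis using that[of "[(fst i, False)]"] near(1)[OF ij(1)] by simp
      qed
    qed
    obtain vs where vs: "length vs \<le> 1" "near_walk T vs y (slip_dom T j)"
    proof -
      consider "y = slip_dom T j" | e where "e \<le> 1" "y = slip_rng T Z e j"
        using y unfolding slip_ends_def by auto
      then show ?thesis
      proof cases
        case 1 then show ?thesis using that[of "[]"] by simp
      next
        case 2 then show ?thesis using that[of "[(fst j, True)]"] near(2)[OF ij(2)] by simp
      qed
    qed
    have "near_walk T (us @ ws @ vs) (slip_dom T i) (slip_dom T j)"
      using us w vs unfolding walk_append by blast
    then show False using sep[OF inner[OF ij(1)] inner[OF ij(2)]] ij(3) us vs ws k L by auto
  qed
  \<comment> \<open>The inverse slip letter \<open>?m\<close> closes both walks to loops at the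
    domain. The slip edge is not a step but it is a near step, and double loops are excluded for
    near walks.\<close>
  have P2: False if i: "i \<in> inner_slips T Z" and k: "k \<le> 2 * N" "k' \<le> 2 * N"
    and p1: "(slip_dom T i, slip_rng T Z 0 i) \<in> step_rel T Z ^^ k"
    and p2: "(slip_dom T i, slip_rng T Z 1 i) \<in> step_rel T Z ^^ k'" for i k k'
  proof -
    obtain b z where bz: "i = (b, z)" by force
    let ?m = "(b, True)"
    have lt: "shift (Z b) z + 1 < T" "z < T"
      using i shift_ge[of z "Z b"] unfolding bz inner_slips_def by auto
    have word: "\<exists>ws. length ws \<le> 2 * N \<and> walk (step T Z) ws (slip_dom T i) (slip_rng T Z e i) \<and>
        reduced (?m # ws @ [?m]) \<and> near_walk T (ws @ [?m]) (slip_dom T i) (slip_dom T i)"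
      if e: "e \<le> 1" and kk: "kk \<le> 2 * N" and p: "(slip_dom T i, slip_rng T Z e i) \<in> step_rel T Z ^^ kk" for e kk
    proof -
      obtain ws0 where ws0: "length ws0 = kk" "walk (step T Z) ws0 (slip_dom T i) (slip_rng T Z e i)"
        using p step_rel_relpow by blast
      then obtain ws where ws: "length ws \<le> length ws0" "walk (step T Z) ws (slip_dom T i) (slip_rng T Z e i)"
        "reduced ws" using shortest_walk_reduced by blast
      have "reduced (?m # ws @ [?m])"
      proof (cases "ws = []")
        case False
        have "hd ws \<noteq> inv_letter ?m"
        proof
          assume "hd ws = inv_letter ?m"
          then have "ws = (b, False) # tl ws" using False by (metis list.collapse inv_letter_simps(1))
          then obtain u where "step T Z (b, False) (slip_dom T i) u"
            using ws(2) by (metis walk.simps(2))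
          then show False using slip_no_step(1)[OF i[unfolded bz]] unfolding bz by blast
        qed
        moreover have "?m \<noteq> inv_letter (last ws)"
        proof
          assume "?m = inv_letter (last ws)"
          then have "last ws = (b, False)" by (metis inv_letter_simps)
          then have "ws = butlast ws @ [(b, False)]" using False by (metis append_butlast_last_id)
          then have "walk (step T Z) (butlast ws @ [(b, False)]) (slip_dom T i) (slip_rng T Z e i)"
            using ws(2) by simp
          then obtain u where "step T Z (b, False) u (slip_rng T Z e i)" unfolding walk_append by auto
          then have "step T Z (b, True) (slip_rng T Z e i) u"
            using step_inv[of T Z "(b, False)"] by simp
          then show False using slip_no_step(2)[OF i[unfolded bz] e] unfolding bz by blast
        qed
        ultimately show ?thesis using ws(3) False
          by (simp add: successively_Cons successively_append_iff)
      qed simp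
      moreover have "near_walk T (ws @ [?m]) (slip_dom T i) (slip_dom T i)"
        using real_near[OF ws(2)] near(2)[OF i e] unfolding walk_append
        by (simp add: bz Z) blast
      moreover have "length ws \<le> 2 * N" using ws(1) ws0(1) kk by simp
      ultimately show ?thesis using ws(2) by blast
    qed
    obtain ws1 where w1: "length ws1 \<le> 2 * N" "walk (step T Z) ws1 (slip_dom T i) (slip_rng T Z 0 i)"
      "reduced (?m # ws1 @ [?m])" "near_walk T (ws1 @ [?m]) (slip_dom T i) (slip_dom T i)"
      using word[OF _ k(1) p1] by auto
    obtain ws2 where w2: "length ws2 \<le> 2 * N" "walk (step T Z) ws2 (slip_dom T i) (slip_rng T Z 1 i)"
      "reduced (?m # ws2 @ [?m])" "near_walk T (ws2 @ [?m]) (slip_dom T i) (slip_dom T i)"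
      using word[OF _ k(2) p2] by auto
    \<comment> \<open>No step along \<open>?m\<close> starts at a range gap, so neither closed word
      can be continued by the other walk; this makes the closed words parallel.\<close>
    have stuck: "\<not> prefix (ws @ [?m]) ws'" if e: "e \<le> 1"
      and s1: "walk (step T Z) ws (slip_dom T i) (slip_rng T Z e i)"
      and s2: "walk (step T Z) ws' (slip_dom T i) r" for ws ws' e r
    proof
      assume "prefix (ws @ [?m]) ws'"
      then obtain t where t: "ws' = ws @ ?m # t" by (auto simp: prefix_def)
      then obtain u u' where "walk (step T Z) ws (slip_dom T i) u" "step T Z ?m u u'"
        using s2 by (auto simp: walk_append)
      then show False using slip_no_step(2)[OF i[unfolded bz] e] walk_det[OF s1] unfolding bz by blast
    qed
    have ne: "ws1 \<noteq> ws2"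
    proof
      assume "ws1 = ws2"
      then have "slip_rng T Z 0 i = slip_rng T Z 1 i" using walk_det w1(2) w2(2) by blast
      then show False using lt flip_gap_inj[of "shift (Z b) z + 0" T "shift (Z b) z + 1" b]
        unfolding slip_rng_def bz by simp
    qed
    have "ws1 @ [?m] \<parallel> ws2 @ [?m]"
      using ne stuck[OF _ w1(2) w2(2)] stuck[OF _ w2(2) w1(2)] unfolding parallel_def by auto
    then show False
      using loops[OF _ _ w1(3) w2(3) _ _ _ _ w1(4) w2(4)] w1(1) w2(1) L flip_gap_less[OF lt(2)]
      unfolding slip_dom_def bz by simp
  qed
  have "T > 2" using T by simp
  then have "slip_system N T Z" unfolding slip_system_def using zero hit P1 P2 by blast
  then show ?thesis by blast
qed

end

section \<open>Lengths of the gaps\<close>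

text \<open>Weights decay geometrically with the distance from the slips. A slip with a range gap close to
  its domain gap carries the large weight \<open>\<Lambda>\<close> on both, so the extra length \<open>2\<close> of the range is
  negligible; all other slips have lengths \<open>3\<close> and \<open>1 + 1 + 1\<close>.\<close>

lemma exists_weights:
  fixes G :: "('v \<times> 'v) set" and d :: "'i \<Rightarrow> 'v" and r :: "nat \<Rightarrow> 'i \<Rightarrow> 'v" and \<rho> \<Lambda> :: real
  assumes \<rho>: "0 < \<rho>" "\<rho> < 1" and \<Lambda>: "3 \<le> \<Lambda>" "2 \<le> \<Lambda> * (1 - \<rho>)" "\<Lambda> * \<rho> ^ N \<le> 1"
    and sep: "\<And>i j x y k. i \<in> I \<Longrightarrow> j \<in> I \<Longrightarrow> i \<noteq> j \<Longrightarrow> x \<in> {d i, r 0 i, r 1 i} \<Longrightarrow>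
      y \<in> {d j, r 0 j, r 1 j} \<Longrightarrow> k \<le> 2 * N \<Longrightarrow> (x, y) \<notin> G ^^ k"
    and one: "\<And>i k k'. i \<in> I \<Longrightarrow> k \<le> 2 * N \<Longrightarrow> k' \<le> 2 * N \<Longrightarrow>
      (d i, r 0 i) \<in> G ^^ k \<Longrightarrow> (d i, r 1 i) \<in> G ^^ k' \<Longrightarrow> False"
  shows "\<exists>w :: 'v \<Rightarrow> real. (\<forall>v. 1 \<le> w v) \<and> (\<forall>(n, m)\<in>G. \<rho> * w n \<le> w m) \<and>
    (\<forall>i\<in>I. \<rho> * w (d i) \<le> w (r 0 i) + w (r 1 i) + 1 \<and> \<rho> * (w (r 0 i) + w (r 1 i) + 1) \<le> w (d i))"
proof -
  define close where "close x y \<longleftrightarrow> (\<exists>k\<le>N. (x, y) \<in> G ^^ k)" for x y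
  \<comment> \<open>The gaps carrying the full weight of slip \<open>i\<close>.\<close>
  define A where "A i = {d i} \<union> {r e i | e. e \<in> {0, 1} \<and> close (d i) (r e i)}" for i
  define val where "val i = (if close (d i) (r 0 i) \<or> close (d i) (r 1 i) then \<Lambda> else 3)" for i
  define V where "V v = {1} \<union> {val i * \<rho> ^ k | i k s. i \<in> I \<and> k \<le> N \<and> s \<in> A i \<and> (s, v) \<in> G ^^ k}" for v
  define w where "w v = Max (V v)" for v
  have val3: "3 \<le> val i" and val\<Lambda>: "val i \<le> \<Lambda>" for i using \<Lambda> by (auto simp: val_def)
  have fin: "finite (V v)" for v
  proof (rule finite_subset)
    show "V v \<subseteq> {1} \<union> (\<lambda>(c, k). c * \<rho> ^ k) ` ({3, \<Lambda>} \<times> {..N})"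
      unfolding V_def val_def by force
  qed simp
  have ne: "V v \<noteq> {}" for v by (simp add: V_def)
  have w_ge: "x \<le> w v" if "x \<in> V v" for x v unfolding w_def using fin that by simp
  have w_in: "w v \<in> V v" for v unfolding w_def using fin ne by simp
  have w1: "1 \<le> w v" for v by (rule w_ge) (simp add: V_def)
  have edge: "\<rho> * w n \<le> w m" if nm: "(n, m) \<in> G" for n m
  proof -
    have "w n \<in> V n" by (rule w_in)
    then consider "w n = 1" | i k s where "i \<in> I" "k \<le> N" "s \<in> A i" "(s, n) \<in> G ^^ k" "w n = val i * \<rho> ^ k"
      unfolding V_def by blast
    then show ?thesis
    proof cases
      case 1
      then show ?thesis using \<rho> w1[of m] by simp
    next
      case 2
      show ?thesis
      \<comment> \<open>At radius \<open>N\<close> a contribution has decayed to at most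
        \<open>1\<close>, so cutting it off there is compatible with the edge condition.\<close>
      proof (cases "k = N")
        case True
        have "val i * \<rho> ^ N \<le> \<Lambda> * \<rho> ^ N" using val\<Lambda> \<rho> by (intro mult_right_mono) auto
        then have "w n \<le> 1" using \<Lambda> 2 True by simp
        then have "\<rho> * w n \<le> 1 * 1" using \<rho> w1[of n] by (intro mult_mono) auto
        then show ?thesis using w1[of m] by simp
      next
        case False
        then have "Suc k \<le> N" "(s, m) \<in> G ^^ Suc k" using 2 nm by auto
        then have "val i * \<rho> ^ Suc k \<in> V m" unfolding V_def using 2 by blast
        from w_ge[OF this] show ?thesis using 2 by (simp add: mult_ac)
      qed
    qed
  qed
  have A: "A i \<subseteq> {d i, r 0 i, r 1 i}" for i unfolding A_def by auto
  have le: "w x \<le> val i" if i: "i \<in> I" and x: "x \<in> {d i, r 0 i, r 1 i}" for i x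
  proof -
    have "w x \<in> V x" by (rule w_in)
    then consider "w x = 1" | j k s where "j \<in> I" "k \<le> N" "s \<in> A j" "(s, x) \<in> G ^^ k" "w x = val j * \<rho> ^ k"
      unfolding V_def by blast
    then show ?thesis
    proof cases
      case 1
      then show ?thesis using val3[of i] by simp
    next
      case 2
      have "j = i" using sep[of j i s x k] 2 i x A[of j] by auto
      moreover have "val j * \<rho> ^ k \<le> val j * 1"
        using val3[of j] \<rho> by (intro mult_left_mono power_le_one) auto
      ultimately show ?thesis using 2 by simp
    qed
  qed
  have eq1: "w x = 1" if i: "i \<in> I" and x: "x \<in> {d i, r 0 i, r 1 i}" and far: "\<And>s. s \<in> A i \<Longrightarrow> \<not> close s x" for i x
  proof -
    have "w x \<in> V x" by (rule w_in)
    then consider "w x = 1" | j k s where "j \<in> I" "k \<le> N" "s \<in> A j" "(s, x) \<in> G ^^ k"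
      unfolding V_def by blast
    then show ?thesis
    proof cases
      case 2
      have "j = i" using sep[of j i s x k] 2 i x A[of j] by auto
      then show ?thesis using far 2 unfolding close_def by blast
    qed
  qed
  have eqv: "w x = val i" if i: "i \<in> I" and x: "x \<in> A i" for i x
  proof -
    have "(x, x) \<in> G ^^ 0" by simp
    then have "val i * \<rho> ^ 0 \<in> V x" unfolding V_def using i x by blast
    from w_ge[OF this] show ?thesis using le[OF i, of x] x A[of i] by auto
  qed
  have slip: "\<rho> * w (d i) \<le> w (r 0 i) + w (r 1 i) + 1 \<and> \<rho> * (w (r 0 i) + w (r 1 i) + 1) \<le> w (d i)"
    if i: "i \<in> I" for i
  proof -
    have d: "w (d i) = val i" using eqv[OF i, of "d i"] by (simp add: A_def)
    \<comment> \<open>A short connection from a source \<open>s\<close> of the same slip would bring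
      both range gaps within \<open>2 * N\<close> steps of the domain.\<close>
    have far: "\<not> close s (r e' i)" if e: "e \<in> {0, 1}" "e' \<in> {0, 1}" "e \<noteq> e'" "close (d i) (r e i)"
      and s: "s \<in> A i" for s e e'
    proof
      assume c: "close s (r e' i)"
      have "close (d i) s" using s by (auto simp: A_def close_def intro: exI[of _ 0])
      then obtain k k' k'' where k: "k \<le> N" "k' \<le> N" "k'' \<le> N" "(d i, s) \<in> G ^^ k"
        "(s, r e' i) \<in> G ^^ k'" "(d i, r e i) \<in> G ^^ k''"
        using c e(4) unfolding close_def by blast
      then have "(d i, r e' i) \<in> G ^^ (k + k')" by (auto simp: relpow_add)
      then show False using one[OF i, of "k + k'" k''] one[OF i, of k'' "k + k'"] k e by auto
    qed
    \<comment> \<open>The additional \<open>1 + 1\<close> is the distant range gap of weight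
      \<open>1\<close> and the space in between.\<close>
    have two: "\<rho> * (\<Lambda> + 1 + 1) \<le> \<Lambda>" "\<rho> * \<Lambda> \<le> \<Lambda> + 1 + 1"
    proof -
      have "\<rho> * \<Lambda> \<le> 1 * \<Lambda>" using \<rho> \<Lambda> by (intro mult_right_mono) auto
      then show "\<rho> * (\<Lambda> + 1 + 1) \<le> \<Lambda>" "\<rho> * \<Lambda> \<le> \<Lambda> + 1 + 1" using \<rho> \<Lambda>(2) by (auto simp: algebra_simps)
    qed
    consider (0) "close (d i) (r 0 i)" | (1) "close (d i) (r 1 i)"
      | (no) "\<not> close (d i) (r 0 i)" "\<not> close (d i) (r 1 i)" by blast
    then show ?thesis
    proof cases
      case 0
      then have "w (r 0 i) = \<Lambda>" "w (d i) = \<Lambda>" using eqv[OF i, of "r 0 i"] d by (auto simp: A_def val_def)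
      moreover have "w (r 1 i) = 1" by (rule eq1[OF i _ far[of 0 1]]) (use 0 in auto)
      ultimately show ?thesis using two by simp
    next
      case 1
      then have "w (r 1 i) = \<Lambda>" "w (d i) = \<Lambda>" using eqv[OF i, of "r 1 i"] d by (auto simp: A_def val_def)
      moreover have "w (r 0 i) = 1" using far[of 1 0] 1 by (intro eq1[OF i]) auto
      ultimately show ?thesis using two by (simp add: add_ac)
    next
      case no
      then have "A i = {d i}" unfolding A_def by auto
      then have s: "\<not> close s (r 0 i)" "\<not> close s (r 1 i)" if "s \<in> A i" for s using no that by simp_all
      have "w (r 0 i) = 1" by (rule eq1[OF i _ s(1)]) auto
      moreover have "w (r 1 i) = 1" by (rule eq1[OF i _ s(2)]) auto
      moreover have "w (d i) = 3" using no d by (simp add: val_def)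
      ultimately show ?thesis using \<rho> by simp
    qed
  qed
  show ?thesis using w1 edge slip by (intro exI[of _ w]) blast
qed

section \<open>A contracting map with given gaps\<close>

text \<open>The cubic is flat at both ends, so successive transitions join in class C1. The
  quadratic is flat at \<open>1\<close> only and serves for the interval that starts at the fixed
  point.\<close>

definition ease :: "bool \<Rightarrow> real \<Rightarrow> real" where
  "ease s t = (if t \<ge> 1 then 1 else if s then 2 * t - t\<^sup>2 else if t \<le> 0 then 0 else 3 * t\<^sup>2 - 2 * t ^ 3)"

definition ease' :: "bool \<Rightarrow> real \<Rightarrow> real" where
  "ease' s t = (if t \<ge> 1 then 0 else if s then 2 - 2 * t else if t \<le> 0 then 0 else 6 * t - 6 * t\<^sup>2)"

lemma glue_deriv:
  fixes f g :: "real \<Rightarrow> real"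
  assumes f: "\<And>t. (f has_real_derivative f' t) (at t)" and g: "\<And>t. (g has_real_derivative g' t) (at t)"
    and c: "f c = g c" "f' c = g' c"
  shows "((\<lambda>t. if c \<le> t then f t else g t) has_real_derivative (if c \<le> t then f' t else g' t)) (at t)"
proof -
  have "((\<lambda>t. if t \<in> {c..} then f t else g t) has_vector_derivative (if t \<in> {c..} then f' t else g' t))
      (at t within UNIV)"
  proof (rule has_vector_derivative_If_within_closures[where T = "{..c}"])
    show "(f has_vector_derivative f' t) (at t within X)" "(g has_vector_derivative g' t) (at t within X)" for X
      using f[of t] g[of t] unfolding has_real_derivative_iff_has_vector_derivative
      by (auto intro: has_vector_derivative_at_within)
  qed (use c in auto)
  then show ?thesis unfolding has_real_derivative_iff_has_vector_derivative by simp
qed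

lemma ease_deriv: "(ease s has_real_derivative ease' s t) (at t)"
proof (cases s)
  case True
  have "((\<lambda>t. if 1 \<le> t then 1 else 2 * t - t\<^sup>2) has_real_derivative (if 1 \<le> t then 0 else 2 - 2 * t)) (at t)"
    by (rule glue_deriv) (auto intro!: derivative_eq_intros simp: power2_eq_square)
  moreover have "ease s = (\<lambda>t. if 1 \<le> t then 1 else 2 * t - t\<^sup>2)" "ease' s t = (if 1 \<le> t then 0 else 2 - 2 * t)"
    using True by (auto simp: ease_def ease'_def fun_eq_iff)
  ultimately show ?thesis by simp
next
  case False
  have sm: "((\<lambda>t. if 0 \<le> t then 3 * t\<^sup>2 - 2 * t ^ 3 else 0) has_real_derivative
      (if 0 \<le> t then 6 * t - 6 * t\<^sup>2 else 0)) (at t)" for t :: real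
    by (rule glue_deriv) (auto intro!: derivative_eq_intros simp: power2_eq_square)
  have "((\<lambda>t. if 1 \<le> t then 1 else if 0 \<le> t then 3 * t\<^sup>2 - 2 * t ^ 3 else 0) has_real_derivative
      (if 1 \<le> t then 0 else if 0 \<le> t then 6 * t - 6 * t\<^sup>2 else 0)) (at t)"
    by (rule glue_deriv) (use sm in \<open>auto intro!: derivative_eq_intros simp: power2_eq_square\<close>)
  moreover have "ease s = (\<lambda>t. if 1 \<le> t then 1 else if 0 \<le> t then 3 * t\<^sup>2 - 2 * t ^ 3 else 0)"
    "ease' s t = (if 1 \<le> t then 0 else if 0 \<le> t then 6 * t - 6 * t\<^sup>2 else 0)"
    using False by (auto simp: ease_def ease'_def fun_eq_iff)
  ultimately show ?thesis by simp
qed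

lemma continuous_ease': "continuous_on UNIV (ease' s)"
proof -
  have "ease' s = (\<lambda>t. if s then 2 - 2 * min t 1 else 6 * max 0 (min t 1) - 6 * (max 0 (min t 1))\<^sup>2)"
    by (auto simp: ease'_def fun_eq_iff max_def min_def)
  then show ?thesis by (cases s) (auto intro!: continuous_intros)
qed

lemma ease_bounds:
  "t \<ge> 1 \<Longrightarrow> ease s t = 1" "t \<ge> 1 \<Longrightarrow> ease' s t = 0" "t \<le> 0 \<Longrightarrow> ease False t = 0" "t \<le> 0 \<Longrightarrow> ease' False t = 0"
  "ease s 0 = 0" "ease' True 0 = 2"
  "t \<ge> 0 \<Longrightarrow> 0 \<le> ease s t" "ease s t \<le> 1" "t > 0 \<Longrightarrow> 0 < ease s t" "t \<ge> 0 \<Longrightarrow> \<bar>ease' s t\<bar> \<le> 2"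
proof -
  have cubic: "3 * t\<^sup>2 - 2 * t ^ 3 = t\<^sup>2 * (3 - 2 * t)" by (simp add: power2_eq_square power3_eq_cube algebra_simps)
  have cubic1: "1 - (3 * t\<^sup>2 - 2 * t ^ 3) = (1 - t)\<^sup>2 * (1 + 2 * t)"
    by (simp add: power2_eq_square power3_eq_cube algebra_simps)
  have quad: "2 * t - t\<^sup>2 = t * (2 - t)" "1 - (2 * t - t\<^sup>2) = (1 - t)\<^sup>2" by (simp_all add: power2_eq_square algebra_simps)
  show "t \<ge> 1 \<Longrightarrow> ease s t = 1" "t \<ge> 1 \<Longrightarrow> ease' s t = 0" "t \<le> 0 \<Longrightarrow> ease False t = 0"
    "t \<le> 0 \<Longrightarrow> ease' False t = 0" "ease s 0 = 0" "ease' True 0 = 2" by (auto simp: ease_def ease'_def)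
  have pos: "0 < ease s t" if "t > 0"
    using that by (auto simp: ease_def cubic quad(1) intro!: mult_pos_pos)
  show "t > 0 \<Longrightarrow> 0 < ease s t" by (rule pos)
  show "0 \<le> ease s t" if "t \<ge> 0"
    using pos that by (cases "t = 0") (auto simp: ease_def)
  have "0 \<le> 1 - ease s t"
  proof (cases "t \<ge> 1 \<or> (\<not> s \<and> t \<le> 0)")
    case False
    then have "1 - ease s t = (1 - t)\<^sup>2 \<or> (1 - ease s t = (1 - t)\<^sup>2 * (1 + 2 * t) \<and> 0 \<le> t)"
      unfolding ease_def using cubic1 quad(2) by auto
    then show ?thesis by (elim disjE conjE) (simp_all only:, simp_all)
  qed (auto simp: ease_def)
  then show "ease s t \<le> 1" by simp
  have "6 * t - 6 * t\<^sup>2 = 6 * (t * (1 - t))" by (simp add: power2_eq_square algebra_simps)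
  moreover have "t * (1 - t) \<le> 1 / 4"
    using zero_le_power2[of "t - 1 / 2"] by (simp add: power2_eq_square algebra_simps)
  moreover have "0 \<le> t * (1 - t)" if "t \<ge> 0" "t \<le> 1" using that by simp
  ultimately show "\<bar>ease' s t\<bar> \<le> 2" if "t \<ge> 0" using that by (auto simp: ease'_def)
qed

section \<open>Layout of gaps and spaces\<close>

definition total :: "nat \<Rightarrow> (nat \<Rightarrow> real) \<Rightarrow> real" where "total T w = (\<Sum>j<T. w j + 1) - 1"

text \<open>Gaps of length \<open>w j\<close> alternate with spaces of length \<open>1\<close>,
  beginning and ending with a gap, and everything is scaled to total length \<open>1\<close>. Index
  \<open>T\<close> thus lies one space to the right of \<open>1\<close>.\<close>

definition left_end :: "nat \<Rightarrow> (nat \<Rightarrow> real) \<Rightarrow> nat \<Rightarrow> real" where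
  "left_end T w i = (\<Sum>j<i. w j + 1) / total T w"

definition spaces :: "nat \<Rightarrow> (nat \<Rightarrow> real) \<Rightarrow> real set" where
  "spaces T w = (\<Union>i\<in>{1..<T}. {left_end T w i - 1 / total T w<..<left_end T w i})"

lemma total_pos: assumes "T > 0" "\<And>j. w j \<ge> 1" shows "total T w > 0"
proof -
  have "(\<Sum>j<T. 2) \<le> (\<Sum>j<T. w j + 1)" using assms(2) by (intro sum_mono) (simp add: add.commute)
  then show ?thesis using assms(1) by (simp add: total_def)
qed

lemma left_end_Suc: "left_end T w (Suc i) = left_end T w i + w i / total T w + 1 / total T w"
  by (simp add: left_end_def add_divide_distrib)

lemma left_end_0 [simp]: "left_end T w 0 = 0"
  by (simp add: left_end_def)

lemma left_end_top: assumes "total T w > 0" shows "left_end T w T = 1 + 1 / total T w"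
proof -
  have "(\<Sum>j<T. w j + 1) = total T w + 1" by (simp add: total_def)
  then show ?thesis using assms by (simp add: left_end_def add_divide_distrib)
qed

text \<open>The map sends the interval from \<open>left_end (shift n)\<close> to \<open>left_end (shift (n + 1)) - 1 / total\<close>
  onto the \<open>n\<close>-th gap and is a translation on the space which follows that interval. The easing
  function used for \<open>n = 0\<close> has slope \<open>2\<close> at \<open>0\<close>, which makes the derivative there less than \<open>1\<close>.\<close>

lemma exists_contracting_map:
  fixes \<rho> :: real and w :: "nat \<Rightarrow> real"
  assumes \<rho>: "3 / 4 < \<rho>" "\<rho> < 1" and T: "T > 2"
    and Z: "0 \<in> Z" "shift Z B = T" and w: "\<And>j. w j \<ge> 1"
    and reg: "\<And>n. n \<notin> Z \<Longrightarrow> shift Z n < T \<Longrightarrow> \<rho> * w n \<le> w (shift Z n) \<and> \<rho> * w (shift Z n) \<le> w n"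
    and slip: "\<And>n. n \<in> Z \<Longrightarrow> Suc (shift Z n) < T \<Longrightarrow>
      \<rho> * w n \<le> w (shift Z n) + w (Suc (shift Z n)) + 1 \<and> \<rho> * (w (shift Z n) + w (Suc (shift Z n)) + 1) \<le> w n"
  shows "\<exists>f f'. (\<forall>x. (f has_real_derivative f' x) (at x)) \<and> continuous_on UNIV f' \<and>
    (\<forall>x\<in>{0..1}. \<bar>f' x - 1\<bar> \<le> 2 * (1 / \<rho> - 1)) \<and> f' 0 < 1 \<and> f 0 = 0 \<and> (\<forall>x\<in>{0<..1}. f x < x) \<and>
    (\<forall>x\<in>{0..1}. f x \<in> spaces T w \<longrightarrow> x \<in> spaces T w)"
proof -
  define X where "X = left_end T w"
  define u where "u = 1 / total T w"
  define H where "H = shift Z"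
  \<comment> \<open>\<open>l n\<close> is the length of the interval to be mapped onto gap
    \<open>n\<close> and \<open>c n\<close> the required change of length; \<open>f\<close> adds
    these changes to the identity one after another.\<close>
  define l where "l n = X (H (Suc n)) - u - X (H n)" for n
  define c where "c n = w n * u - l n" for n
  have tot: "total T w > 0" using total_pos T w by simp
  have u: "u > 0" using tot by (simp add: u_def)
  have XS: "X (Suc i) = X i + w i * u + u" for i unfolding X_def u_def by (simp add: left_end_Suc)
  have XT: "X T = 1 + u" unfolding X_def u_def by (rule left_end_top[OF tot])
  have X0: "X 0 = 0" by (simp add: X_def)
  have wu: "w i * u \<ge> u" for i using w[of i] u by simp
  have "strict_mono X" by (rule strict_monoI_Suc) (use XS wu u in \<open>smt (verit)\<close>)
  then have Xless: "X i < X j \<longleftrightarrow> i < j" and Xle: "X i \<le> X j \<longleftrightarrow> i \<le> j" for i j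
    by (simp_all add: strict_mono_less strict_mono_less_eq)
  have H: "H 0 = 0" "H (Suc n) = H n + (if n \<in> Z then 2 else 1)" "H i < H j \<longleftrightarrow> i < j" "H i \<le> H j \<longleftrightarrow> i \<le> j" for i j n
    by (simp_all add: H_def shift_Suc strict_mono_less_eq[OF strict_mono_shift])
  have l_eq: "l n = (if n \<in> Z then (w (H n) + w (Suc (H n)) + 1) * u else w (H n) * u)" for n
    unfolding l_def H(2) by (auto simp: XS algebra_simps)
  have l_pos: "l n > 0" for n
    unfolding l_eq using u w[of "H n"] w[of "Suc (H n)"] by (auto intro!: mult_pos_pos)
  have ratio: "\<bar>c n / l n\<bar> \<le> 1 / \<rho> - 1" if n: "n < B" for n
  proof -
    have "H (Suc n) \<le> T" using H(4)[of "Suc n" B] n Z(2) unfolding H_def by simp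
    then have "if n \<in> Z then Suc (shift Z n) < T else shift Z n < T"
      unfolding H(2) unfolding H_def by (auto split: if_splits)
    then have *: "\<rho> * (w n * u) \<le> l n \<and> \<rho> * l n \<le> w n * u"
      using reg[of n] slip[of n] u unfolding l_eq H(2) H_def
      by (auto simp: mult.assoc[symmetric] split: if_splits)
    then have 1: "w n * u / l n \<le> 1 / \<rho>" "\<rho> \<le> w n * u / l n"
      using l_pos[of n] \<rho> by (auto simp: field_simps)
    have "c n / l n = w n * u / l n - 1" using l_pos[of n] by (simp add: c_def diff_divide_distrib)
    moreover have "1 - \<rho> \<le> 1 / \<rho> - 1"
    proof -
      have "(1 - \<rho>) * \<rho> \<le> (1 - \<rho>) * 1" using \<rho> by (intro mult_left_mono) auto
      then show ?thesis using \<rho> by (simp add: field_simps)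
    qed
    ultimately show ?thesis using 1 by (simp add: abs_le_iff)
  qed
  define E where "E n x = ease (n = 0) ((x - X (H n)) / l n)" for n x
  define E' where "E' n x = ease' (n = 0) ((x - X (H n)) / l n)" for n x
  define f where "f x = x + (\<Sum>n<B. c n * E n x)" for x
  define f' where "f' x = 1 + (\<Sum>n<B. c n * (E' n x * (1 / l n)))" for x
  have deriv: "(f has_real_derivative f' x) (at x)" for x
  proof -
    have dE: "(E n has_real_derivative E' n x * (1 / l n)) (at x)" for n
      unfolding E_def[abs_def] E'_def using l_pos[of n]
      by (intro DERIV_chain2[OF ease_deriv]) (auto intro!: derivative_eq_intros)
    show ?thesis unfolding f_def[abs_def] f'_def
      by (intro DERIV_add DERIV_ident DERIV_sum DERIV_cmult dE)
  qed
  have cont: "continuous_on UNIV f'"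
    unfolding f'_def[abs_def] E'_def
    by (intro continuous_intros continuous_on_compose2[OF continuous_ease']) (use l_pos in \<open>auto simp: less_imp_neq[THEN not_sym]\<close>)
  have past: "E n x = 1" "E' n x = 0" if "X (H (Suc n)) - u \<le> x" for n x
  proof -
    have "1 \<le> (x - X (H n)) / l n" using that l_pos[of n] unfolding l_def by (simp add: le_divide_eq)
    then show "E n x = 1" "E' n x = 0" unfolding E_def E'_def by (simp_all add: ease_bounds)
  qed
  have future: "E n x = 0" "E' n x = 0" if "x \<le> X (H n)" "n > 0" for n x
  proof -
    have "(x - X (H n)) / l n \<le> 0" using that l_pos[of n] by (simp add: divide_nonpos_pos)
    then show "E n x = 0" "E' n x = 0" unfolding E_def E'_def using that by (simp_all add: ease_bounds)
  qed
  have sum_c: "(\<Sum>n<m. c n) = X m - X (H m)" for m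
  proof (induction m)
    case (Suc m)
    then show ?case unfolding sum.lessThan_Suc by (simp add: c_def l_def XS)
  qed (simp add: X0 H)
  \<comment> \<open>Earlier transitions are complete and later ones have not begun, so a single term
    varies.\<close>
  have piece: "(\<Sum>n<B. c n * E n x) = (\<Sum>n<m. c n) + c m * E m x" "(\<Sum>n<B. c n * (E' n x * (1 / l n))) = c m * (E' m x * (1 / l m))"
    if m: "m < B" "m = 0 \<or> X (H m) - u \<le> x" "x \<le> X (H (Suc m))" for m x
  proof -
    have past': "E n x = 1 \<and> E' n x = 0" if "n < m" for n
    proof -
      have "X (H (Suc n)) \<le> X (H m)" using that by (simp add: Xle H del: H(2))
      then show ?thesis using past[of n x] m that by auto
    qed
    have fut: "E n x = 0 \<and> E' n x = 0" if "m < n" for n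
    proof -
      have "X (H (Suc m)) \<le> X (H n)" using that by (simp add: Xle H del: H(2))
      then show ?thesis using future[of x n] m that by auto
    qed
    have split: "{..<B} = {..<m} \<union> insert m {m<..<B}" using m by auto
    have S: "(\<Sum>n<B. g n) = (\<Sum>n<m. g n) + (g m + (\<Sum>n\<in>{m<..<B}. g n))" for g :: "nat \<Rightarrow> real"
      unfolding split by (subst sum.union_disjoint) auto
    have "(\<Sum>n<m. c n * E n x) = (\<Sum>n<m. c n)" by (intro sum.cong) (simp_all add: past')
    moreover have "(\<Sum>n\<in>{m<..<B}. c n * E n x) = 0" by (intro sum.neutral) (simp add: fut)
    ultimately show "(\<Sum>n<B. c n * E n x) = (\<Sum>n<m. c n) + c m * E m x" unfolding S[of "\<lambda>n. c n * E n x"] by simp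
    have "(\<Sum>n<m. c n * (E' n x * (1 / l n))) = 0" by (intro sum.neutral) (simp add: past')
    moreover have "(\<Sum>n\<in>{m<..<B}. c n * (E' n x * (1 / l n))) = 0" by (intro sum.neutral) (simp add: fut)
    ultimately show "(\<Sum>n<B. c n * (E' n x * (1 / l n))) = c m * (E' m x * (1 / l m))"
      unfolding S[of "\<lambda>n. c n * (E' n x * (1 / l n))"] by simp
  qed
  have B: "B > 0" using Z T by (cases B) auto
  have locate: "\<exists>m<B. X (H m) \<le> x \<and> x \<le> X (H (Suc m))" if "x \<in> {0..1}" for x
  proof -
    define m where "m = (LEAST m. x \<le> X (H (Suc m)))"
    have ex: "x \<le> X (H (Suc (B - 1)))" using B XT Z that u unfolding H_def by simp
    then have m: "x \<le> X (H (Suc m))" "m \<le> B - 1" unfolding m_def by (auto intro: LeastI Least_le)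
    have "X (H m) \<le> x"
    proof (cases m)
      case 0 then show ?thesis using that X0 H by simp
    next
      case (Suc k)
      then have "\<not> x \<le> X (H (Suc k))" using not_less_Least[of k "\<lambda>m. x \<le> X (H (Suc m))"] unfolding m_def[symmetric] by simp
      then show ?thesis using Suc by simp
    qed
    then show ?thesis using m B by (intro exI[of _ m]) auto
  qed
  have arg: "(x - X (H m)) / l m \<ge> 0" if "X (H m) \<le> x" for m x using that l_pos[of m] by simp
  have f'_bound: "\<bar>f' x - 1\<bar> \<le> 2 * (1 / \<rho> - 1)" if x: "x \<in> {0..1}" for x
  proof -
    obtain m where m: "m < B" "X (H m) \<le> x" "x \<le> X (H (Suc m))" using locate[OF x] by blast
    have "f' x - 1 = c m * (E' m x * (1 / l m))" unfolding f'_def using piece(2)[of m x] m u by simp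
    also have "\<dots> = c m / l m * E' m x" by simp
    finally have "\<bar>f' x - 1\<bar> = \<bar>c m / l m\<bar> * \<bar>E' m x\<bar>" by (simp add: abs_mult)
    also have "\<dots> \<le> (1 / \<rho> - 1) * 2"
    proof (rule mult_mono)
      show "0 \<le> 1 / \<rho> - 1" using \<rho> by (simp add: field_simps)
    qed (use ratio[OF m(1)] ease_bounds(10)[OF arg[OF m(2)]] in \<open>auto simp: E'_def\<close>)
    finally show ?thesis by simp
  qed
  \<comment> \<open>Because of the slip at \<open>0\<close>, the first interval is longer than its
    image.\<close>
  have c0: "c 0 < 0"
    unfolding c_def l_eq using Z(1) H u w[of 1] by (simp add: algebra_simps) (use u w[of 1] in \<open>smt (verit) mult_pos_pos\<close>)
  have f'0: "f' 0 < 1"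
  proof -
    have "f' 0 = 1 + c 0 * (E' 0 0 * (1 / l 0))" unfolding f'_def using piece(2)[of 0 0] B Xle[of 0 "H 1"] X0 by simp
    also have "E' 0 0 = 2" unfolding E'_def using X0 H by (simp add: ease_bounds)
    finally have "f' 0 = 1 + 2 * c 0 / l 0" by simp
    moreover have "2 * c 0 / l 0 < 0" using c0 l_pos[of 0] by (simp add: divide_neg_pos)
    ultimately show ?thesis by linarith
  qed
  have f0: "f 0 = 0"
  proof -
    have "E 0 0 = 0" unfolding E_def using X0 H by (simp add: ease_bounds)
    then show ?thesis unfolding f_def using piece(1)[of 0 0] B Xle[of 0 "H 1"] X0 by simp
  qed
  have fless: "f x < x" if x: "x \<in> {0<..1}" for x
  proof -
    obtain m where m: "m < B" "X (H m) \<le> x" "x \<le> X (H (Suc m))" using locate[of x] x by auto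
    let ?s = "E m x"
    have s: "0 \<le> ?s" "?s \<le> 1" unfolding E_def using ease_bounds(7,8) arg[OF m(2)] by auto
    have D: "X m - X (H m) < 0" if "m > 0" for m
      using shift_gt[OF Z(1) that] Xless[of m "H m"] unfolding H_def by simp
    have "c m = (\<Sum>n<Suc m. c n) - (\<Sum>n<m. c n)" by simp
    then have cm: "c m = (X (Suc m) - X (H (Suc m))) - (X m - X (H m))" unfolding sum_c .
    have "f x - x = (X m - X (H m)) + c m * ?s"
      unfolding f_def using piece(1)[of m x] m u sum_c[of m] by simp
    \<comment> \<open>A convex combination of the displacements at consecutive gap ends, which are
      negative except for the zero one at \<open>m = 0\<close>.\<close>
    also have "\<dots> = (1 - ?s) * (X m - X (H m)) + ?s * (X (Suc m) - X (H (Suc m)))"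
      unfolding cm by (simp add: algebra_simps)
    also have "\<dots> < 0"
    proof (cases m)
      case 0
      have "0 < (x - X (H 0)) / l 0" using x X0 H l_pos[of 0] by simp
      then have "0 < ?s" unfolding E_def 0 by (rule ease_bounds(9))
      then show ?thesis using D[of "Suc m"] X0 H(1) 0 by (simp add: mult_pos_neg)
    next
      case (Suc k)
      have "(1 - ?s) * (X m - X (H m)) \<le> 0" "?s * (X (Suc m) - X (H (Suc m))) \<le> 0"
        using s D[of m] D[of "Suc m"] Suc by (simp_all add: mult_nonneg_nonpos del: H(2))
      moreover have "(1 - ?s) * (X m - X (H m)) < 0 \<or> ?s * (X (Suc m) - X (H (Suc m))) < 0"
        using s D[of m] D[of "Suc m"] Suc by (cases "?s = 0") (simp_all add: mult_pos_neg del: H(2))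
      ultimately show ?thesis by linarith
    qed
    finally show ?thesis by simp
  qed
  have less1: "2 * (1 / \<rho> - 1) < 1" using \<rho> by (simp add: field_simps)
  have f'pos: "0 < f' x" if "x \<in> {0..1}" for x using f'_bound[OF that] less1 by linarith
  have mono: "f x < f y" if "0 \<le> x" "x < y" "y \<le> 1" for x y
  proof (rule DERIV_pos_imp_increasing[OF that(2)])
    fix z assume "x \<le> z" "z \<le> y"
    then show "\<exists>d. (f has_real_derivative d) (at z) \<and> 0 < d" using deriv f'pos[of z] that by (intro exI[of _ "f' z"]) auto
  qed
  have space: "x \<in> spaces T w" if x: "x \<in> {0..1}" and fx: "f x \<in> spaces T w" for x
  proof -
    obtain i where i: "1 \<le> i" "i < T" "X i - u < f x" "f x < X i"
      using fx unfolding spaces_def X_def u_def by auto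
    \<comment> \<open>Between two transitions \<open>f\<close> is a translation, taking the space
      before gap \<open>H m\<close> to the space before gap \<open>m\<close>. By monotonicity
      nothing else enters the latter.\<close>
    have trans: "f y = X m - X (H m) + y" if y: "X (H m) - u \<le> y" "y \<le> X (H m)" "0 < m" "m \<le> B" for m y
    proof -
      obtain k where k: "m = Suc k" using y by (cases m) auto
      have le: "X (H k) \<le> y"
      proof -
        have "l k > 0" by (rule l_pos)
        then show ?thesis using y unfolding l_def k by simp
      qed
      have "E k y = 1" using past[of k y] y k by simp
      then have "(\<Sum>n<B. c n * E n y) = (\<Sum>n<m. c n)" using piece(1)[of k y] y k le u by simp
      then show ?thesis unfolding f_def sum_c by simp
    qed
    \<comment> \<open>The image of \<open>f\<close> stops at \<open>X B - u\<close>, the right end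
      of gap \<open>B - 1\<close>, so it misses the spaces of index at least
      \<open>B\<close>.\<close>
    have "i < B"
    proof (rule ccontr)
      assume "\<not> i < B"
      have HB: "X (H B) = 1 + u" using XT Z by (simp add: H_def)
      have "f 1 = X B - u" using trans[of B 1] HB u B by simp
      moreover have "f x \<le> f 1" using mono[of x 1] x by (cases "x = 1") auto
      moreover have "X B \<le> X i" using \<open>\<not> i < B\<close> by (simp add: Xle)
      ultimately show False using i by simp
    qed
    have Hi: "0 < H i" "H i < T" using i \<open>i < B\<close> H(3)[of 0 i] H(3)[of i B] H(1) Z(2) unfolding H_def by auto
    have lo: "0 \<le> X (H i) - u"
    proof -
      obtain j where j: "H i = Suc j" using Hi by (cases "H i") auto
      show ?thesis unfolding j XS using Xle[of 0 j] X0 wu[of j] u by simp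
    qed
    have hi: "X (H i) \<le> 1"
    proof -
      have "X (Suc (H i)) \<le> X T" using Hi by (simp add: Xle)
      then show ?thesis unfolding XS XT using wu[of "H i"] u by linarith
    qed
    have "f (X (H i) - u) = X i - u" "f (X (H i)) = X i"
      using trans[of i "X (H i) - u"] trans[of i "X (H i)"] u i \<open>i < B\<close> by auto
    moreover have "\<not> x \<le> X (H i) - u"
    proof
      assume "x \<le> X (H i) - u"
      then have "f x \<le> f (X (H i) - u)" using mono[of x "X (H i) - u"] x hi u by (cases "x = X (H i) - u") auto
      then show False using calculation i by simp
    qed
    moreover have "\<not> X (H i) \<le> x"
    proof
      assume "X (H i) \<le> x"
      then have "f (X (H i)) \<le> f x" using mono[of "X (H i)" x] x lo u by (cases "x = X (H i)") auto
      then show False using calculation i by simp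
    qed
    ultimately have "x \<in> {X (H i) - u<..<X (H i)}" by auto
    then show ?thesis unfolding spaces_def X_def[symmetric] u_def[symmetric] using Hi by (intro UN_I[of "H i"]) auto
  qed
  show ?thesis
    using deriv cont f'_bound f'0 f0 fless space by (intro exI[of _ f] exI[of _ f']) blast
qed

section \<open>Minimal sets and proximity to the identity\<close>

lemma semigroup_gen_props:
  assumes C: "(f, g) \<in> class_C" and \<phi>: "\<phi> \<in> semigroup_gen f g"
  shows "continuous_on unit_I \<phi> \<and> \<phi> ` unit_I \<subseteq> unit_I \<and> (\<forall>M. f ` M \<subseteq> M \<longrightarrow> g ` M \<subseteq> M \<longrightarrow> \<phi> ` M \<subseteq> M)"
  using \<phi>
proof induction
  case (gen_comp \<phi> \<psi>)
  then have "continuous_on unit_I (\<phi> \<circ> \<psi>)"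
    by (intro continuous_on_compose) (auto intro: continuous_on_subset)
  moreover have "(\<phi> \<circ> \<psi>) ` A \<subseteq> A" if "\<phi> ` A \<subseteq> A" "\<psi> ` A \<subseteq> A" for A
    using that by (auto simp: image_subset_iff)
  ultimately show ?case using gen_comp.IH by simp
qed (use C in \<open>auto simp: class_C_def\<close>)

lemma forward_orbit_subset:
  assumes C: "(f, g) \<in> class_C" and M: "f ` M \<subseteq> M" "g ` M \<subseteq> M" "x \<in> M"
  shows "forward_orbit f g x \<subseteq> M"
  using semigroup_gen_props[OF C] M unfolding forward_orbit_def by blast

lemma closure_orbit_invariant:
  assumes C: "(f, g) \<in> class_C" and x: "x \<in> unit_I" and \<phi>: "\<phi> \<in> semigroup_gen f g"
  shows "\<phi> ` closure (forward_orbit f g x) \<subseteq> closure (forward_orbit f g x)"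
proof (rule image_closure_subset)
  have "forward_orbit f g x \<subseteq> unit_I"
    using forward_orbit_subset[OF C _ _ x] C by (auto simp: class_C_def)
  then have "closure (forward_orbit f g x) \<subseteq> unit_I" by (intro closure_minimal) auto
  then show "continuous_on (closure (forward_orbit f g x)) \<phi>"
    using conjunct1[OF semigroup_gen_props[OF C \<phi>]] by (rule continuous_on_subset[rotated])
  have "\<phi> ` forward_orbit f g x \<subseteq> forward_orbit f g x"
  proof
    fix y assume "y \<in> \<phi> ` forward_orbit f g x"
    then obtain \<psi> where "\<psi> \<in> semigroup_gen f g" "y = \<phi> (\<psi> x)" unfolding forward_orbit_def by auto
    then show "y \<in> forward_orbit f g x" unfolding forward_orbit_def
      using semigroup_gen.gen_comp[OF \<phi>, of \<psi>] by (intro CollectI exI[of _ "\<phi> \<circ> \<psi>"]) simp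
  qed
  then show "\<phi> ` forward_orbit f g x \<subseteq> closure (forward_orbit f g x)"
    using closure_subset by blast
qed simp

text \<open>The iterates of \<open>f\<close> decrease to a fixed point of \<open>f\<close>, which
  can only be \<open>0\<close>.\<close>

lemma zero_in_closure_orbit:
  assumes C: "(f, g) \<in> class_C" and x: "x \<in> unit_I"
  shows "0 \<in> closure (forward_orbit f g x)"
proof -
  have f: "continuous_on unit_I f" "f ` unit_I \<subseteq> unit_I" "f 0 = 0"
    "\<And>y. y \<in> unit_I \<Longrightarrow> y \<noteq> 0 \<Longrightarrow> f y < y" using C by (auto simp: class_C_def)
  define s where "s n = (f ^^ Suc n) x" for n
  have "f y \<in> unit_I" if "y \<in> unit_I" for y using f(2) that by blast
  then have s_I: "s n \<in> unit_I" for n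
    using x by (induction n) (simp_all add: s_def del: atLeastAtMost_iff)
  have s_Suc: "s (Suc n) = f (s n)" for n by (simp add: s_def)
  have gen: "f ^^ Suc n \<in> semigroup_gen f g" for n
  proof (induction n)
    case (Suc n)
    show ?case by (subst funpow.simps(2)) (rule semigroup_gen.gen_comp[OF semigroup_gen.gen_left Suc.IH])
  qed (simp add: semigroup_gen.gen_left)
  then have s_orbit: "s n \<in> forward_orbit f g x" for n unfolding forward_orbit_def s_def by blast
  have "decseq s"
  proof (rule decseq_SucI)
    fix n show "s (Suc n) \<le> s n" using f(3) f(4)[OF s_I[of n]] s_Suc[of n] by (cases "s n = 0") auto
  qed
  then obtain p where p: "s \<longlonglongrightarrow> p"
    using decseq_convergent[of s 0] s_I by (metis atLeastAtMost_iff)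
  have pI: "p \<in> unit_I" by (rule closed_sequentially[OF _ s_I p]) simp
  have "(\<lambda>n. f (s n)) \<longlonglongrightarrow> f p"
    by (rule continuous_on_tendsto_compose[OF f(1) p pI]) (use s_I in auto)
  moreover have "(\<lambda>n. f (s n)) \<longlonglongrightarrow> p" using LIMSEQ_Suc[OF p] by (simp add: s_Suc)
  ultimately have "f p = p" by (rule LIMSEQ_unique)
  then have "p = 0" using f(4)[OF pI] by force
  then show ?thesis using p s_orbit unfolding closure_sequential by blast
qed

text \<open>All orbit closures contain \<open>0\<close>, hence also the orbit closure of
  \<open>0\<close>, which is therefore minimal; compactness and Zorn's lemma do not enter.\<close>

lemma exists_minimal_subset:
  assumes C: "(f, g) \<in> class_C" and M: "closed M" "M \<subseteq> unit_I" "0 \<in> M" "f ` M \<subseteq> M" "g ` M \<subseteq> M"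
  shows "\<exists>K \<subseteq> M. minimal_set f g K"
proof -
  let ?K = "closure (forward_orbit f g 0)"
  have KM: "?K \<subseteq> M" by (intro closure_minimal forward_orbit_subset[OF C]) (use M in auto)
  have "closure (forward_orbit f g x) = ?K" if x: "x \<in> ?K" for x
  proof
    have xI: "x \<in> unit_I" using x KM M by blast
    have "forward_orbit f g x \<subseteq> ?K"
      using closure_orbit_invariant[OF C, of 0] x unfolding forward_orbit_def by auto
    then show "closure (forward_orbit f g x) \<subseteq> ?K" by (intro closure_minimal) auto
    have "\<phi> 0 \<in> closure (forward_orbit f g x)" if "\<phi> \<in> semigroup_gen f g" for \<phi>
      using closure_orbit_invariant[OF C xI that] zero_in_closure_orbit[OF C xI] by blast
    then have "forward_orbit f g 0 \<subseteq> closure (forward_orbit f g x)"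
      by (subst forward_orbit_def) blast
    then show "?K \<subseteq> closure (forward_orbit f g x)" by (intro closure_minimal) auto
  qed
  moreover have "?K \<noteq> {}" using zero_in_closure_orbit[OF C, of 0] by auto
  ultimately show ?thesis using KM M(2) unfolding minimal_set_def by (intro exI[of _ ?K]) auto
qed

section \<open>C1 maps with positive derivative and their distance to the identity\<close>

context
  fixes f f' :: "real \<Rightarrow> real"
  assumes deriv: "\<And>x. (f has_real_derivative f' x) (at x)" and cont': "continuous_on UNIV f'"
begin

lemma deriv_I_eq: "x \<in> unit_I \<Longrightarrow> deriv_I f x = f' x"
  unfolding deriv_I_def
  using vector_derivative_within_cbox[of 0 1 x f "f' x"] has_field_derivative_at_within[OF deriv]
  by (simp add: has_real_derivative_iff_has_vector_derivative)

lemma strict_mono_on_unit: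
  assumes pos: "\<And>x. x \<in> unit_I \<Longrightarrow> 0 < f' x"
  shows "strict_mono_on unit_I f"
proof (rule strict_mono_onI)
  fix x y :: real assume xy: "x \<in> unit_I" "y \<in> unit_I" "x < y"
  show "f x < f y"
  proof (rule DERIV_pos_imp_increasing[OF xy(3)])
    fix z assume "x \<le> z" "z \<le> y"
    then show "\<exists>d. (f has_real_derivative d) (at z) \<and> 0 < d"
      using deriv pos[of z] xy by (intro exI[of _ "f' z"]) auto
  qed
qed

lemma continuous_on_unit: "continuous_on S f"
  by (intro continuous_at_imp_continuous_on ballI DERIV_isCont[OF deriv])

lemma diffeo_onto_image:
  assumes pos: "\<And>x. x \<in> unit_I \<Longrightarrow> 0 < f' x"
  shows "orientation_preserving_embedding f" "C1_diffeo_onto_image f"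
proof -
  note mono = strict_mono_on_unit[OF pos]
  have inj: "inj_on f unit_I" using mono strict_mono_on_imp_inj_on by blast
  define h where "h = inv_into unit_I f"
  have hf: "h (f x) = x" if "x \<in> unit_I" for x using that inj by (simp add: h_def)
  have cont_h: "continuous_on (f ` unit_I) h"
    by (rule continuous_on_inv) (use continuous_on_unit hf in auto)
  have "homeomorphism unit_I (f ` unit_I) f h"
    using cont_h continuous_on_unit hf by (auto simp: homeomorphism_def image_iff)
  then show "orientation_preserving_embedding f"
    using mono unfolding orientation_preserving_embedding_def by blast
  \<comment> \<open>The derivative is taken within the image, so it is obtained by substituting
    \<open>h\<close> into the one-sided difference quotient of \<open>f\<close> and
    inverting.\<close>
  have h_deriv: "(h has_real_derivative inverse (f' (h y))) (at y within f ` unit_I)" if y: "y \<in> f ` unit_I" for y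
  proof -
    obtain x where x: "x \<in> unit_I" "y = f x" using y by auto
    have quot: "((\<lambda>z. (f z - f x) / (z - x)) \<longlongrightarrow> f' x) (at x within unit_I)"
      using has_field_derivative_at_within[OF deriv[of x], of unit_I] by (simp add: has_field_derivative_iff)
    have "(h \<longlongrightarrow> h y) (at y within f ` unit_I)" using cont_h y unfolding continuous_on_def by blast
    moreover have "\<forall>\<^sub>F z in at y within f ` unit_I. h z \<in> unit_I \<and> h z \<noteq> x"
      unfolding eventually_at_filter by (rule always_eventually) (use hf x in auto)
    ultimately have "filterlim h (at x within unit_I) (at y within f ` unit_I)"
      unfolding filterlim_at using hf x by simp
    from filterlim_compose[OF quot this]
    have "((\<lambda>z. inverse ((f (h z) - f x) / (h z - x))) \<longlongrightarrow> inverse (f' x)) (at y within f ` unit_I)"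
      by (rule tendsto_inverse) (use pos[OF x(1)] in simp)
    moreover have "\<forall>\<^sub>F z in at y within f ` unit_I. inverse ((f (h z) - f x) / (h z - x)) = (h z - h y) / (z - y)"
      unfolding eventually_at_filter using hf x by (intro always_eventually) auto
    ultimately have "((\<lambda>z. (h z - h y) / (z - y)) \<longlongrightarrow> inverse (f' x)) (at y within f ` unit_I)"
      by (rule Lim_transform_eventually)
    then show ?thesis using hf x by (simp add: has_field_derivative_iff)
  qed
  have "h ` f ` unit_I \<subseteq> unit_I" using hf by auto
  moreover have "f' (h y) \<noteq> 0" if "y \<in> f ` unit_I" for y using that hf pos by force
  ultimately have "continuous_on (f ` unit_I) (\<lambda>y. inverse (f' (h y)))"
    using continuous_on_subset[OF cont'] by (intro continuous_on_inverse continuous_on_compose2[OF cont' cont_h]) auto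
  then have "C1_within (f ` unit_I) h"
    unfolding C1_within_def by (intro exI[of _ "\<lambda>y. inverse (f' (h y))"] conjI ballI h_deriv)
  moreover have "C1_within unit_I f"
    unfolding C1_within_def using has_field_derivative_at_within[OF deriv] continuous_on_subset[OF cont'] by blast
  ultimately show "C1_diffeo_onto_image f"
    unfolding C1_diffeo_onto_image_def using inj by (simp add: h_def)
qed

text \<open>The mean value inequality, started at the fixed point \<open>p\<close>, bounds the
  displacement by the deviation of the derivative from \<open>1\<close>. For the lower bound, both
  suprema have to be over bounded sets.\<close>

lemma d_C1_le:
  assumes p: "p \<in> unit_I" "f p = p" and bound: "\<And>x. x \<in> unit_I \<Longrightarrow> \<bar>f' x - 1\<bar> \<le> B"
  shows "d_C1 f \<le> 2 * B" "0 \<le> d_C1 f"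
proof -
  have dist: "\<bar>f x - x\<bar> \<le> B" if x: "x \<in> unit_I" for x
  proof -
    have "norm ((f x - x) - (f p - p)) \<le> B * norm (x - p)"
    proof (rule field_differentiable_bound[where S = unit_I and f = "\<lambda>x. f x - x" and f' = "\<lambda>x. f' x - 1"])
      fix z show "((\<lambda>x. f x - x) has_real_derivative f' z - 1) (at z within unit_I)"
        by (rule has_field_derivative_at_within[OF DERIV_diff[OF deriv DERIV_ident]])
    qed (use x p bound in auto)
    also have "\<dots> \<le> B * 1" using x p bound[OF x] by (intro mult_left_mono) auto
    finally show ?thesis using p by simp
  qed
  have 1: "(SUP x\<in>unit_I. \<bar>f x - x\<bar>) \<le> B" by (rule cSUP_least) (use dist in auto)
  have 2: "(SUP x\<in>unit_I. \<bar>deriv_I f x - 1\<bar>) \<le> B"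
    by (rule cSUP_least) (use bound in \<open>auto simp: deriv_I_eq\<close>)
  show "d_C1 f \<le> 2 * B" using 1 2 unfolding d_C1_def by simp
  have "0 \<le> \<bar>f 0 - 0\<bar>" by simp
  also have "\<dots> \<le> (SUP x\<in>unit_I. \<bar>f x - x\<bar>)"
    by (rule cSUP_upper[of 0 unit_I "\<lambda>x. \<bar>f x - x\<bar>"]) (use dist in \<open>auto intro!: bdd_aboveI2[where M = B]\<close>)
  finally have 3: "0 \<le> (SUP x\<in>unit_I. \<bar>f x - x\<bar>)" .
  have "0 \<le> \<bar>deriv_I f 0 - 1\<bar>" by simp
  also have "\<dots> \<le> (SUP x\<in>unit_I. \<bar>deriv_I f x - 1\<bar>)"
    by (rule cSUP_upper[of 0 unit_I "\<lambda>x. \<bar>deriv_I f x - 1\<bar>"]) (use bound in \<open>auto intro!: bdd_aboveI2[where M = B] simp: deriv_I_eq\<close>)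
  finally show "0 \<le> d_C1 f" using 3 unfolding d_C1_def by simp
qed

end

section \<open>Mirror image of the layout, and assembly of the pair\<close>

lemma left_end_mirror:
  assumes tot: "total T w > 0" and i: "i \<le> T"
  shows "left_end T (\<lambda>n. w (T - 1 - n)) i = 1 + 1 / total T w - left_end T w (T - i)"
proof -
  have tt: "total T (\<lambda>n. w (T - 1 - n)) = total T w"
    unfolding total_def using sum.nat_diff_reindex[of "\<lambda>n. w n + 1" T] by simp
  show ?thesis using i
  proof (induction i)
    case 0
    then show ?case using left_end_top[OF tot] by simp
  next
    case (Suc i)
    then have "T - i = Suc (T - 1 - i)" by simp
    then have "left_end T w (T - i) = left_end T w (T - 1 - i) + w (T - 1 - i) / total T w + 1 / total T w"
      by (simp only: left_end_Suc)
    then show ?case using Suc by (simp add: left_end_Suc tt[simplified])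
  qed
qed

text \<open>Allows \<open>g\<close> to be built as a contracting map for the reversed weights and
  then conjugated by \<open>x \<mapsto> 1 - x\<close>, with the same spaces as for
  \<open>f\<close>.\<close>

lemma spaces_mirror:
  assumes tot: "total T w > 0"
  shows "x \<in> spaces T (\<lambda>n. w (T - 1 - n)) \<longleftrightarrow> 1 - x \<in> spaces T w"
proof -
  have tt: "total T (\<lambda>n. w (T - 1 - n)) = total T w"
    unfolding total_def using sum.nat_diff_reindex[of "\<lambda>n. w n + 1" T] by simp
  have "x \<in> spaces T (\<lambda>n. w (T - 1 - n)) \<longleftrightarrow>
      (\<exists>i\<in>{1..<T}. 1 - x \<in> {left_end T w (T - i) - 1 / total T w<..<left_end T w (T - i)})"
    unfolding spaces_def tt UN_iff
  proof (rule bex_cong[OF refl])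
    fix i assume "i \<in> {1..<T}"
    then have l: "left_end T (\<lambda>n. w (T - 1 - n)) i = 1 + 1 / total T w - left_end T w (T - i)"
      by (intro left_end_mirror[OF tot]) simp
    show "x \<in> {left_end T (\<lambda>n. w (T - 1 - n)) i - 1 / total T w<..<left_end T (\<lambda>n. w (T - 1 - n)) i} \<longleftrightarrow>
        1 - x \<in> {left_end T w (T - i) - 1 / total T w<..<left_end T w (T - i)}"
      unfolding l by auto
  qed
  also have "\<dots> \<longleftrightarrow> (\<exists>j\<in>{1..<T}. 1 - x \<in> {left_end T w j - 1 / total T w<..<left_end T w j})"
  proof (rule iffI; elim bexE)
    fix i assume "i \<in> {1..<T}" "1 - x \<in> {left_end T w (T - i) - 1 / total T w<..<left_end T w (T - i)}"
    then show "\<exists>j\<in>{1..<T}. 1 - x \<in> {left_end T w j - 1 / total T w<..<left_end T w j}"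
      by (intro bexI[of _ "T - i"]) auto
  next
    fix j assume "j \<in> {1..<T}" "1 - x \<in> {left_end T w j - 1 / total T w<..<left_end T w j}"
    then show "\<exists>i\<in>{1..<T}. 1 - x \<in> {left_end T w (T - i) - 1 / total T w<..<left_end T w (T - i)}"
      by (intro bexI[of _ "T - j"]) auto
  qed
  finally show ?thesis unfolding spaces_def by simp
qed

lemma exists_pair_near_identity:
  fixes \<rho> :: real
  assumes \<rho>: "3 / 4 < \<rho>" "\<rho> < 1"
  shows "\<exists>f g. (f, g) \<in> class_D \<and> \<bar>d_C1 f\<bar> \<le> 4 * (1 / \<rho> - 1) \<and> \<bar>d_C1 g\<bar> \<le> 4 * (1 / \<rho> - 1) \<and>
    (\<exists>M. minimal_set f g M \<and> M \<noteq> unit_I)"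
proof -
  define \<Lambda> where "\<Lambda> = max 3 (2 / (1 - \<rho>))"
  have \<Lambda>: "3 \<le> \<Lambda>" "2 \<le> \<Lambda> * (1 - \<rho>)" using \<rho> by (auto simp: \<Lambda>_def pos_divide_le_eq[symmetric])
  obtain N where N: "\<rho> ^ N < 1 / \<Lambda>" using real_arch_pow_inv[of "1 / \<Lambda>" \<rho>] \<Lambda>(1) \<rho> by auto
  have \<Lambda>N: "\<Lambda> * \<rho> ^ N \<le> 1" using N \<Lambda>(1) by (simp add: field_simps)
  define L where "L = 2 * N + 2"
  \<comment> \<open>\<open>R\<close> depends on \<open>L\<close> only, and \<open>E\<close> is then
    taken large compared with both, which keeps slips of one side farther apart than
    \<open>one_relevant_slip\<close> permits.\<close>
  define R where "R = 4 * card (short_words L) * (8 * 4 ^ L + 1) + 1"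
  obtain E0 :: nat where E0: "real R + 2 ^ L * (8 * 4 ^ L + real R) < real E0" using reals_Archimedean2 by blast
  define E where "E = E0 + 2 * L + 1"
  obtain bad where ref: "reference (ref_a E) E bad" using exists_reference[of E] by (auto simp: E_def)
  have "\<exists>T Z. slip_system N T Z"
    by (rule reference.exists_slip_system[OF ref L_def, of R]) (use E0 in \<open>auto simp: E_def R_def\<close>)
  then obtain T Z where sys: "slip_system N T Z" by blast
  have T: "T > 2" using sys unfolding slip_system_def by blast
  have Z: "0 \<in> Z b" for b using sys unfolding slip_system_def by blast
  have Z_top: "\<exists>n. shift (Z b) n = T" for b using sys unfolding slip_system_def by blast
  have sep: "(x, y) \<notin> step_rel T Z ^^ k" if "i \<in> inner_slips T Z" "j \<in> inner_slips T Z" "i \<noteq> j"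
    "x \<in> slip_ends T Z i" "y \<in> slip_ends T Z j" "k \<le> 2 * N" for i j x y k
    using sys that unfolding slip_system_def by blast
  have one: False if "i \<in> inner_slips T Z" "k \<le> 2 * N" "k' \<le> 2 * N"
    "(slip_dom T i, slip_rng T Z 0 i) \<in> step_rel T Z ^^ k" "(slip_dom T i, slip_rng T Z 1 i) \<in> step_rel T Z ^^ k'"
    for i k k'
    using sys that unfolding slip_system_def by blast
  have "\<exists>w :: nat \<Rightarrow> real. (\<forall>v. 1 \<le> w v) \<and> (\<forall>(n, m)\<in>step_rel T Z. \<rho> * w n \<le> w m) \<and>
    (\<forall>i\<in>inner_slips T Z. \<rho> * w (slip_dom T i) \<le> w (slip_rng T Z 0 i) + w (slip_rng T Z 1 i) + 1 \<and>
       \<rho> * (w (slip_rng T Z 0 i) + w (slip_rng T Z 1 i) + 1) \<le> w (slip_dom T i))"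
  proof (rule exists_weights[where d = "slip_dom T" and r = "slip_rng T Z", OF _ \<rho>(2) \<Lambda> \<Lambda>N])
    show "0 < \<rho>" using \<rho> by simp
    show "(x, y) \<notin> step_rel T Z ^^ k" if "i \<in> inner_slips T Z" "j \<in> inner_slips T Z" "i \<noteq> j"
      "x \<in> {slip_dom T i, slip_rng T Z 0 i, slip_rng T Z 1 i}"
      "y \<in> {slip_dom T j, slip_rng T Z 0 j, slip_rng T Z 1 j}" "k \<le> 2 * N" for i j x y k
      using sep[of i j x y k] that unfolding slip_ends_def by simp
  qed (rule one)
  then obtain w :: "nat \<Rightarrow> real" where w: "\<And>v. 1 \<le> w v"
    and w_step: "\<And>n m. (n, m) \<in> step_rel T Z \<Longrightarrow> \<rho> * w n \<le> w m"
    and w_slip: "\<And>i. i \<in> inner_slips T Z \<Longrightarrow> \<rho> * w (slip_dom T i) \<le> w (slip_rng T Z 0 i) + w (slip_rng T Z 1 i) + 1 \<and>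
       \<rho> * (w (slip_rng T Z 0 i) + w (slip_rng T Z 1 i) + 1) \<le> w (slip_dom T i)"
    by blast
  \<comment> \<open>The same weights read from side \<open>b\<close>; with \<open>b = True\<close>
    they run from right to left.\<close>
  define v where "v b n = w (flip_gap T b n)" for b n
  have "\<exists>f f'. (\<forall>x. (f has_real_derivative f' x) (at x)) \<and> continuous_on UNIV f' \<and>
    (\<forall>x\<in>{0..1}. \<bar>f' x - 1\<bar> \<le> 2 * (1 / \<rho> - 1)) \<and> f' 0 < 1 \<and> f 0 = 0 \<and> (\<forall>x\<in>{0<..1}. f x < x) \<and>
    (\<forall>x\<in>{0..1}. f x \<in> spaces T (v b) \<longrightarrow> x \<in> spaces T (v b))" for b
  proof -
    obtain B where B: "shift (Z b) B = T" using Z_top by blast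
    show ?thesis
    proof (rule exists_contracting_map[OF \<rho> T Z B])
      show "1 \<le> v b j" for j using w by (simp add: v_def)
      show "\<rho> * v b n \<le> v b (shift (Z b) n) \<and> \<rho> * v b (shift (Z b) n) \<le> v b n"
        if "n \<notin> Z b" "shift (Z b) n < T" for n
      proof -
        have "step T Z (b, False) (flip_gap T b n) (flip_gap T b (shift (Z b) n))"
          using that by (auto simp: step_def forward_step_def)
        then have "(flip_gap T b n, flip_gap T b (shift (Z b) n)) \<in> step_rel T Z"
          unfolding step_rel_def by blast
        then show ?thesis using w_step symD[OF sym_step_rel] unfolding v_def by blast
      qed
      show "\<rho> * v b n \<le> v b (shift (Z b) n) + v b (Suc (shift (Z b) n)) + 1 \<and>
          \<rho> * (v b (shift (Z b) n) + v b (Suc (shift (Z b) n)) + 1) \<le> v b n"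
        if "n \<in> Z b" "Suc (shift (Z b) n) < T" for n
        using w_slip[of "(b, n)"] that by (simp add: inner_slips_def slip_dom_def slip_rng_def v_def)
    qed
  qed
  then obtain F F' where F: "\<And>b x. (F b has_real_derivative F' b x) (at x)" "\<And>b. continuous_on UNIV (F' b)"
      "\<And>b x. x \<in> unit_I \<Longrightarrow> \<bar>F' b x - 1\<bar> \<le> 2 * (1 / \<rho> - 1)" "\<And>b. F' b 0 < 1" "\<And>b. F b 0 = 0"
      "\<And>b x. x \<in> {0<..1} \<Longrightarrow> F b x < x"
      "\<And>b x. x \<in> unit_I \<Longrightarrow> F b x \<in> spaces T (v b) \<Longrightarrow> x \<in> spaces T (v b)"
    by metis
  have less1: "2 * (1 / \<rho> - 1) < 1" using \<rho> by (simp add: field_simps)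
  have F'pos: "0 < F' b x" if "x \<in> unit_I" for b x using F(3)[OF that, of b] less1 by linarith
  have F_pos: "0 < F b x" if "x \<in> {0<..1}" for b x
    using strict_mono_onD[OF strict_mono_on_unit[OF F(1) F(2) F'pos], of 0 x b] that F(5) by simp
  define f where "f = F False"
  define g where "g x = 1 - F True (1 - x)" for x
  define g' where "g' x = F' True (1 - x)" for x
  have g_deriv: "(g has_real_derivative g' x) (at x)" for x
  proof -
    have "((\<lambda>x. F True (1 - x)) has_real_derivative F' True (1 - x) * (- 1)) (at x)"
      by (rule DERIV_chain2[OF F(1)]) (auto intro!: derivative_eq_intros)
    then show ?thesis unfolding g_def[abs_def] g'_def by (auto intro!: derivative_eq_intros)
  qed
  have g'_cont: "continuous_on UNIV g'" unfolding g'_def[abs_def]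
    by (intro continuous_on_compose2[OF F(2)] continuous_intros) auto
  have g'pos: "0 < g' x" if "x \<in> unit_I" for x unfolding g'_def using that by (intro F'pos) auto
  have f_low: "0 < f x \<and> f x < x" if "x \<in> unit_I" "x \<noteq> 0" for x
    using that F(6)[of x False] F_pos[of x False] unfolding f_def by auto
  have g_low: "x < g x \<and> g x < 1" if "x \<in> unit_I" "x \<noteq> 1" for x
    using that F(6)[of "1 - x" True] F_pos[of "1 - x" True] unfolding g_def by auto
  have f0: "f 0 = 0" and g1: "g 1 = 1" using F(5) by (auto simp: f_def g_def)
  have "f x \<in> unit_I" if "x \<in> unit_I" for x using f_low[OF that] f0 that by (cases "x = 0") auto
  then have f_I: "f ` unit_I \<subseteq> unit_I" by blast
  have "g x \<in> unit_I" if "x \<in> unit_I" for x using g_low[OF that] g1 that by (cases "x = 1") auto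
  then have g_I: "g ` unit_I \<subseteq> unit_I" by blast
  note df = F(1)[of False, folded f_def] and dg = g_deriv
  have C: "(f, g) \<in> class_C"
    unfolding class_C_def mem_Collect_eq prod.case
    by (intro conjI ballI impI continuous_on_unit[OF df F(2)] continuous_on_unit[OF dg g'_cont] f_I g_I f0 g1
        f_low[THEN conjunct1] f_low[THEN conjunct2] g_low[THEN conjunct1] g_low[THEN conjunct2]
        diffeo_onto_image(1)[OF df F(2) F'pos] diffeo_onto_image(1)[OF dg g'_cont g'pos])
  have "deriv_I f 0 \<in> {0<..<1}" using deriv_I_eq[OF df F(2), of 0] F(4) F'pos[of 0 False] by simp
  moreover have "deriv_I g 1 \<in> {0<..<1}" using deriv_I_eq[OF dg g'_cont, of 1] F(4)[of True] g'pos[of 1] by (simp add: g'_def)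
  ultimately have D: "(f, g) \<in> class_D"
    unfolding class_D_def using C diffeo_onto_image(2)[OF df F(2) F'pos] diffeo_onto_image(2)[OF dg g'_cont g'pos] by simp
  have df1: "\<bar>d_C1 f\<bar> \<le> 4 * (1 / \<rho> - 1)"
    using d_C1_le[OF df F(2), of 0 "2 * (1 / \<rho> - 1)"] f0 F(3) by simp
  have "\<bar>g' x - 1\<bar> \<le> 2 * (1 / \<rho> - 1)" if "x \<in> unit_I" for x unfolding g'_def using that by (intro F(3)) auto
  then have dg1: "\<bar>d_C1 g\<bar> \<le> 4 * (1 / \<rho> - 1)"
    using d_C1_le[OF dg g'_cont, of 1 "2 * (1 / \<rho> - 1)"] g1 by simp
  have v: "v False = w" "v True = (\<lambda>n. w (T - 1 - n))" by (auto simp: v_def flip_gap_def)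
  have tot: "total T w > 0" using total_pos T w by simp
  define M where "M = unit_I - spaces T w"
  have "open (spaces T w)" unfolding spaces_def by auto
  then have "closed M" unfolding M_def by (intro closed_Diff) auto
  have mono: "left_end T w i \<le> left_end T w (Suc i)" for i
    using w[of i] tot by (simp add: left_end_Suc)
  have le: "left_end T w i \<le> left_end T w j" if "i \<le> j" for i j
    using lift_Suc_mono_le[of "left_end T w" i j] mono that by blast
  have X1: "left_end T w 1 = w 0 / total T w + 1 / total T w" using left_end_Suc[of T w 0] by simp
  have "0 \<notin> spaces T w"
  proof
    assume "0 \<in> spaces T w"
    then obtain i where "i \<in> {1..<T}" "left_end T w i - 1 / total T w < 0" unfolding spaces_def by auto
    moreover have "0 < w 0 / total T w" using w[of 0] tot by simp
    ultimately show False using le[of 1 i] X1 by simp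
  qed
  then have "0 \<in> M" by (simp add: M_def)
  have "f ` M \<subseteq> M" using f_I F(7)[of _ False] unfolding M_def v f_def by blast
  moreover have "g ` M \<subseteq> M"
  proof
    fix y assume "y \<in> g ` M"
    then obtain x where x: "x \<in> unit_I" "x \<notin> spaces T w" "y = g x" unfolding M_def by auto
    have "1 - x \<notin> spaces T (v True)" unfolding v spaces_mirror[OF tot] using x by simp
    then have "F True (1 - x) \<notin> spaces T (v True)" using F(7)[of "1 - x" True] x by auto
    then have "y \<notin> spaces T w" unfolding v spaces_mirror[OF tot] x(3) g_def .
    then show "y \<in> M" using g_I x unfolding M_def by blast
  qed
  ultimately obtain K where K: "K \<subseteq> M" "minimal_set f g K"
    using exists_minimal_subset[OF C \<open>closed M\<close> _ \<open>0 \<in> M\<close>] unfolding M_def by blast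
  have "K \<noteq> unit_I"
  proof
    assume "K = unit_I"
    \<comment> \<open>The midpoint of the space between the first two gaps.\<close>
    define x where "x = left_end T w 1 - 1 / (2 * total T w)"
    have "x \<in> {left_end T w 1 - 1 / total T w<..<left_end T w 1}"
      unfolding x_def using tot by (simp add: field_simps)
    then have "x \<in> spaces T w" unfolding spaces_def using T by (intro UN_I[of 1]) auto
    moreover have "x \<in> unit_I"
    proof -
      have "left_end T w 2 \<le> 1 + 1 / total T w" using le[of 2 T] T left_end_top[OF tot] by simp
      moreover have "left_end T w 2 = left_end T w 1 + w 1 / total T w + 1 / total T w"
        using left_end_Suc[of T w 1] by (simp add: numeral_2_eq_2)
      moreover have "0 < w 0 / total T w" "0 < w 1 / total T w" "0 < 1 / (2 * total T w)"
        "1 / (2 * total T w) < 1 / total T w" using w[of 0] w[of 1] tot by (auto simp: field_simps)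
      ultimately show ?thesis unfolding x_def using X1 by auto
    qed
    ultimately show False using \<open>K = unit_I\<close> K(1) unfolding M_def by blast
  qed
  then show ?thesis using D df1 dg1 K(2) by blast
qed

theorem mainTheorem1:
  "\<exists>f g :: nat \<Rightarrow> real \<Rightarrow> real.
     (\<forall>n. (f n, g n) \<in> class_D) \<and>
     (\<lambda>n. d_C1 (f n)) \<longlonglongrightarrow> 0 \<and> (\<lambda>n. d_C1 (g n)) \<longlonglongrightarrow> 0 \<and>
     (\<forall>n. \<exists>M. minimal_set (f n) (g n) M \<and> M \<noteq> unit_I)"
proof -
  \<comment> \<open>The \<open>5\<close> makes the first value \<open>4 / 5\<close>, above the bound
    \<open>3 / 4\<close> that keeps derivatives positive.\<close>
  define \<rho> where "\<rho> n = 1 - 1 / (real n + 5)" for n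
  have "3 / 4 < \<rho> n \<and> \<rho> n < 1" for n by (simp add: \<rho>_def field_simps)
  then have "\<exists>p. p \<in> class_D \<and> \<bar>d_C1 (fst p)\<bar> \<le> 4 * (1 / \<rho> n - 1) \<and> \<bar>d_C1 (snd p)\<bar> \<le> 4 * (1 / \<rho> n - 1) \<and>
    (\<exists>M. minimal_set (fst p) (snd p) M \<and> M \<noteq> unit_I)" for n
    using exists_pair_near_identity[of "\<rho> n"] by auto
  then obtain p where p: "\<And>n. p n \<in> class_D" "\<And>n. \<bar>d_C1 (fst (p n))\<bar> \<le> 4 * (1 / \<rho> n - 1)"
    "\<And>n. \<bar>d_C1 (snd (p n))\<bar> \<le> 4 * (1 / \<rho> n - 1)"
    "\<And>n. \<exists>M. minimal_set (fst (p n)) (snd (p n)) M \<and> M \<noteq> unit_I" by metis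
  have lim: "(\<lambda>n. 4 * (1 / \<rho> n - 1)) \<longlonglongrightarrow> 0" unfolding \<rho>_def by real_asymp
  show ?thesis
  proof (rule exI[of _ "\<lambda>n. fst (p n)"], rule exI[of _ "\<lambda>n. snd (p n)"], intro conjI allI)
    show "(\<lambda>n. d_C1 (fst (p n))) \<longlonglongrightarrow> 0"
      by (rule Lim_null_comparison[OF _ lim]) (use p(2) in simp)
    show "(\<lambda>n. d_C1 (snd (p n))) \<longlonglongrightarrow> 0"
      by (rule Lim_null_comparison[OF _ lim]) (use p(3) in simp)
  qed (use p in auto)
qed

end
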